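(* Let $x,\mu,\lambda\in\mathbb{C}$ with $\mathrm{Re}(x)>0$ and $\mathrm{Re}(\mu+\lambda)>0$. Then $$2\sum_{n=1}^\infty\left(\frac{nx}{2}\right)^{-\lambda}{}_{\mu}K_{0}(nx,\lambda)-\frac{\pi\, 2^{\mu+\lambda}\,\Gamma(\lambda+\mu)}{x\,\Gamma(\lambda)}$$ $$=2^{\mu+\lambda}\frac{\Gamma\left(\frac{1}{2}+\lambda+\mu\right)}{\Gamma\left(\frac{1}{2}+\lambda\right)}\sum_{n=1}^\infty\frac{1}{n}\Bigg\{{}_2F_1\left(\frac{1}{2},\frac{1}{2}+\lambda+\mu;\frac{1}{2}+\lambda;-\frac{x^2}{4\pi^2n^2}\right)-1\Bigg\}$$ $$\qquad+\frac{2^{\mu+\lambda-1}\Gamma\left(\frac{1}{2}+\lambda+\mu\right)}{\Gamma\left(\lambda+\frac{1}{2}\right)}\left(2\left(\gamma+\log\left(\frac{x}{4\pi}\right)\right)-\psi\left(\lambda+\frac{1}{2}\right)+\psi\left(\lambda+\mu+\frac{1}{2}\right)\right).$$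
   Context: $\gamma$ is Euler's constant and $\psi=\Gamma'/\Gamma$ is the digamma function. All complex powers and logarithms are principal values. ${}_1F_2(a;b_1,b_2;\xi)=\sum_{n\ge0}\frac{(a)_n}{(b_1)_n(b_2)_n}\frac{\xi^n}{n!}$ with $(a)_n=a(a+1)\cdots(a+n-1)$. ${}_2F_1(a,b;c;\xi)$ is the Gauss hypergeometric function (principal branch on $|\arg(1-\xi)|<\pi$), given for $\mathrm{Re}(c)>\mathrm{Re}(b)>0$ by $\frac{\Gamma(c)}{\Gamma(b)\Gamma(c-b)}\int_0^1t^{b-1}(1-t)^{c-b-1}(1-t\xi)^{-a}\,dt$ and by analytic continuation in the parameters otherwise. $1/\Gamma$ is taken to be $0$ at the poles of $\Gamma$, and quotients such as ${}_2F_1(a,b;c;\xi)/\Gamma(c)$, $\psi(c)/\Gamma(c)$ or ${}_1F_2(a;b_1,b_2;\xi)/\Gamma(b_1)$ are understood by continuity when $c$ or $b_1$ is a nonpositive integer. For $z\in\mathbb{C}\setminus\mathbb{Z}$ and $x,\mu,\lambda\in\mathbb{C}$ with $\mu+\lambda\ne-\frac12,-\frac32,-\frac52,\ldots$, the two-parameter generalized modified Bessel function is $${}_{\mu}K_{z}(x,\lambda)=\frac{\pi x^\lambda 2^{\mu+z-1}}{\sin(z\pi)}\Bigg\{\left(\frac{x}{2}\right)^{-z}\frac{\Gamma(\mu+\lambda+\frac12)}{\Gamma(1-z)\Gamma(\lambda+\frac12-z)}\,{}_1F_2\left(\mu+\lambda+\tfrac12;\lambda+\tfrac12-z,1-z;\frac{x^2}{4}\right)$$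 $$\qquad-\left(\frac{x}{2}\right)^{z}\frac{\Gamma(\mu+z+\lambda+\frac12)}{\Gamma(1+z)\Gamma(\lambda+\frac12)}\,{}_1F_2\left(\mu+z+\lambda+\tfrac12;\lambda+\tfrac12,1+z;\frac{x^2}{4}\right)\Bigg\},$$ and ${}_{\mu}K_{0}(x,\lambda)=\lim_{z\to0}{}_{\mu}K_{z}(x,\lambda)$. *)

theory Defs
  imports "HOL-Complex_Analysis.Complex_Analysis"
begin

text \<open>
  The quotient \<open>f c / \<Gamma>(c)\<close>, understood by continuity in \<open>c\<close> where \<open>c\<close> is a pole of \<open>\<Gamma>\<close>.
  (HOL's \<open>Gamma\<close> is 0 at its poles, so plain division would always give 0 there.)
\<close>

definition div_Gamma :: "(complex \<Rightarrow> complex) \<Rightarrow> complex \<Rightarrow> complex" where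
  "div_Gamma f c =
     (if c \<in> \<int>\<^sub>\<le>\<^sub>0 then Lim (at c) (\<lambda>w. f w / Gamma w) else f c / Gamma c)"

definition hyp1F2 :: "complex \<Rightarrow> complex \<Rightarrow> complex \<Rightarrow> complex \<Rightarrow> complex" where
  "hyp1F2 a b1 b2 \<xi> =
     (\<Sum>n. pochhammer a n / (pochhammer b1 n * pochhammer b2 n) * (\<xi> ^ n / fact n))"

definition Euler_integral_2F1 :: "complex \<Rightarrow> complex \<Rightarrow> complex \<Rightarrow> complex \<Rightarrow> complex" where
  "Euler_integral_2F1 a b c \<xi> =
     Gamma c / (Gamma b * Gamma (c - b)) *
     integral {0..1} (\<lambda>t::real. complex_of_real t powr (b - 1) *
       (1 - complex_of_real t) powr (c - b - 1) * (1 - complex_of_real t * \<xi>) powr (- a))"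

text \<open>
  \<open>F\<close> continues the Euler integral, as a function of \<open>(b, c)\<close>, analytically from
  \<open>Re c > Re b > 0\<close> to all \<open>b\<close> and all \<open>c\<close> other than \<open>0, -1, -2, \<dots>\<close>; by Hartogs' theorem
  holomorphy in each variable is joint holomorphy.  (The integral is entire in \<open>a\<close> when \<open>\<xi>\<close> is
  off the cut \<open>[1, \<infinity>)\<close>, so no continuation in \<open>a\<close> is needed.)
\<close>

definition continues_2F1 ::
    "complex \<Rightarrow> complex \<Rightarrow> (complex \<Rightarrow> complex \<Rightarrow> complex) \<Rightarrow> bool" where
  "continues_2F1 a \<xi> F \<longleftrightarrow>
     (\<forall>c. c \<notin> \<int>\<^sub>\<le>\<^sub>0 \<longrightarrow> (\<lambda>b. F b c) holomorphic_on UNIV) \<and>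
     (\<forall>b. (\<lambda>c. F b c) holomorphic_on (- \<int>\<^sub>\<le>\<^sub>0)) \<and>
     (\<forall>b c. 0 < Re b \<longrightarrow> Re b < Re c \<longrightarrow> F b c = Euler_integral_2F1 a b c \<xi>)"

lemma continues_2F1_unique:
  assumes F: "continues_2F1 a \<xi> F" and G: "continues_2F1 a \<xi> G" and c: "c \<notin> \<int>\<^sub>\<le>\<^sub>0"
  shows "F b c = G b c"
proof -
  have op: "open (- \<int>\<^sub>\<le>\<^sub>0 :: complex set)"
    by (simp add: open_Compl)
  have right: "F b c = G b c" if "Re c > 0" for b c
  proof -
    have c': "c \<notin> \<int>\<^sub>\<le>\<^sub>0"
      using that by (auto elim!: nonpos_Ints_cases)
    let ?U = "{b. 0 < Re b} \<inter> {b. Re b < Re c}"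
    show ?thesis
    proof (rule analytic_continuation_open[of ?U UNIV "\<lambda>b. F b c" "\<lambda>b. G b c" b])
      show "open ?U"
        by (intro open_Int open_halfspace_Re_gt open_halfspace_Re_lt)
      have "complex_of_real (Re c / 2) \<in> ?U"
        using that by simp
      then show "?U \<noteq> {}" by blast
      show "(\<lambda>b. F b c) holomorphic_on UNIV" "(\<lambda>b. G b c) holomorphic_on UNIV"
        using F G c' by (auto simp: continues_2F1_def)
      show "F b c = G b c" if "b \<in> ?U" for b
        using F G that by (auto simp: continues_2F1_def)
    qed auto
  qed
  show ?thesis
  proof (rule analytic_continuation_open[of "{c. 0 < Re c}" "- \<int>\<^sub>\<le>\<^sub>0" "F b" "G b" c])
    show "open {c. 0 < Re c}" by (rule open_halfspace_Re_gt)
    have "(1::complex) \<in> {c. 0 < Re c}" by simp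
    then show "{c. 0 < Re c} \<noteq> ({} :: complex set)" by blast
    show "open (- \<int>\<^sub>\<le>\<^sub>0 :: complex set)" by (rule op)
    have "countable (\<int>\<^sub>\<le>\<^sub>0 :: complex set)"
      by (rule countable_subset[of _ \<int>]) (auto simp: Ints_def elim!: nonpos_Ints_cases)
    then show "connected (- \<int>\<^sub>\<le>\<^sub>0 :: complex set)"
      using connected_open_diff_countable[of "UNIV :: complex set" "\<int>\<^sub>\<le>\<^sub>0"]
      by (simp add: Compl_eq_Diff_UNIV connected_UNIV)
    show "{c. 0 < Re c} \<subseteq> (- \<int>\<^sub>\<le>\<^sub>0 :: complex set)"
      by (auto elim!: nonpos_Ints_cases)
    show "F b holomorphic_on - \<int>\<^sub>\<le>\<^sub>0" "G b holomorphic_on - \<int>\<^sub>\<le>\<^sub>0"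
      using F G by (auto simp: continues_2F1_def)
  qed (use c right in auto)
qed

text \<open>
  By the preceding lemma the choice does not matter for \<open>c\<close> outside \<open>0, -1, -2, \<dots>\<close>.
\<close>

definition hyp2F1 :: "complex \<Rightarrow> complex \<Rightarrow> complex \<Rightarrow> complex \<Rightarrow> complex" where
  "hyp2F1 a b c \<xi> = (SOME F. continues_2F1 a \<xi> F) b c"

definition gen_besselK_nonint :: "complex \<Rightarrow> complex \<Rightarrow> complex \<Rightarrow> complex \<Rightarrow> complex" where
  "gen_besselK_nonint \<mu> z x lam =
     of_real pi * x powr lam * 2 powr (\<mu> + z - 1) / sin (z * of_real pi) *
     ((x / 2) powr (- z) * (Gamma (\<mu> + lam + 1/2) / Gamma (1 - z)) *
        div_Gamma (\<lambda>b. hyp1F2 (\<mu> + lam + 1/2) b (1 - z) (x\<^sup>2 / 4)) (lam + 1/2 - z)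
      - (x / 2) powr z * (Gamma (\<mu> + z + lam + 1/2) / Gamma (1 + z)) *
        div_Gamma (\<lambda>b. hyp1F2 (\<mu> + z + lam + 1/2) b (1 + z) (x\<^sup>2 / 4)) (lam + 1/2))"

text \<open>Meaningful for \<open>z = 0\<close> and for \<open>z\<close> not an integer.\<close>

definition gen_besselK :: "complex \<Rightarrow> complex \<Rightarrow> complex \<Rightarrow> complex \<Rightarrow> complex" where
  "gen_besselK \<mu> z x lam =
     (if z = 0 then Lim (at 0) (\<lambda>w. gen_besselK_nonint \<mu> w x lam)
      else gen_besselK_nonint \<mu> z x lam)"

end

theory Submission
  imports Defs
begin

text \<open>
  Fix \<open>s = \<mu> + \<lambda> + 1/2\<close> and \<open>x\<close>, and let \<open>c = \<lambda> + 1/2\<close> vary. Up to elementary factors the limit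
  \<open>\<^sub>\<mu>K\<^sub>0(y, \<lambda>)\<close> is a logarithmic series that is entire in \<open>c\<close>, and for \<open>Re c > Re s\<close> it is the integral of
  \<open>K\<^sub>0(y \<surd>v)\<close> against \<open>v\<^bsup>s-1\<^esup> (1 - v)\<^bsup>c-s-1\<^esup>\<close>. Integrating the classical formula
  \<open>2 \<Sum> K\<^sub>0(nx) = \<pi>/x + \<gamma> + log(x/4\<pi>) + \<Sum> (1/n) ((1 + x\<^sup>2/(4\<pi>\<^sup>2n\<^sup>2))\<^bsup>-1/2\<^esup> - 1)\<close> against this weight turns
  the last summands into Euler integrals for \<open>\<^sub>2F\<^sub>1\<close> and \<open>log v\<close> into the difference of digamma values.
  Both sides are entire in \<open>c\<close>, so the result extends to all \<open>c\<close>. On the left the required local bounds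
  in \<open>c\<close> follow from a contiguous relation lowering \<open>c\<close> together with Cauchy's inequality in \<open>y\<close>.
  The classical formula comes from the partial fractions of \<open>1/(e\<^bsup>z\<^esup> - 1)\<close> with \<open>z = x cosh t\<close>:
  the partial sums minus the integral over \<open>[0, N]\<close> are dominated by \<open>2/z\<close>.
\<close>

subsection \<open>Holomorphic dependence on parameters and the Beta integral\<close>


text \<open>The obstacle is the range of the parameters. Integrals against the weight need Re c > Re
  s, which reads Re \<mu> < 0, while the claim covers every \<mu> with Re (\<mu> + \<lambda>) > 0,
  that is Re s > 1/2. This second condition is the one the integration really uses: K_0(n x sqrt v)
  is estimated by (n sqrt v)^(-2 \<sigma>), where 2 \<sigma> > 1 sums over n and \<sigma> < Re s
  keeps the integral against v^(s-1) finite, and pi / (x sqrt v) integrates to a multiple of Gamma(s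
  - 1/2). So s can stay fixed and only c has to be continued. For that, every quotient by Gamma(c)
  is expressed through \<open>rGamma\<close>, and psi(c) / Gamma(c) becomes
  \<open>- deriv rGamma c\<close>, which is entire. In the classical formula the partial fractions
  cannot be integrated one by one and summed, because their integrals behave like 1/(2 n);
  subtracting an integral over the index restores convergence. The limit z -> 0 and the integral
  representation meet only in the logarithmic series of K_0. Bessel's equation alone does not single
  out K_0; its behaviour at the origin does, and there Euler's constant enters.\<close>

lemma has_field_derivative_integral_param:
  fixes f :: "complex \<Rightarrow> 'a \<Rightarrow> complex"
  assumes r: "r > 0"
    and meas: "\<And>z. z \<in> ball z0 r \<Longrightarrow> f z \<in> borel_measurable M"
    and hol: "\<And>t. t \<in> space M \<Longrightarrow> (\<lambda>z. f z t) holomorphic_on ball z0 r"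
    and bd: "\<And>z t. z \<in> ball z0 r \<Longrightarrow> t \<in> space M \<Longrightarrow> norm (f z t) \<le> g t"
    and g: "integrable M g"
  shows "integrable M (\<lambda>t. deriv (\<lambda>z. f z t) z0)" (is ?A)
    and "((\<lambda>z. \<integral>t. f z t \<partial>M) has_field_derivative (\<integral>t. deriv (\<lambda>z. f z t) z0 \<partial>M)) (at z0)" (is ?B)
proof -
  have int: "integrable M (f z)" if "z \<in> ball z0 r" for z
    by (rule Bochner_Integration.integrable_bound[OF g meas[OF that]])
       (intro AE_I2 order.trans[OF bd[OF that] abs_ge_self[THEN order.trans]], auto)
  \<comment> \<open>Cauchy's inequality on discs of radius r/4 around points of the half ball bounds
    the derivative by \<open>4 / r * g t\<close>, so a multiple of the majorant of the functions
    also dominates their difference quotients.\<close>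
  have lip: "norm (f z t - f z0 t) \<le> (4 / r * g t) * norm (z - z0)"
    if z: "z \<in> ball z0 (r/2)" and t: "t \<in> space M" for z t
  proof (rule field_differentiable_bound)
    show "convex (ball z0 (r/2))" by simp
    fix w assume w: "w \<in> ball z0 (r/2)"
    have sub: "cball w (r/4) \<subseteq> ball z0 r"
    proof
      fix u assume "u \<in> cball w (r/4)"
      then have "dist z0 u \<le> dist z0 w + r/4" using dist_triangle[of z0 u w] by simp
      then show "u \<in> ball z0 r" using w r by simp
    qed
    have "w \<in> ball z0 r" using w r by simp
    then have "((\<lambda>z. f z t) has_field_derivative deriv (\<lambda>z. f z t) w) (at w)"
      using hol[OF t] holomorphic_derivI open_ball by blast
    then show "((\<lambda>z. f z t) has_field_derivative deriv (\<lambda>z. f z t) w) (at w within ball z0 (r/2))"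
      by (rule has_field_derivative_at_within)
    have "norm ((deriv ^^ 1) (\<lambda>z. f z t) w) \<le> fact 1 * g t / (r/4)^1"
    proof (rule Cauchy_inequality)
      show "(\<lambda>z. f z t) holomorphic_on ball w (r/4)"
        using hol[OF t] sub by (meson ball_subset_cball holomorphic_on_subset order_trans)
      show "continuous_on (cball w (r/4)) (\<lambda>z. f z t)"
        using hol[OF t] sub by (meson holomorphic_on_imp_continuous_on continuous_on_subset)
      show "0 < r/4" using r by simp
      show "norm (f u t) \<le> g t" if "cmod (w - u) = r/4" for u
        using sub that t by (intro bd) (auto simp: dist_norm)
    qed
    then show "norm (deriv (\<lambda>z. f z t) w) \<le> 4 / r * g t"
      by (simp add: field_simps)
  qed (use z r in auto)
  have main: "?A \<and> (\<lambda>i. ((\<integral>t. f (X i) t \<partial>M) - (\<integral>t. f z0 t \<partial>M)) / (X i - z0)) \<longlonglongrightarrow> (\<integral>t. deriv (\<lambda>z. f z t) z0 \<partial>M)"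
    if X: "\<And>i. X i \<noteq> z0" "X \<longlonglongrightarrow> z0" for X
  proof -
    \<comment> \<open>The value 0 while \<open>X i\<close> is still outside the half ball makes the
      domination hold for every \<open>i\<close>; only finitely many terms are affected.\<close>
    define s where "s i t = (if X i \<in> ball z0 (r/2) then (f (X i) t - f z0 t) / (X i - z0) else 0)" for i t
    have ev: "\<forall>\<^sub>F i in sequentially. X i \<in> ball z0 (r/2)"
      using X(2) r by (intro topological_tendstoD) auto
    have smeas: "s i \<in> borel_measurable M" for i
      using r meas[of "X i"] meas[of z0] unfolding s_def by (cases "X i \<in> ball z0 (r/2)") auto
    have slim: "(\<lambda>i. s i t) \<longlonglongrightarrow> deriv (\<lambda>z. f z t) z0" if t: "t \<in> space M" for t
    proof -
      have "((\<lambda>z. f z t) has_field_derivative deriv (\<lambda>z. f z t) z0) (at z0)"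
        using hol[OF t] holomorphic_derivI[of "\<lambda>z. f z t" "ball z0 r" z0] r by simp
      then have "(\<lambda>i. (f (X i) t - f z0 t) / (X i - z0)) \<longlonglongrightarrow> deriv (\<lambda>z. f z t) z0"
        using X unfolding has_field_derivative_iff tendsto_at_iff_sequentially by (auto simp: o_def)
      then show ?thesis
        by (rule Lim_transform_eventually) (use ev in eventually_elim, auto simp: s_def)
    qed
    have dmeas: "(\<lambda>t. deriv (\<lambda>z. f z t) z0) \<in> borel_measurable M"
      by (rule borel_measurable_LIMSEQ_metric[OF smeas slim])
    have sb: "AE t in M. norm (s i t) \<le> 4 / r * g t" for i
    proof (intro AE_I2)
      fix t assume t: "t \<in> space M"
      have "0 \<le> g t" using bd[of z0 t] r t norm_ge_zero order_trans by (metis centre_in_ball)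
      then show "norm (s i t) \<le> 4 / r * g t"
        using lip[of "X i" t] X(1)[of i] t r
        by (auto simp: s_def norm_divide divide_simps)
    qed
    have w: "integrable M (\<lambda>t. 4 / r * g t)" using g by simp
    have lims: "AE t in M. (\<lambda>i. s i t) \<longlonglongrightarrow> deriv (\<lambda>z. f z t) z0" using slim by (intro AE_I2)
    note dc = integrable_dominated_convergence[OF dmeas smeas w lims sb]
      integral_dominated_convergence[OF dmeas smeas w lims sb]
    have eq: "(\<integral>t. s i t \<partial>M) = ((\<integral>t. f (X i) t \<partial>M) - (\<integral>t. f z0 t \<partial>M)) / (X i - z0)"
      if "X i \<in> ball z0 (r/2)" for i
    proof -
      have "X i \<in> ball z0 r" "z0 \<in> ball z0 r" using that r by auto
      then show ?thesis using that int by (simp add: s_def)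
    qed
    have "(\<lambda>i. ((\<integral>t. f (X i) t \<partial>M) - (\<integral>t. f z0 t \<partial>M)) / (X i - z0)) \<longlonglongrightarrow> (\<integral>t. deriv (\<lambda>z. f z t) z0 \<partial>M)"
      by (rule Lim_transform_eventually[OF dc(2)]) (use ev in eventually_elim, auto simp: eq)
    with dc(1) show ?thesis by blast
  qed
  \<comment> \<open>Any sequence tending to z0 and avoiding it would do: it only serves to extract
    the integrability of the derivative from \<open>main\<close>.\<close>
  have X0: "(\<lambda>i. z0 + of_real (inverse (real (Suc i)))) \<longlonglongrightarrow> z0"
    using tendsto_add[OF tendsto_const tendsto_of_real[OF LIMSEQ_inverse_real_of_nat], of z0] by simp
  have "z0 + of_real (inverse (real (Suc i))) \<noteq> z0" for i
    by (simp del: of_nat_Suc)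
  from main[OF this X0] show ?A by blast
  show ?B unfolding has_field_derivative_iff tendsto_at_iff_sequentially
    using main by (auto simp: o_def)
qed

lemma holomorphic_on_integral_param:
  fixes f :: "complex \<Rightarrow> 'a \<Rightarrow> complex"
  assumes meas: "\<And>z. z \<in> A \<Longrightarrow> f z \<in> borel_measurable M" and A: "open A"
    and hol: "\<And>t. t \<in> space M \<Longrightarrow> (\<lambda>z. f z t) holomorphic_on A"
    and bd: "\<And>z0. z0 \<in> A \<Longrightarrow> \<exists>r g. r > 0 \<and> integrable M g \<and>
                (\<forall>z\<in>ball z0 r \<inter> A. \<forall>t\<in>space M. norm (f z t) \<le> g t)"
  shows "(\<lambda>z. \<integral>t. f z t \<partial>M) holomorphic_on A"
    and "z0 \<in> A \<Longrightarrow> integrable M (\<lambda>t. deriv (\<lambda>z. f z t) z0)"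
    and "z0 \<in> A \<Longrightarrow> ((\<lambda>z. \<integral>t. f z t \<partial>M) has_field_derivative (\<integral>t. deriv (\<lambda>z. f z t) z0 \<partial>M)) (at z0)"
    and "z0 \<in> A \<Longrightarrow> integrable M (f z0)"
proof -
  have *: "integrable M (\<lambda>t. deriv (\<lambda>z. f z t) z0) \<and> integrable M (f z0) \<and>
     ((\<lambda>z. \<integral>t. f z t \<partial>M) has_field_derivative (\<integral>t. deriv (\<lambda>z. f z t) z0 \<partial>M)) (at z0)"
    if z0: "z0 \<in> A" for z0
  proof -
    obtain r g where r: "r > 0" "integrable M g" "\<And>z t. z\<in>ball z0 r \<inter> A \<Longrightarrow> t\<in>space M \<Longrightarrow> norm (f z t) \<le> g t"
      using bd[OF z0] by blast
    obtain e where e: "e > 0" "ball z0 e \<subseteq> A" using A z0 openE by blast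
    have sub: "ball z0 (min r e) \<subseteq> A" "ball z0 (min r e) \<subseteq> ball z0 r" using e by auto
    note h = has_field_derivative_integral_param[of "min r e" z0 f M g]
    have "integrable M (f z0)"
      by (rule Bochner_Integration.integrable_bound[OF r(2) meas[OF z0]])
         (intro AE_I2 order.trans[OF r(3) abs_ge_self[THEN order.trans]], use z0 r(1) in auto)
    moreover have "integrable M (\<lambda>t. deriv (\<lambda>z. f z t) z0)"
      using sub by (intro h(1)) (use r e sub meas holomorphic_on_subset[OF hol] in auto)
    moreover have "((\<lambda>z. \<integral>t. f z t \<partial>M) has_field_derivative (\<integral>t. deriv (\<lambda>z. f z t) z0 \<partial>M)) (at z0)"
      using sub by (intro h(2)) (use r e sub meas holomorphic_on_subset[OF hol] in auto)
    ultimately show ?thesis by blast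
  qed
  show "(\<lambda>z. \<integral>t. f z t \<partial>M) holomorphic_on A"
    using * A by (auto simp: holomorphic_on_open)
  show "integrable M (\<lambda>t. deriv (\<lambda>z. f z t) z0)"
    "((\<lambda>z. \<integral>t. f z t \<partial>M) has_field_derivative (\<integral>t. deriv (\<lambda>z. f z t) z0 \<partial>M)) (at z0)"
    "integrable M (f z0)" if "z0 \<in> A" using *[OF that] by auto
qed

text \<open>Majorants that factor as \<open>a n * g t\<close> separate the decay in n from the size
  of the weight; the pointwise series and the series of integrated norms then converge
  together.\<close>

lemma sums_integral_bounded:
  fixes f :: "nat \<Rightarrow> 'a \<Rightarrow> complex"
  assumes meas: "\<And>n. f n \<in> borel_measurable M" and g: "integrable M g" and a: "summable a"
    and bd: "\<And>n t. t \<in> space M \<Longrightarrow> norm (f n t) \<le> a n * g t"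
  shows "(\<lambda>n. \<integral>t. f n t \<partial>M) sums (\<integral>t. (\<Sum>n. f n t) \<partial>M)"
    and "integrable M (\<lambda>t. \<Sum>n. f n t)"
    and "t \<in> space M \<Longrightarrow> summable (\<lambda>n. f n t)"
    and "integrable M (f n)"
proof -
  have int: "integrable M (f n)" for n
  proof (rule Bochner_Integration.integrable_bound)
    show "integrable M (\<lambda>t. a n * g t)" by (intro integrable_mult_right g)
    show "AE t in M. norm (f n t) \<le> norm (a n * g t)"
      by (intro AE_I2 order.trans[OF bd]) auto
  qed (rule meas)
  have sn: "summable (\<lambda>n. norm (f n t))" if "t \<in> space M" for t
  proof (rule summable_comparison_test'[where N=0])
    show "summable (\<lambda>n. a n * g t)" by (intro summable_mult2 a)
    show "norm (norm (f n t)) \<le> a n * g t" for n using bd[OF that] by simp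
  qed
  have AEs: "AE t in M. summable (\<lambda>n. norm (f n t))" using sn by (rule AE_I2)
  have si: "summable (\<lambda>n. \<integral>t. norm (f n t) \<partial>M)"
  proof (rule summable_comparison_test'[where N=0])
    show "summable (\<lambda>n. a n * (\<integral>t. g t \<partial>M))" by (intro summable_mult2 a)
    fix n
    have "(\<integral>t. norm (f n t) \<partial>M) \<le> (\<integral>t. a n * g t \<partial>M)"
      by (intro integral_mono integrable_norm int integrable_mult_right g bd)
    then show "norm (\<integral>t. norm (f n t) \<partial>M) \<le> a n * (\<integral>t. g t \<partial>M)" by simp
  qed
  show "(\<lambda>n. \<integral>t. f n t \<partial>M) sums (\<integral>t. (\<Sum>n. f n t) \<partial>M)" by (rule sums_integral[OF int AEs si])
  show "integrable M (\<lambda>t. \<Sum>n. f n t)" by (rule integrable_suminf[OF int AEs si])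
  show "summable (\<lambda>n. f n t)" if "t \<in> space M" using sn[OF that] by (rule summable_norm_cancel)
  show "integrable M (f n)" by (rule int)
qed

lemma Re_pos_notin_nonpos_Ints: "Re z > 0 \<Longrightarrow> z \<notin> \<int>\<^sub>\<le>\<^sub>0"
  by (auto elim!: nonpos_Ints_cases)

lemma rGamma_mult_Gamma_pos: "Re z > 0 \<Longrightarrow> rGamma z * Gamma (z::complex) = 1"
  by (subst rGamma_inverse_Gamma, subst left_inverse) (auto simp: Gamma_eq_zero_iff elim!: nonpos_Ints_cases)

lemma holomorphic_on_series:
  fixes f :: "nat \<Rightarrow> complex \<Rightarrow> complex"
  assumes S: "open S" and hol: "\<And>n. f n holomorphic_on S"
    and bd: "\<And>x. x \<in> S \<Longrightarrow> \<exists>d h. 0 < d \<and> summable h \<and> (\<forall>n. \<forall>y\<in>ball x d \<inter> S. norm (f n y) \<le> h n)"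
  shows "(\<lambda>x. \<Sum>n. f n x) holomorphic_on S"
    and "x \<in> S \<Longrightarrow> summable (\<lambda>n. norm (f n x))"
    and "x \<in> S \<Longrightarrow> (\<lambda>n. deriv (f n) x) sums deriv (\<lambda>x. \<Sum>n. f n x) x"
proof -
  have hfd: "(f n has_field_derivative deriv (f n) x) (at x)" if "x \<in> S" for n x
    using hol S that by (rule holomorphic_derivI)
  have "\<exists>g g'. \<forall>x \<in> S. ((\<lambda>n. f n x) sums g x) \<and> ((\<lambda>n. deriv (f n) x) sums g' x) \<and> (g has_field_derivative g' x) (at x)"
  proof (rule series_and_derivative_comparison_local[OF S hfd])
    fix x assume "x \<in> S"
    from bd[OF this] obtain d h where "0 < d" "summable h" "\<forall>n. \<forall>y\<in>ball x d \<inter> S. norm (f n y) \<le> h n" by blast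
    then show "\<exists>d h. 0 < d \<and> summable h \<and> (\<forall>\<^sub>F n in sequentially. \<forall>y\<in>ball x d \<inter> S. norm (f n y) \<le> h n)"
      by (intro exI[of _ d] exI[of _ h]) auto
  qed
  then obtain g g' where g: "\<And>x. x \<in> S \<Longrightarrow> (\<lambda>n. f n x) sums g x"
      "\<And>x. x \<in> S \<Longrightarrow> (\<lambda>n. deriv (f n) x) sums g' x" "\<And>x. x \<in> S \<Longrightarrow> (g has_field_derivative g' x) (at x)"
    by blast
  have d: "((\<lambda>x. \<Sum>n. f n x) has_field_derivative g' x) (at x)" if "x \<in> S" for x
    by (rule has_field_derivative_transform_within_open[OF g(3)[OF that] S that])
       (use g(1) in \<open>simp add: sums_iff\<close>)
  show "(\<lambda>x. \<Sum>n. f n x) holomorphic_on S" using d S by (auto simp: holomorphic_on_open)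
  show "(\<lambda>n. deriv (f n) x) sums deriv (\<lambda>x. \<Sum>n. f n x) x" if "x \<in> S"
    using g(2)[OF that] DERIV_imp_deriv[OF d[OF that]] by simp
  show "summable (\<lambda>n. norm (f n x))" if x: "x \<in> S"
  proof -
    obtain d h where dh: "0 < d" "summable h" "\<forall>n. \<forall>y\<in>ball x d \<inter> S. norm (f n y) \<le> h n"
      using bd[OF x] by blast
    from dh(2) show ?thesis
    proof (rule summable_comparison_test')
      fix n show "norm (norm (f n x)) \<le> h n" using dh x by simp
    qed
  qed
qed

section \<open>Beta integrals with complex exponents\<close>

abbreviation unit_lborel :: "real measure" where
  "unit_lborel \<equiv> restrict_space lborel {0<..<1}"

lemma measurable_unit_lborel:
  fixes f :: "real \<Rightarrow> 'a::topological_space"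
  shows "continuous_on {0<..<1} f \<Longrightarrow> f \<in> borel_measurable unit_lborel"
  using borel_measurable_continuous_on_restrict[of "{0<..<1}" f]
  by (simp cong: measurable_cong_sets add: measurable_def space_restrict_space sets_restrict_space)

definition beta_weight :: "complex \<Rightarrow> complex \<Rightarrow> real \<Rightarrow> complex" where
  "beta_weight a b t = of_real t powr (a - 1) * (1 - of_real t) powr (b - 1)"

lemma norm_beta_weight:
  assumes "0 < t" "t < 1"
  shows "norm (beta_weight a b t) = t powr (Re a - 1) * (1 - t) powr (Re b - 1)"
proof -
  have *: "(1 - complex_of_real t) powr (b - 1) = of_real (1 - t) powr (b - 1)" by simp
  show ?thesis unfolding beta_weight_def * norm_mult
    using assms by (simp add: norm_powr_real_powr)
qed

lemma continuous_beta_weight: "continuous_on {0<..<1} (beta_weight a b)"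
  unfolding beta_weight_def by (intro continuous_intros) (auto simp: complex_nonpos_Reals_iff)

lemma measurable_beta_weight [measurable]: "beta_weight a b \<in> borel_measurable unit_lborel"
  by (rule measurable_unit_lborel[OF continuous_beta_weight])

lemma beta_weight_shift:
  assumes "0 < t"
  shows "beta_weight a b t * of_real t ^ n = beta_weight (a + of_nat n) b t"
proof -
  have "complex_of_real t powr (a - 1 + of_nat n) = of_real t powr (a - 1) * of_real t ^ n"
    using assms by (simp only: powr_add) (simp add: powr_nat')
  then have "complex_of_real t powr (a + of_nat n - 1) = of_real t powr (a - 1) * of_real t ^ n"
    by (simp add: algebra_simps)
  then show ?thesis by (simp add: beta_weight_def)
qed

text \<open>For a nonnegative integrand the gauge integral and the Lebesgue integral agree, and
  continuity on the open interval gives measurability. This carries the real Beta integral, possibly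
  singular at both ends, into the Lebesgue setting.\<close>

lemma has_integral_imp_unit_lborel:
  fixes f :: "real \<Rightarrow> real"
  assumes "(f has_integral I) {0..1}" and "\<And>t. 0 < t \<Longrightarrow> t < 1 \<Longrightarrow> 0 \<le> f t" and "continuous_on {0<..<1} f"
  shows "has_bochner_integral unit_lborel f I"
proof -
  have 1: "(f has_integral I) {0<..<1}"
    using assms(1) by (subst has_integral_Icc_iff_Ioo[symmetric])
  have "((\<lambda>t. if t \<in> {0<..<1} then f t else 0) has_integral I) UNIV"
    using 1 by (subst has_integral_restrict_UNIV)
  also have e: "(\<lambda>t. if t \<in> {0<..<1} then f t else 0) = (\<lambda>t. indicator {0<..<1} t * f t)"
    by (auto simp: fun_eq_iff)
  finally have 2: "((\<lambda>t. indicator {0<..<1} t * f t) has_integral I) UNIV" .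
  have m: "(\<lambda>t. indicator {0<..<1} t * f t) \<in> borel_measurable borel"
    using borel_measurable_continuous_on_indicator[OF _ assms(3)] by simp
  have nn: "0 \<le> indicator {0<..<1} t * f t" for t
    using assms(2) by (auto simp: indicator_def)
  have "I \<ge> 0" by (rule has_integral_nonneg[OF 1]) (use assms(2) in auto)
  have "integral\<^sup>N lborel (\<lambda>t. ennreal (indicator {0<..<1} t * f t)) = ennreal I"
    by (rule nn_integral_has_integral_lborel[OF m nn 2])
  then have "has_bochner_integral lborel (\<lambda>t. indicator {0<..<1} t * f t) I"
    by (intro has_bochner_integral_nn_integral) (use m nn \<open>I \<ge> 0\<close> in auto)
  then show ?thesis by (simp add: has_bochner_integral_restrict_space)
qed

lemma has_integral_Beta_unit_lborel_real:
  assumes "a > 0" "b > (0::real)"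
  shows "has_bochner_integral unit_lborel (\<lambda>t. t powr (a - 1) * (1 - t) powr (b - 1)) (Beta a b)"
  by (rule has_integral_imp_unit_lborel[OF has_integral_Beta_real[OF assms]])
     (auto intro!: continuous_intros)

lemma integrable_beta_weight_norm:
  "Re a > 0 \<Longrightarrow> Re b > 0 \<Longrightarrow> integrable unit_lborel (\<lambda>t. norm (beta_weight a b t))"
  by (subst Bochner_Integration.integrable_cong[OF refl, of _ _ "\<lambda>t. t powr (Re a - 1) * (1 - t) powr (Re b - 1)"])
     (use has_integral_Beta_unit_lborel_real[of "Re a" "Re b"]
      in \<open>auto simp: norm_beta_weight space_restrict_space has_bochner_integral_iff\<close>)

lemma integrable_beta_weight:
  "Re a > 0 \<Longrightarrow> Re b > 0 \<Longrightarrow> integrable unit_lborel (beta_weight a b)"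
  using integrable_beta_weight_norm by (subst (asm) integrable_norm_iff) auto

lemma norm_beta_weight_mono:
  assumes "0 < t" "t < 1" "Re a' \<le> Re a" "Re b' \<le> Re b"
  shows "norm (beta_weight a b t) \<le> norm (beta_weight a' b' t)"
  using assms by (simp add: norm_beta_weight mult_mono powr_mono')

lemma connected_Re_gt: "connected {z. Re z > c}"
  by (intro convex_connected convex_halfspace_Re_gt)

lemma ball_Re: "z \<in> ball z0 r \<Longrightarrow> Re z > Re z0 - r"
  using abs_Re_le_cmod[of "z0 - z"] by (simp add: dist_norm)

lemma has_integral_beta_weight_aux:
  assumes "Re b > 0"
  shows "(\<lambda>a. \<integral>t. beta_weight a b t \<partial>unit_lborel) holomorphic_on {a. Re a > 0}"
    and "(\<lambda>a. \<integral>t. beta_weight b a t \<partial>unit_lborel) holomorphic_on {a. Re a > 0}"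
    and "Re a > 0 \<Longrightarrow> ((\<lambda>a. \<integral>t. beta_weight a b t \<partial>unit_lborel) has_field_derivative
            (\<integral>t. beta_weight a b t * of_real (ln t) \<partial>unit_lborel)) (at a)"
    and "Re a > 0 \<Longrightarrow> integrable unit_lborel (\<lambda>t. beta_weight a b t * of_real (ln t))"
proof -
  have bd1: "\<exists>r g. r > 0 \<and> integrable unit_lborel g \<and>
     (\<forall>z\<in>ball z0 r \<inter> {a. Re a > 0}. \<forall>t\<in>space unit_lborel. norm (beta_weight z b t) \<le> g t)"
     "\<exists>r g. r > 0 \<and> integrable unit_lborel g \<and>
     (\<forall>z\<in>ball z0 r \<inter> {a. Re a > 0}. \<forall>t\<in>space unit_lborel. norm (beta_weight b z t) \<le> g t)"
    if z0: "z0 \<in> {a. Re a > 0}" for z0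
  proof -
    \<comment> \<open>Within distance Re z0 / 2 of z0 the real part exceeds Re z0 / 2, and on (0, 1)
      a smaller exponent gives a larger weight, so the weight with exponent z0 / 2 is the
      majorant.\<close>
    show "\<exists>r g. r > 0 \<and> integrable unit_lborel g \<and>
     (\<forall>z\<in>ball z0 r \<inter> {a. Re a > 0}. \<forall>t\<in>space unit_lborel. norm (beta_weight z b t) \<le> g t)"
      using z0 assms ball_Re[of _ z0 "Re z0/2"]
      by (intro exI[of _ "Re z0 / 2"] exI[of _ "\<lambda>t. norm (beta_weight (z0/2) b t)"])
         (fastforce intro!: integrable_beta_weight_norm norm_beta_weight_mono simp: space_restrict_space)
    show "\<exists>r g. r > 0 \<and> integrable unit_lborel g \<and>
     (\<forall>z\<in>ball z0 r \<inter> {a. Re a > 0}. \<forall>t\<in>space unit_lborel. norm (beta_weight b z t) \<le> g t)"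
      using z0 assms ball_Re[of _ z0 "Re z0/2"]
      by (intro exI[of _ "Re z0 / 2"] exI[of _ "\<lambda>t. norm (beta_weight b (z0/2) t)"])
         (fastforce intro!: integrable_beta_weight_norm norm_beta_weight_mono simp: space_restrict_space)
  qed
  have op: "open {a. Re a > 0}" by (rule open_halfspace_Re_gt)
  have hol: "(\<lambda>z. beta_weight z b t) holomorphic_on {a. Re a > 0}"
       "(\<lambda>z. beta_weight b z t) holomorphic_on {a. Re a > 0}" if "t \<in> space unit_lborel" for t
    unfolding beta_weight_def using that
    by (auto intro!: holomorphic_intros simp: space_restrict_space)
  note p = holomorphic_on_integral_param[of "{a. Re a > 0}" "\<lambda>z. beta_weight z b" unit_lborel,
      OF measurable_beta_weight op hol(1) bd1(1)]
  show "(\<lambda>a. \<integral>t. beta_weight a b t \<partial>unit_lborel) holomorphic_on {a. Re a > 0}"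
    by (rule p(1))
  show "(\<lambda>a. \<integral>t. beta_weight b a t \<partial>unit_lborel) holomorphic_on {a. Re a > 0}"
    using holomorphic_on_integral_param[of "{a. Re a > 0}" "\<lambda>z. beta_weight b z" unit_lborel,
      OF measurable_beta_weight op hol(2) bd1(2)] by simp
  have d: "deriv (\<lambda>z. beta_weight z b t) a = beta_weight a b t * of_real (ln t)"
    if "t \<in> space unit_lborel" for t a
  proof (rule DERIV_imp_deriv)
    have t: "0 < t" "t < 1" using that by (auto simp: space_restrict_space)
    have "((\<lambda>z. exp ((z - 1) * of_real (ln t)) * (1 - of_real t) powr (b - 1)) has_field_derivative
        exp ((a - 1) * of_real (ln t)) * (1 - of_real t) powr (b - 1) * of_real (ln t)) (at a)"
      by (auto intro!: derivative_eq_intros)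
    moreover have "of_real t powr z = exp (z * of_real (ln t))" for z :: complex
      using t by (simp add: powr_def Ln_of_real)
    ultimately show "((\<lambda>z. beta_weight z b t) has_field_derivative beta_weight a b t * of_real (ln t)) (at a)"
      by (simp add: beta_weight_def)
  qed
  show "integrable unit_lborel (\<lambda>t. beta_weight a b t * of_real (ln t))" if a: "Re a > 0"
    using p(2)[of a] a by (subst Bochner_Integration.integrable_cong[OF refl d[symmetric]]) auto
  show "((\<lambda>a. \<integral>t. beta_weight a b t \<partial>unit_lborel) has_field_derivative
            (\<integral>t. beta_weight a b t * of_real (ln t) \<partial>unit_lborel)) (at a)" if a: "Re a > 0"
    using p(3)[of a] a Bochner_Integration.integral_cong[OF refl d[of _ a], of unit_lborel] by simp
qed

lemma holomorphic_eq_from_pos_reals: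
  assumes "f holomorphic_on {z. Re z > 0}" "g holomorphic_on {z. Re z > 0}"
    and "\<And>x. x > 0 \<Longrightarrow> f (of_real x) = g (of_real x)" and "Re z > 0"
  shows "f z = g z"
proof -
  let ?H = "{z. Re z > 0}" let ?U = "complex_of_real ` {0<..}"
  have lp: "1 islimpt ?U"
    unfolding islimpt_approachable
  proof (intro allI impI)
    fix e :: real assume "e > 0"
    have "dist (complex_of_real (1 + e/2)) 1 = norm (complex_of_real (1 + e/2) - of_real 1)"
      by (simp only: dist_norm of_real_1)
    also have "\<dots> = norm (complex_of_real (e/2))"
      by (simp only: of_real_diff[symmetric]) simp
    also have "\<dots> = e/2" using \<open>e > 0\<close> by (simp only: norm_of_real)
    finally have "dist (complex_of_real (1 + e/2)) 1 < e" "complex_of_real (1 + e/2) \<noteq> 1"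
      using \<open>e > 0\<close> by auto
    then show "\<exists>x'\<in>?U. x' \<noteq> 1 \<and> dist x' 1 < e"
      using \<open>e > 0\<close> by (intro bexI[of _ "complex_of_real (1 + e/2)"] imageI) simp_all
  qed
  have "f z - g z = 0"
  proof (rule analytic_continuation[of "\<lambda>z. f z - g z" ?H ?U 1])
    show "(\<lambda>z. f z - g z) holomorphic_on ?H" by (intro holomorphic_on_diff assms)
  qed (use assms lp open_halfspace_Re_gt connected_Re_gt in auto)
  then show ?thesis by simp
qed

text \<open>The formula is known for positive real exponents. The identity theorem extends it in one
  exponent while the other is real, and a second time in the other.\<close>

lemma integral_beta_weight:
  assumes "Re a > 0" "Re b > 0"
  shows "(\<integral>t. beta_weight a b t \<partial>unit_lborel) = Beta a b"
proof -
  let ?I = "\<lambda>a b. (\<integral>t. beta_weight a b t \<partial>unit_lborel)"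
  have real: "?I (of_real u) (of_real v) = Beta (of_real u) (of_real v)" if "u > 0" "v > 0" for u v
  proof -
    have "?I (of_real u) (of_real v) = (\<integral>t. of_real (t powr (u - 1) * (1 - t) powr (v - 1)) \<partial>unit_lborel)"
    proof (rule Bochner_Integration.integral_cong[OF refl])
      fix t assume "t \<in> space unit_lborel"
      then have t: "0 < t" "t < 1" by (auto simp: space_restrict_space)
      have "(1 - complex_of_real t) powr (of_real v - 1) = of_real (1 - t) powr (of_real (v - 1))" by simp
      also have "\<dots> = of_real ((1 - t) powr (v - 1))" using t by (subst powr_of_real) auto
      finally show "beta_weight (of_real u) (of_real v) t = of_real (t powr (u - 1) * (1 - t) powr (v - 1))"
        using t powr_of_real[of t "u - 1"] by (simp add: beta_weight_def)
    qed
    also have "\<dots> = of_real (Beta u v)"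
      using has_integral_Beta_unit_lborel_real[OF that]
      by (simp add: has_bochner_integral_iff del: of_real_mult)
    finally show ?thesis by (simp add: Beta_def Gamma_complex_of_real flip: of_real_add)
  qed
  have 1: "?I z (of_real v) = Beta z (of_real v)" if "Re z > 0" "v > 0" for z v
    by (rule holomorphic_eq_from_pos_reals[of "\<lambda>z. ?I z (of_real v)" "\<lambda>z. Beta z (of_real v)" z])
       (use that real in \<open>auto intro!: holomorphic_intros has_integral_beta_weight_aux simp: Re_pos_notin_nonpos_Ints\<close>)
  show ?thesis
    by (rule holomorphic_eq_from_pos_reals[of "\<lambda>z. ?I a z" "\<lambda>z. Beta a z" b])
       (use assms 1 in \<open>auto intro!: holomorphic_intros has_integral_beta_weight_aux simp: Re_pos_notin_nonpos_Ints\<close>)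
qed

text \<open>Differentiating the Beta integral in \<open>a\<close> inserts the logarithm; the digamma
  values of the final formula originate here.\<close>

lemma integral_beta_weight_ln:
  assumes "Re a > 0" "Re b > 0"
  shows "(\<integral>t. beta_weight a b t * of_real (ln t) \<partial>unit_lborel) = Beta a b * (Digamma a - Digamma (a + b))"
proof -
  have 1: "((\<lambda>z. Beta z b) has_field_derivative (Beta a b * (Digamma a - Digamma (a + b)))) (at a)"
    using assms by (intro derivative_eq_intros) (auto simp: Re_pos_notin_nonpos_Ints)
  have "((\<lambda>z. Beta z b) has_field_derivative (\<integral>t. beta_weight a b t * of_real (ln t) \<partial>unit_lborel)) (at a)"
  proof (rule has_field_derivative_transform_within_open[OF has_integral_beta_weight_aux(3)])
    show "open {z. Re z > 0}" by (rule open_halfspace_Re_gt)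
  qed (use assms integral_beta_weight in auto)
  from DERIV_unique[OF this 1] show ?thesis .
qed

subsection \<open>The regularized Gauss hypergeometric function\<close>


lemma norm_pochhammer_le: "norm (pochhammer (s::complex) n) \<le> (norm s + 1) ^ n * fact n"
proof (induction n)
  case (Suc n)
  have "norm (s + of_nat n) \<le> norm s + real n" by (rule order.trans[OF norm_triangle_ineq]) simp
  also have "\<dots> \<le> (norm s + 1) * (1 + real n)" by (simp add: algebra_simps)
  finally have "norm (pochhammer s n) * norm (s + of_nat n) \<le>
      ((norm s + 1) ^ n * fact n) * ((norm s + 1) * (1 + real n))"
    using Suc.IH by (intro mult_mono) auto
  then show ?case by (simp add: pochhammer_Suc norm_mult mult_ac)
qed simp

lemma norm_pochhammer_le_fact:
  assumes "norm (s::complex) \<le> 1" shows "norm (pochhammer s n) \<le> fact n"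
proof (induction n)
  case (Suc n)
  have "norm (s + of_nat n) \<le> 1 + real n"
    using assms by (intro order.trans[OF norm_triangle_ineq]) simp
  then have "norm (pochhammer s n) * norm (s + of_nat n) \<le> fact n * (1 + real n)"
    using Suc.IH by (intro mult_mono) auto
  then show ?case by (simp add: pochhammer_Suc norm_mult mult_ac)
qed simp

lemma rGamma_Suc: "rGamma ((z::complex) + of_nat n) = (z + of_nat n) * rGamma (z + of_nat (Suc n))"
  using rGamma_plus1[of "z + of_nat n"] by (simp add: add_ac)

text \<open>Each step of rGamma w = w rGamma (w + 1) divides by |c + n|, which is at least (n + 1)/4
  as soon as n >= 2 R + 2; the finitely many smaller n are settled by compactness. The bound is
  uniform on the disc, poles of Gamma included, so it can serve as a majorant for holomorphy in
  c.\<close>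

lemma rGamma_shift_bound:
  obtains B where "B \<ge> 0" "\<And>c n. norm (c::complex) \<le> R \<Longrightarrow> norm (rGamma (c + of_nat n)) \<le> B * 4 ^ n / fact n"
proof (cases "R \<ge> 0")
  case False
  show ?thesis
    by (rule that[of 0]) (use False norm_ge_zero order_trans in \<open>blast+\<close>)
next
  case True
  define N where "N = nat \<lceil>2 * R\<rceil> + 2"
  have N: "real N \<ge> 2 * R + 2" unfolding N_def using True by linarith
  have "bounded (rGamma ` cball (0::complex) (R + N))"
    by (intro compact_imp_bounded compact_continuous_image continuous_intros) auto
  then obtain B1 where B1: "\<And>w. norm (w::complex) \<le> R + N \<Longrightarrow> norm (rGamma w) \<le> B1"
    by (fastforce simp: bounded_iff)
  have B10: "B1 \<ge> 0" using B1[of 0] True by simp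
  have small: "norm (rGamma (c + of_nat n)) \<le> B1 * fact N * 4 ^ n / fact n"
    if "norm c \<le> R" "n \<le> N" for c :: complex and n
  proof -
    have "norm (c + of_nat n) \<le> R + N"
      using that by (intro order.trans[OF norm_triangle_ineq]) simp
    then have "norm (rGamma (c + of_nat n)) \<le> B1" by (rule B1)
    also have "\<dots> \<le> B1 * (fact N / fact n * 4 ^ n)"
    proof -
      have "1 * 1 \<le> fact N / fact n * (4::real) ^ n"
        using that fact_mono[of n N, where ?'a=real] by (intro mult_mono) auto
      then have "B1 * 1 \<le> B1 * (fact N / fact n * 4 ^ n)"
        using B10 by (intro mult_left_mono) auto
      then show ?thesis by simp
    qed
    finally show ?thesis by (simp add: field_simps)
  qed
  have "norm (rGamma (c + of_nat n)) \<le> B1 * fact N * 4 ^ n / fact n" if c: "norm c \<le> R" for c :: complex and n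
  proof (cases "n \<le> N")
    case True then show ?thesis using small c by blast
  next
    case False
    then have "N \<le> n" by simp
    then show ?thesis
    proof (induction n rule: dec_induct)
      case base then show ?case using small c by blast
    next
      case (step n)
      have nn: "real n \<ge> 2 * R + 2" using N step(1) by linarith
      have "real n - R \<le> norm (c + of_nat n)"
        using norm_triangle_ineq2[of "of_nat n :: complex" "- c"] c by (simp add: add.commute)
      then have *: "norm (c + of_nat n) \<ge> (real n + 1) / 4" using nn True by (simp add: field_simps)
      have "norm (c + of_nat n) * norm (rGamma (c + of_nat (Suc n))) \<le> B1 * fact N * 4 ^ n / fact n"
        using step(3) rGamma_Suc[of c n] by (simp only: norm_mult)
      moreover have "(real n + 1) / 4 * norm (rGamma (c + of_nat (Suc n)))
           \<le> norm (c + of_nat n) * norm (rGamma (c + of_nat (Suc n)))"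
        by (rule mult_right_mono[OF *]) simp
      ultimately have "(real n + 1) / 4 * norm (rGamma (c + of_nat (Suc n))) \<le> B1 * fact N * 4 ^ n / fact n"
        by linarith
      then have "norm (rGamma (c + of_nat (Suc n))) \<le> (B1 * fact N * 4 ^ n / fact n) / ((real n + 1) / 4)"
        by (subst pos_le_divide_eq) (auto simp only: mult.commute, auto)
      also have "\<dots> = B1 * fact N * 4 ^ Suc n / fact (Suc n)"
        by (simp add: field_simps)
      finally show ?case .
    qed
  qed
  then show ?thesis using B10 by (intro that[of "B1 * fact N"]) auto
qed

text \<open>Cauchy's inequality on a unit circle, at the price of enlarging R by 1.\<close>

lemma deriv_rGamma_shift_bound:
  obtains B where "B \<ge> 0" "\<And>c n. norm (c::complex) \<le> R \<Longrightarrow> norm (deriv rGamma (c + of_nat n)) \<le> B * 4 ^ n / fact n"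
proof -
  obtain B where B: "B \<ge> 0" "\<And>c n. norm (c::complex) \<le> R + 1 \<Longrightarrow> norm (rGamma (c + of_nat n)) \<le> B * 4 ^ n / fact n"
    using rGamma_shift_bound[of "R + 1"] by metis
  have "norm (deriv rGamma (c + of_nat n)) \<le> B * 4 ^ n / fact n" if c: "norm c \<le> R" for c :: complex and n
  proof -
    have "norm ((deriv ^^ 1) rGamma (c + of_nat n)) \<le> fact 1 * (B * 4 ^ n / fact n) / 1 ^ 1"
    proof (rule Cauchy_inequality)
      fix x assume x: "cmod (c + of_nat n - x) = 1"
      have "norm (x - of_nat n) \<le> norm c + norm (c + of_nat n - x)"
        using norm_triangle_ineq4[of c "c + of_nat n - x"] by simp
      then have "norm (x - of_nat n) \<le> R + 1" using x c by simp
      from B(2)[OF this, of n] show "cmod (rGamma x) \<le> B * 4 ^ n / fact n" by simp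
    qed (auto intro!: holomorphic_intros continuous_intros)
    then show ?thesis by simp
  qed
  with B(1) show ?thesis by (rule that)
qed

section \<open>The plane slit along [1, infinity)\<close>

definition slit_plane :: "complex set" where
  "slit_plane = - (complex_of_real ` {1..})"

lemma open_slit_plane: "open slit_plane"
  unfolding slit_plane_def
proof (intro open_Compl)
  have "complex_of_real ` {1..} = {z. Im z = 0} \<inter> {z. Re z \<ge> 1}"
    by (auto simp: complex_eq_iff intro!: image_eqI[of _ _ "Re _"])
  then show "closed (complex_of_real ` {1..})"
    by (simp add: closed_Int closed_halfspace_Im_eq closed_halfspace_Re_ge)
qed

text \<open>Star-shapedness about 0: it keeps 1 - t \<xi> off the branch cut along the whole Euler
  integral, and it makes the slit plane connected for the continuation in \<xi>.\<close>

lemma scaled_slit_plane: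
  assumes "\<xi> \<in> slit_plane" "0 \<le> t" "t \<le> 1"
  shows "of_real t * \<xi> \<in> slit_plane"
proof (rule ccontr)
  assume "of_real t * \<xi> \<notin> slit_plane"
  then obtain r where r: "r \<ge> 1" "of_real t * \<xi> = of_real r" by (auto simp: slit_plane_def)
  then have "t \<noteq> 0" by auto
  with r have "\<xi> = of_real (r / t)" by (simp add: field_simps)
  moreover have "r / t \<in> {1..}" using r assms \<open>t \<noteq> 0\<close> by (simp add: field_simps)
  ultimately have "\<xi> \<in> of_real ` {1..}" by (rule image_eqI)
  then show False using assms(1) by (simp add: slit_plane_def)
qed

lemma one_minus_slit_plane:
  assumes "\<xi> \<in> slit_plane" shows "1 - \<xi> \<notin> \<real>\<^sub>\<le>\<^sub>0"
proof
  assume "1 - \<xi> \<in> \<real>\<^sub>\<le>\<^sub>0"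
  then obtain r where "r \<le> 0" "1 - \<xi> = of_real r" by (auto elim!: nonpos_Reals_cases)
  then have "\<xi> = of_real (1 - r)" "1 - r \<in> {1..}" by (auto simp: algebra_simps)
  then have "\<xi> \<in> of_real ` {1..}" by (rule image_eqI)
  then show False using assms by (simp add: slit_plane_def)
qed

lemma one_minus_scaled_slit_plane:
  "\<xi> \<in> slit_plane \<Longrightarrow> 0 \<le> t \<Longrightarrow> t \<le> 1 \<Longrightarrow> 1 - of_real t * \<xi> \<notin> \<real>\<^sub>\<le>\<^sub>0"
  by (intro one_minus_slit_plane scaled_slit_plane)

lemma connected_slit_plane: "connected slit_plane"
proof (rule starlike_imp_connected)
  have "closed_segment 0 x \<subseteq> slit_plane" if "x \<in> slit_plane" for x
    using scaled_slit_plane[OF that] by (auto simp: closed_segment_def scaleR_conv_of_real)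
  then show "starlike slit_plane"
    unfolding starlike_def by (intro bexI[of _ 0]) (auto simp: slit_plane_def)
qed

lemma norm_lt_1_slit_plane: "norm \<xi> < 1 \<Longrightarrow> \<xi> \<in> slit_plane"
  by (auto simp: slit_plane_def)

text \<open>Ln (1 - t \<xi>) is continuous, hence bounded, on the compact product of [0, 1] and K;
  the exponential of the product of the two norms then covers all exponents up to R at once.\<close>

lemma slit_powr_bound:
  assumes K: "compact K" "K \<subseteq> slit_plane"
  obtains B where "B > 0"
    "\<And>t \<xi> b. 0 \<le> t \<Longrightarrow> t \<le> 1 \<Longrightarrow> \<xi> \<in> K \<Longrightarrow> norm b \<le> R \<Longrightarrow> norm ((1 - of_real t * \<xi>) powr (-b)) \<le> B"
proof -
  have "bounded ((\<lambda>p::real \<times> complex. Ln (1 - of_real (fst p) * snd p)) ` ({0..1} \<times> K))"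
  proof (intro compact_imp_bounded compact_continuous_image compact_Times K continuous_intros)
    fix p :: "real \<times> complex" assume "p \<in> {0..1} \<times> K"
    then show "1 - of_real (fst p) * snd p \<notin> \<real>\<^sub>\<le>\<^sub>0"
      using K(2) one_minus_scaled_slit_plane[of "snd p" "fst p"] by auto
  qed auto
  then obtain L where L: "\<And>t \<xi>. 0 \<le> t \<Longrightarrow> t \<le> 1 \<Longrightarrow> \<xi> \<in> K \<Longrightarrow> norm (Ln (1 - of_real t * \<xi>)) \<le> L"
    by (fastforce simp: bounded_iff)
  have "norm ((1 - of_real t * \<xi>) powr (-b)) \<le> exp (\<bar>R\<bar> * \<bar>L\<bar>)"
    if "0 \<le> t" "t \<le> 1" "\<xi> \<in> K" "norm b \<le> R" for t \<xi> b
  proof -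
    have "1 - of_real t * \<xi> \<noteq> 0"
      using one_minus_scaled_slit_plane[of \<xi> t] that K(2) by auto
    then have "norm ((1 - of_real t * \<xi>) powr (-b)) \<le> exp (norm (- b * Ln (1 - of_real t * \<xi>)))"
      unfolding powr_def by (simp only: if_False norm_exp)
    also have "\<dots> \<le> exp (\<bar>R\<bar> * \<bar>L\<bar>)"
      unfolding norm_mult using that L[of t \<xi>] by (simp add: mult_mono)
    finally show ?thesis .
  qed
  then show ?thesis by (intro that[of "exp (\<bar>R\<bar> * \<bar>L\<bar>)"]) auto
qed

text \<open>
  \<open>reg2F1 k a b c \<xi>\<close> is \<open>\<^sub>2F\<^sub>1(a, b; c; \<xi>) / \<Gamma>(c)\<close>, continued from \<open>Re c > Re a > 0\<close> to
  \<open>Re c > Re a - k\<close> by the contiguous relation obtained from \<open>1/\<Gamma>(c+n) = (c+n)/\<Gamma>(c+n+1)\<close> in the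
  power series.
\<close>

primrec reg2F1 :: "nat \<Rightarrow> complex \<Rightarrow> complex \<Rightarrow> complex \<Rightarrow> complex \<Rightarrow> complex" where
  "reg2F1 0 a b c \<xi> = rGamma a * rGamma (c - a) *
     (\<integral>t. beta_weight a (c - a) t * (1 - of_real t * \<xi>) powr (- b) \<partial>unit_lborel)"
| "reg2F1 (Suc k) a b c \<xi> =
     c * reg2F1 k a b (c + 1) \<xi> + \<xi> * a * b * reg2F1 k (a + 1) (b + 1) (c + 2) \<xi>"

lemma continuous_beta_weight_powr:
  assumes "\<xi> \<in> slit_plane"
  shows "continuous_on {0<..<1} (\<lambda>t. beta_weight a d t * (1 - of_real t * \<xi>) powr (- b))"
proof -
  have *: "1 - of_real t * \<xi> \<notin> \<real>\<^sub>\<le>\<^sub>0" if "t \<in> {0<..<1}" for t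
    using one_minus_scaled_slit_plane[OF assms, of t] that by simp
  have "continuous_on {0<..<1} (\<lambda>t. exp (- b * Ln (1 - of_real t * \<xi>)))"
    by (intro continuous_intros) (use * in auto)
  then have "continuous_on {0<..<1} (\<lambda>t. (1 - of_real t * \<xi>) powr (- b))"
    by (rule continuous_on_eq) (use * in \<open>force simp: powr_def\<close>)
  then show ?thesis by (intro continuous_on_mult continuous_beta_weight)
qed

lemma norm_beta_weight_powr_le:
  assumes "norm p \<le> B"
  shows "norm (beta_weight a d t * p) \<le> B * norm (beta_weight a d t)"
  using assms by (simp add: norm_mult mult.commute mult_right_mono)

lemma reg2F1_0_holomorphic_xi:
  assumes "Re a > 0" "Re c > Re a"
  shows "reg2F1 0 a b c holomorphic_on slit_plane"
proof -
  have "(\<lambda>\<xi>. \<integral>t. beta_weight a (c - a) t * (1 - of_real t * \<xi>) powr (- b) \<partial>unit_lborel) holomorphic_on slit_plane"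
  proof (rule holomorphic_on_integral_param(1))
    fix \<xi>0 assume "\<xi>0 \<in> slit_plane"
    then obtain r where r: "r > 0" "cball \<xi>0 r \<subseteq> slit_plane"
      using open_slit_plane open_contains_cball by blast
    obtain B where "B > 0" "\<And>t \<xi> b'. 0 \<le> t \<Longrightarrow> t \<le> 1 \<Longrightarrow> \<xi> \<in> cball \<xi>0 r \<Longrightarrow> norm b' \<le> norm b \<Longrightarrow>
        norm ((1 - of_real t * \<xi>) powr (-b')) \<le> B"
      using slit_powr_bound[of "cball \<xi>0 r" "norm b"] r by auto
    then show "\<exists>r g. r > 0 \<and> integrable unit_lborel g \<and> (\<forall>z\<in>ball \<xi>0 r \<inter> slit_plane. \<forall>t\<in>space unit_lborel.
        norm (beta_weight a (c - a) t * (1 - of_real t * z) powr (- b)) \<le> g t)"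
      using r(1) assms
      by (intro exI[of _ r] exI[of _ "\<lambda>t. B * norm (beta_weight a (c - a) t)"])
         (auto intro!: integrable_mult_right integrable_beta_weight_norm norm_beta_weight_powr_le
               simp: space_restrict_space)
  next
    fix \<xi> assume "\<xi> \<in> slit_plane"
    then show "(\<lambda>t. beta_weight a (c - a) t * (1 - of_real t * \<xi>) powr (- b)) \<in> borel_measurable unit_lborel"
      by (intro measurable_unit_lborel continuous_beta_weight_powr)
  next
    fix t assume "t \<in> space unit_lborel"
    then show "(\<lambda>z. beta_weight a (c - a) t * (1 - of_real t * z) powr (- b)) holomorphic_on slit_plane"
      using one_minus_scaled_slit_plane
      by (intro holomorphic_intros) (auto simp: space_restrict_space)
  qed (rule open_slit_plane)
  moreover have "reg2F1 0 a b c = (\<lambda>\<xi>. rGamma a * rGamma (c - a) *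
     (\<integral>t. beta_weight a (c - a) t * (1 - of_real t * \<xi>) powr (- b) \<partial>unit_lborel))"
    by (rule ext) simp
  ultimately show ?thesis by (auto intro!: holomorphic_intros)
qed

text \<open>The induction closes because both terms of the recursion, with \<open>(a, c + 1)\<close>
  and \<open>(a + 1, c + 2)\<close>, raise Re c - Re a by exactly 1.\<close>

lemma reg2F1_holomorphic_xi:
  "Re a > 0 \<Longrightarrow> Re c > Re a - real k \<Longrightarrow> reg2F1 k a b c holomorphic_on slit_plane"
proof (induction k arbitrary: a b c)
  case 0 then show ?case using reg2F1_0_holomorphic_xi[of a] by (simp del: reg2F1.simps)
next
  case (Suc k)
  have "reg2F1 (Suc k) a b c = (\<lambda>\<xi>. c * reg2F1 k a b (c + 1) \<xi> + \<xi> * a * b * reg2F1 k (a + 1) (b + 1) (c + 2) \<xi>)"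
    by (rule ext) simp
  then show ?case using Suc.prems
    by (auto intro!: holomorphic_intros Suc.IH)
qed

lemma reg2F1_0_holomorphic_b:
  assumes "Re a > 0" "Re c > Re a" "\<xi> \<in> slit_plane"
  shows "(\<lambda>b. reg2F1 0 a b c \<xi>) holomorphic_on UNIV"
proof -
  have "(\<lambda>b. \<integral>t. beta_weight a (c - a) t * (1 - of_real t * \<xi>) powr (- b) \<partial>unit_lborel) holomorphic_on UNIV"
  proof (rule holomorphic_on_integral_param(1))
    fix b0 :: complex
    obtain B where B: "B > 0" "\<And>t \<xi>' b'. 0 \<le> t \<Longrightarrow> t \<le> 1 \<Longrightarrow> \<xi>' \<in> {\<xi>} \<Longrightarrow> norm b' \<le> norm b0 + 1 \<Longrightarrow>
        norm ((1 - of_real t * \<xi>') powr (-b')) \<le> B"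
      using slit_powr_bound[of "{\<xi>}" "norm b0 + 1"] assms(3) by auto
    have "norm b' \<le> norm b0 + 1" if "dist b0 b' < 1" for b'
      using that norm_triangle_ineq2[of b' b0] by (simp add: dist_norm norm_minus_commute)
    with B show "\<exists>r g. r > 0 \<and> integrable unit_lborel g \<and> (\<forall>z\<in>ball b0 r \<inter> UNIV. \<forall>t\<in>space unit_lborel.
        norm (beta_weight a (c - a) t * (1 - of_real t * \<xi>) powr (- z)) \<le> g t)"
      using assms
      by (intro exI[of _ 1] exI[of _ "\<lambda>t. B * norm (beta_weight a (c - a) t)"])
         (auto intro!: integrable_mult_right integrable_beta_weight_norm norm_beta_weight_powr_le
               simp: space_restrict_space)
  next
    fix b
    show "(\<lambda>t. beta_weight a (c - a) t * (1 - of_real t * \<xi>) powr (- b)) \<in> borel_measurable unit_lborel"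
      by (intro measurable_unit_lborel continuous_beta_weight_powr assms)
  next
    fix t assume "t \<in> space unit_lborel"
    then show "(\<lambda>z. beta_weight a (c - a) t * (1 - of_real t * \<xi>) powr (- z)) holomorphic_on UNIV"
      using one_minus_scaled_slit_plane[OF assms(3), of t]
      by (intro holomorphic_intros) (auto simp: space_restrict_space)
  qed simp
  then show ?thesis by (auto intro!: holomorphic_intros)
qed

lemma holomorphic_on_shift:
  "f holomorphic_on UNIV \<Longrightarrow> (\<lambda>z. f (z + w)) holomorphic_on UNIV" for f :: "complex \<Rightarrow> complex"
  by (rule holomorphic_on_compose_gen[of "\<lambda>z. z + w" UNIV f UNIV, unfolded o_def])
     (auto intro!: holomorphic_intros)

lemma reg2F1_holomorphic_b:
  "Re a > 0 \<Longrightarrow> Re c > Re a - real k \<Longrightarrow> \<xi> \<in> slit_plane \<Longrightarrow> (\<lambda>b. reg2F1 k a b c \<xi>) holomorphic_on UNIV"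
proof (induction k arbitrary: a c)
  case 0 then show ?case using reg2F1_0_holomorphic_b[of a] by (simp del: reg2F1.simps)
next
  case (Suc k)
  have "(\<lambda>b. reg2F1 k (a + 1) (b + 1) (c + 2) \<xi>) holomorphic_on UNIV"
    by (rule holomorphic_on_shift) (use Suc in auto)
  then show ?case using Suc.prems
    by (auto intro!: holomorphic_intros Suc.IH)
qed

lemma reg2F1_0_holomorphic_c:
  assumes "Re a > 0" "\<xi> \<in> slit_plane"
  shows "(\<lambda>c. reg2F1 0 a b c \<xi>) holomorphic_on {c. Re c > Re a}"
proof -
  have "(\<lambda>d. \<integral>t. beta_weight a (d - a) t * (1 - of_real t * \<xi>) powr (- b) \<partial>unit_lborel) holomorphic_on {c. Re c > Re a}"
  proof (rule holomorphic_on_integral_param(1))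
    fix c0 :: complex assume c0: "c0 \<in> {c. Re c > Re a}"
    define r where "r = (Re c0 - Re a) / 2"
    obtain B where B: "B > 0" "\<And>t \<xi>' b'. 0 \<le> t \<Longrightarrow> t \<le> 1 \<Longrightarrow> \<xi>' \<in> {\<xi>} \<Longrightarrow> norm b' \<le> norm b \<Longrightarrow>
        norm ((1 - of_real t * \<xi>') powr (-b')) \<le> B"
      using slit_powr_bound[of "{\<xi>}" "norm b"] assms(2) by auto
    have "norm (beta_weight a (z - a) t * (1 - of_real t * \<xi>) powr (- b)) \<le> B * norm (beta_weight a (of_real r) t)"
      if "z \<in> ball c0 r" "t \<in> space unit_lborel" for z t
    proof -
      have t: "0 < t" "t < 1" using that by (auto simp: space_restrict_space)
      have "norm (beta_weight a (z - a) t * (1 - of_real t * \<xi>) powr (- b)) \<le> B * norm (beta_weight a (z - a) t)"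
        using B t by (intro norm_beta_weight_powr_le) auto
      also have "\<dots> \<le> B * norm (beta_weight a (of_real r) t)"
        using B t ball_Re[OF that(1)] c0 unfolding r_def
        by (intro mult_left_mono norm_beta_weight_mono) (auto simp: field_simps)
      finally show ?thesis .
    qed
    then show "\<exists>r g. r > 0 \<and> integrable unit_lborel g \<and> (\<forall>z\<in>ball c0 r \<inter> {c. Re c > Re a}. \<forall>t\<in>space unit_lborel.
        norm (beta_weight a (z - a) t * (1 - of_real t * \<xi>) powr (- b)) \<le> g t)"
      using assms c0 unfolding r_def
      by (intro exI[of _ "(Re c0 - Re a) / 2"] exI[of _ "\<lambda>t. B * norm (beta_weight a (of_real ((Re c0 - Re a) / 2)) t)"])
         (auto intro!: integrable_mult_right integrable_beta_weight_norm)
  next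
    fix c :: complex
    show "(\<lambda>t. beta_weight a (c - a) t * (1 - of_real t * \<xi>) powr (- b)) \<in> borel_measurable unit_lborel"
      by (intro measurable_unit_lborel continuous_beta_weight_powr assms)
  next
    fix t assume "t \<in> space unit_lborel"
    then show "(\<lambda>z. beta_weight a (z - a) t * (1 - of_real t * \<xi>) powr (- b)) holomorphic_on {c. Re c > Re a}"
      using one_minus_scaled_slit_plane[OF assms(2), of t] unfolding beta_weight_def
      by (intro holomorphic_intros) (auto simp: space_restrict_space)
  qed (rule open_halfspace_Re_gt)
  then show ?thesis by (auto intro!: holomorphic_intros)
qed

lemma reg2F1_holomorphic_c:
  "Re a > 0 \<Longrightarrow> \<xi> \<in> slit_plane \<Longrightarrow> (\<lambda>c. reg2F1 k a b c \<xi>) holomorphic_on {c. Re c > Re a - real k}"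
proof (induction k arbitrary: a b)
  case 0 then show ?case using reg2F1_0_holomorphic_c[of a] by (simp del: reg2F1.simps)
next
  case (Suc k)
  have "(\<lambda>c. reg2F1 k a b (c + 1) \<xi>) holomorphic_on {c. Re c > Re a - real (Suc k)}"
    by (rule holomorphic_on_compose_gen[of "\<lambda>z. z + 1" _ "\<lambda>c. reg2F1 k a b c \<xi>" "{c. Re c > Re a - real k}", unfolded o_def])
       (use Suc in \<open>auto intro!: holomorphic_intros\<close>)
  moreover have "(\<lambda>c. reg2F1 k (a + 1) (b + 1) (c + 2) \<xi>) holomorphic_on {c. Re c > Re a - real (Suc k)}"
    by (rule holomorphic_on_compose_gen[of "\<lambda>z. z + 2" _ "\<lambda>c. reg2F1 k (a + 1) (b + 1) c \<xi>"
          "{c. Re c > Re (a + 1) - real k}", unfolded o_def])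
       (use Suc.prems Suc.IH[of "a + 1" "b + 1"] in \<open>auto intro!: holomorphic_intros\<close>)
  ultimately show ?case
    by (auto intro!: holomorphic_intros)
qed

text \<open>The binomial series of the power is integrated term by term, each term being a Beta
  integral. The small disc reflects the crude bound \<open>norm_pochhammer_le\<close>; it suffices,
  since continuation in \<xi> does the rest.\<close>

lemma reg2F1_0_sums:
  assumes a: "Re a > 0" "Re c > Re a" and \<xi>: "(norm b + 1) * norm \<xi> < 1"
  shows "(\<lambda>n. pochhammer a n * pochhammer b n * rGamma (c + of_nat n) / fact n * \<xi> ^ n) sums reg2F1 0 a b c \<xi>"
proof -
  define f where "f n t = beta_weight a (c - a) t * (pochhammer b n / fact n * (of_real t * \<xi>) ^ n)" for n t
  have \<xi>1: "norm \<xi> < 1"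
    using \<xi> mult_right_mono[of 1 "norm b + 1" "norm \<xi>"] by simp
  have w: "f n t = pochhammer b n / fact n * \<xi> ^ n * beta_weight (a + of_nat n) (c - a) t"
    if "t \<in> space unit_lborel" for n t
  proof -
    have "t > 0" using that by (auto simp: space_restrict_space)
    then show ?thesis by (simp add: f_def power_mult_distrib flip: beta_weight_shift)
  qed
  have meas: "f n \<in> borel_measurable unit_lborel" for n
    unfolding f_def by (intro measurable_unit_lborel continuous_intros continuous_beta_weight)
  have val: "(\<integral>t. f n t \<partial>unit_lborel) = pochhammer b n / fact n * \<xi> ^ n * Beta (a + of_nat n) (c - a)" for n
    by (subst Bochner_Integration.integral_cong[OF refl w]) (use a in \<open>auto simp: integral_beta_weight\<close>)
  have nf: "norm (f n t) \<le> ((norm b + 1) * norm \<xi>) ^ n * norm (beta_weight a (c - a) t)"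
    if "t \<in> space unit_lborel" for n t
  proof -
    have t: "0 < t" "t < 1" using that by (auto simp: space_restrict_space)
    have "norm (pochhammer b n / fact n) \<le> (norm b + 1) ^ n"
      using norm_pochhammer_le[of b n] by (simp add: norm_divide field_simps)
    moreover have "norm ((of_real t * \<xi>) ^ n) \<le> norm \<xi> ^ n"
      using t by (simp add: norm_power norm_mult power_mono mult_left_le_one_le)
    ultimately have "norm (pochhammer b n / fact n * (of_real t * \<xi>) ^ n) \<le> (norm b + 1) ^ n * norm \<xi> ^ n"
      unfolding norm_mult by (intro mult_mono) auto
    then show ?thesis
      unfolding f_def by (subst power_mult_distrib) (rule norm_beta_weight_powr_le)
  qed
  have sg: "summable (\<lambda>n. ((norm b + 1) * norm \<xi>) ^ n)"
    using \<xi> by (intro summable_geometric) (simp add: abs_mult)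
  have "integrable unit_lborel (\<lambda>t. norm (beta_weight a (c - a) t))"
    using a by (intro integrable_beta_weight_norm) auto
  then have "(\<lambda>n. \<integral>t. f n t \<partial>unit_lborel) sums (\<integral>t. (\<Sum>n. f n t) \<partial>unit_lborel)"
    by (rule sums_integral_bounded(1)[OF meas _ sg nf])
  also have "(\<integral>t. (\<Sum>n. f n t) \<partial>unit_lborel) = (\<integral>t. beta_weight a (c - a) t * (1 - of_real t * \<xi>) powr (- b) \<partial>unit_lborel)"
  proof (rule Bochner_Integration.integral_cong[OF refl])
    fix t assume "t \<in> space unit_lborel"
    then have t: "0 < t" "t < 1" by (auto simp: space_restrict_space)
    have "norm (of_real t * \<xi>) < 1"
      using t \<xi>1 mult_strict_mono[of t 1 "norm \<xi>" 1] by (simp add: norm_mult)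
    then have "(\<lambda>n. ((- b) gchoose n) * (- (of_real t * \<xi>)) ^ n) sums (1 + - (of_real t * \<xi>)) powr (- b)"
      by (intro gen_binomial_complex) simp
    moreover have "((- b) gchoose n) * (- (of_real t * \<xi>)) ^ n = pochhammer b n / fact n * (of_real t * \<xi>) ^ n" for n
      by (simp add: gbinomial_pochhammer power_minus[of "of_real t * \<xi>"])
    ultimately have "(\<lambda>n. f n t) sums (beta_weight a (c - a) t * (1 - of_real t * \<xi>) powr (- b))"
      unfolding f_def by (intro sums_mult) simp
    then show "(\<Sum>n. f n t) = beta_weight a (c - a) t * (1 - of_real t * \<xi>) powr (- b)"
      by (rule sums_unique[symmetric])
  qed
  finally have "(\<lambda>n. rGamma a * rGamma (c - a) * (\<integral>t. f n t \<partial>unit_lborel)) sums reg2F1 0 a b c \<xi>"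
    unfolding reg2F1.simps by (rule sums_mult)
  moreover have "rGamma a * rGamma (c - a) * (\<integral>t. f n t \<partial>unit_lborel) =
      pochhammer a n * pochhammer b n * rGamma (c + of_nat n) / fact n * \<xi> ^ n" for n
  proof -
    have "rGamma a * Beta (a + of_nat n) (c - a) * rGamma (c - a) =
       pochhammer a n * (rGamma (a + of_nat n) * Gamma (a + of_nat n)) * (rGamma (c - a) * Gamma (c - a)) * rGamma (c + of_nat n)"
      unfolding Beta_altdef by (subst pochhammer_rGamma[of a n]) (simp add: algebra_simps)
    also have "\<dots> = pochhammer a n * rGamma (c + of_nat n)"
      using a by (simp add: rGamma_mult_Gamma_pos)
    finally show ?thesis unfolding val by (simp add: field_simps)
  qed
  ultimately show ?thesis by simp
qed

text \<open>The radius shrinks with k because the recursion replaces b by b + 1.\<close>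

lemma reg2F1_sums:
  "Re a > 0 \<Longrightarrow> Re c > Re a - real k \<Longrightarrow> (norm b + 1 + real k) * norm \<xi> < 1 \<Longrightarrow>
   (\<lambda>n. pochhammer a n * pochhammer b n * rGamma (c + of_nat n) / fact n * \<xi> ^ n) sums reg2F1 k a b c \<xi>"
proof (induction k arbitrary: a b c)
  case 0 then show ?case using reg2F1_0_sums[of a c b \<xi>] by simp
next
  case (Suc k)
  define u where "u n = pochhammer a n * pochhammer b n * rGamma (c + 1 + of_nat n) / fact n * \<xi> ^ n" for n
  have "(norm b + 1 + real k) * norm \<xi> \<le> (norm b + 1 + real (Suc k)) * norm \<xi>"
    by (intro mult_right_mono) auto
  then have 1: "u sums reg2F1 k a b (c + 1) \<xi>"
    unfolding u_def using Suc.prems by (intro Suc.IH) auto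
  have "(norm (b + 1) + 1 + real k) * norm \<xi> \<le> (norm b + 1 + real (Suc k)) * norm \<xi>"
    using norm_triangle_ineq[of b 1] by (intro mult_right_mono) auto
  then have 2: "(\<lambda>n. pochhammer (a+1) n * pochhammer (b+1) n * rGamma (c + 2 + of_nat n) / fact n * \<xi> ^ n)
      sums reg2F1 k (a + 1) (b + 1) (c + 2) \<xi>"
    using Suc.prems by (intro Suc.IH) auto
  have "(\<lambda>n. \<xi> * a * b * (pochhammer (a+1) n * pochhammer (b+1) n * rGamma (c + 2 + of_nat n) / fact n * \<xi> ^ n))
      sums (\<xi> * a * b * reg2F1 k (a + 1) (b + 1) (c + 2) \<xi>)"
    by (rule sums_mult[OF 2])
  \<comment> \<open>Shifting both numerator parameters and the index by one gives the terms n u(n);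
    together with c u(n) they restore the factor c + n of \<open>rGamma_Suc\<close>.\<close>
  also have "(\<lambda>n. \<xi> * a * b * (pochhammer (a+1) n * pochhammer (b+1) n * rGamma (c + 2 + of_nat n) / fact n * \<xi> ^ n))
     = (\<lambda>n. of_nat (Suc n) * u (Suc n))"
  proof
    fix n
    have e: "c + 2 + of_nat n = c + 1 + of_nat (Suc n)" by simp
    show "\<xi> * a * b * (pochhammer (a+1) n * pochhammer (b+1) n * rGamma (c + 2 + of_nat n) / fact n * \<xi> ^ n)
       = of_nat (Suc n) * u (Suc n)"
      unfolding u_def e pochhammer_rec fact_Suc by (simp add: field_simps del: of_nat_Suc)
  qed
  finally have "(\<lambda>n. of_nat n * u n) sums (\<xi> * a * b * reg2F1 k (a + 1) (b + 1) (c + 2) \<xi>)"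
    by (subst (asm) sums_Suc_iff) simp
  then have "(\<lambda>n. c * u n + of_nat n * u n) sums reg2F1 (Suc k) a b c \<xi>"
    unfolding reg2F1.simps by (intro sums_add sums_mult 1)
  also have "(\<lambda>n. c * u n + of_nat n * u n) =
     (\<lambda>n. pochhammer a n * pochhammer b n * rGamma (c + of_nat n) / fact n * \<xi> ^ n)"
    by (rule ext) (simp add: u_def rGamma_Suc[of c] algebra_simps add_divide_distrib)
  finally show ?case .
qed

text \<open>Near 0 both sides have the same power series, which is symmetric in the numerator
  parameters and does not see the level. Continuation over the slit plane therefore yields
  independence of k and the symmetry in a and b together.\<close>

lemma reg2F1_cong:
  assumes "Re a > 0" "Re c > Re a - real k" "Re a' > 0" "Re c > Re a' - real k'"
    and "{a, b} = {a', b'}" and \<xi>: "\<xi> \<in> slit_plane"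
  shows "reg2F1 k a b c \<xi> = reg2F1 k' a' b' c \<xi>"
proof -
  have eq: "pochhammer a n * pochhammer b n = pochhammer a' n * pochhammer b' n" for n
    using assms(5) by (auto simp: doubleton_eq_iff)
  define r where "r = 1 / (norm b + norm b' + real k + real k' + 2)"
  have den: "norm b + norm b' + real k + real k' + 2 > 0" by (auto intro!: add_nonneg_pos)
  then have r: "r > 0" by (simp add: r_def)
  show ?thesis
  proof (rule analytic_continuation_open[of "ball 0 r" slit_plane "reg2F1 k a b c" "reg2F1 k' a' b' c"])
    show "ball 0 r \<subseteq> slit_plane"
    proof
      fix z assume "z \<in> ball (0::complex) r"
      then have "norm z < r" by simp
      also have "r \<le> 1" unfolding r_def using den by (subst divide_le_eq_1_pos) auto
      finally show "z \<in> slit_plane" by (rule norm_lt_1_slit_plane)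
    qed
    fix z assume "z \<in> ball (0::complex) r"
    then have z: "norm z * (norm b + norm b' + real k + real k' + 2) < 1"
      using den by (simp add: r_def field_simps)
    have "(norm b + 1 + real k) * norm z < 1" "(norm b' + 1 + real k') * norm z < 1"
      by (rule le_less_trans[OF _ z], subst mult.commute, intro mult_left_mono, auto)+
    then show "reg2F1 k a b c z = reg2F1 k' a' b' c z"
      using reg2F1_sums[of a k c b z] reg2F1_sums[of a' k' c b' z] assms sums_unique2
      by (simp add: eq)
  qed (use r assms in \<open>auto intro!: reg2F1_holomorphic_xi open_slit_plane connected_slit_plane\<close>)
qed

section \<open>The hypergeometric function with a numerator parameter 1/2\<close>

text \<open>The Euler weight carries the exponent 1/2 instead of b: its real part is positive, so b
  occurs only in the power of 1 - t \<xi> and is unrestricted. The level k is large enough for Re c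
  > 1/2 - k.\<close>

definition half2F1 :: "complex \<Rightarrow> complex \<Rightarrow> complex \<Rightarrow> complex" where
  "half2F1 b c \<xi> = reg2F1 (nat \<lceil>1 - Re c\<rceil>) (1/2) b c \<xi>"

lemma half2F1_eq:
  assumes "Re a' > 0" "Re c > Re a' - real k" "{1/2, b} = {a', b'}" "\<xi> \<in> slit_plane"
  shows "half2F1 b c \<xi> = reg2F1 k a' b' c \<xi>"
  unfolding half2F1_def
proof (rule reg2F1_cong)
  show "Re (1/2) - real (nat \<lceil>1 - Re c\<rceil>) < Re c" by simp linarith
qed (use assms in auto)

lemma half2F1_holomorphic_b:
  assumes "\<xi> \<in> slit_plane" shows "(\<lambda>b. half2F1 b c \<xi>) holomorphic_on UNIV"
  unfolding half2F1_def
proof (rule reg2F1_holomorphic_b)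
  show "Re (1/2) - real (nat \<lceil>1 - Re c\<rceil>) < Re c" by simp linarith
qed (use assms in auto)

lemma half2F1_holomorphic_c:
  assumes "\<xi> \<in> slit_plane" shows "(\<lambda>c. half2F1 b c \<xi>) holomorphic_on UNIV"
proof -
  have "(\<lambda>c. half2F1 b c \<xi>) holomorphic_on (\<Union>k. {c. Re c > Re (1/2) - real k})"
  proof (rule holomorphic_on_UN_open)
    fix k
    have "(\<lambda>c. reg2F1 k (1/2) b c \<xi>) holomorphic_on {c. Re c > Re (1/2) - real k}"
      by (rule reg2F1_holomorphic_c) (use assms in auto)
    then show "(\<lambda>c. half2F1 b c \<xi>) holomorphic_on {c. Re c > Re (1/2) - real k}"
      by (rule holomorphic_transform) (use assms half2F1_eq[of "1/2"] in auto)
  qed (rule open_halfspace_Re_gt)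
  also have "(\<Union>k. {c. Re c > Re (1/2) - real k}) = UNIV"
  proof (intro set_eqI iffI UNIV_I)
    fix c :: complex
    have "Re (1/2) - real (nat \<lceil>1 - Re c\<rceil>) < Re c" by simp linarith
    then show "c \<in> (\<Union>k. {c. Re c > Re (1/2) - real k})" by blast
  qed
  finally show ?thesis .
qed

lemma Euler_integral_2F1_eq:
  assumes b: "Re b > 0" "Re c > Re b" and \<xi>: "\<xi> \<in> slit_plane"
  shows "Euler_integral_2F1 a b c \<xi> = Gamma c * reg2F1 0 b a c \<xi>"
proof -
  let ?f = "\<lambda>t. beta_weight b (c - b) t * (1 - of_real t * \<xi>) powr (- a)"
  obtain B where B: "B > 0" "\<And>t \<xi>' b'. 0 \<le> t \<Longrightarrow> t \<le> 1 \<Longrightarrow> \<xi>' \<in> {\<xi>} \<Longrightarrow> norm b' \<le> norm a \<Longrightarrow>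
        norm ((1 - of_real t * \<xi>') powr (-b')) \<le> B"
    using slit_powr_bound[of "{\<xi>}" "norm a"] \<xi> by auto
  have "integrable unit_lborel ?f"
  proof (rule Bochner_Integration.integrable_bound)
    show "integrable unit_lborel (\<lambda>t. B * norm (beta_weight b (c - b) t))"
      using b by (intro integrable_mult_right integrable_beta_weight_norm) auto
    show "?f \<in> borel_measurable unit_lborel"
      by (intro measurable_unit_lborel continuous_beta_weight_powr \<xi>)
    show "AE t in unit_lborel. norm (?f t) \<le> norm (B * norm (beta_weight b (c - b) t))"
      using B by (intro AE_I2 order.trans[OF norm_beta_weight_powr_le[of _ B]]) (auto simp: space_restrict_space)
  qed
  then have "set_integrable lborel {0<..<1} ?f"
    by (simp add: set_integrable_def integrable_restrict_space)
  from set_borel_integral_eq_integral(2)[OF this]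
  have "integral {0<..<1} ?f = (\<integral>t. ?f t \<partial>unit_lborel)"
    by (simp add: integral_restrict_space set_lebesgue_integral_def)
  then have "integral {0..1} ?f = (\<integral>t. ?f t \<partial>unit_lborel)"
    by (simp add: integral_open_interval_real)
  then show ?thesis
    unfolding Euler_integral_2F1_def
    by (simp add: beta_weight_def Gamma_def field_simps)
qed

text \<open>The Euler integral has b as its weight exponent: it is level 0 of the recursion with the
  numerator parameters exchanged, and the symmetry contained in \<open>half2F1_eq\<close> identifies
  the two.\<close>

lemma continues_2F1_half2F1:
  assumes \<xi>: "\<xi> \<in> slit_plane"
  shows "continues_2F1 (1/2) \<xi> (\<lambda>b c. Gamma c * half2F1 b c \<xi>)"
  unfolding continues_2F1_def
proof (intro conjI allI impI)
  fix c :: complex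
  show "(\<lambda>b. Gamma c * half2F1 b c \<xi>) holomorphic_on UNIV"
    by (intro holomorphic_intros half2F1_holomorphic_b \<xi>)
next
  fix b
  show "(\<lambda>c. Gamma c * half2F1 b c \<xi>) holomorphic_on - \<int>\<^sub>\<le>\<^sub>0"
    by (intro holomorphic_intros holomorphic_on_subset[OF half2F1_holomorphic_c[OF \<xi>]]) auto
next
  fix b c :: complex assume "0 < Re b" "Re b < Re c"
  then show "Gamma c * half2F1 b c \<xi> = Euler_integral_2F1 (1/2) b c \<xi>"
    using half2F1_eq[of b 0 c b "1/2" \<xi>] \<xi> by (auto simp: Euler_integral_2F1_eq)
qed

lemma hyp2F1_half:
  assumes "\<xi> \<in> slit_plane" "c \<notin> \<int>\<^sub>\<le>\<^sub>0"
  shows "hyp2F1 (1/2) b c \<xi> = Gamma c * half2F1 b c \<xi>"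
  unfolding hyp2F1_def
  by (rule continues_2F1_unique[OF _ continues_2F1_half2F1])
     (use assms continues_2F1_half2F1[OF assms(1)] in \<open>auto intro: someI[of "continues_2F1 _ _"]\<close>)

text \<open>The poles of Gamma are isolated, so a function that is continuous at c and equals the
  quotient off the poles is its value by continuity. Each \<open>div_Gamma\<close> in the theorem is
  replaced by an entire function in this way.\<close>

lemma div_Gamma_eq:
  assumes "isCont h c" and "\<And>w. w \<notin> \<int>\<^sub>\<le>\<^sub>0 \<Longrightarrow> f w / Gamma w = h w"
  shows "div_Gamma f c = h c"
proof (cases "c \<in> \<int>\<^sub>\<le>\<^sub>0")
  case True
  have "\<forall>\<^sub>F w in at c. h w = f w / Gamma w"
  proof -
    have "\<forall>\<^sub>F w in at c. w \<notin> \<int>\<^sub>\<le>\<^sub>0"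
    proof -
      \<comment> \<open>With c removed the set of poles is still closed, so some neighbourhood of c
        contains no other pole.\<close>
      have "c \<notin> (\<int>\<^sub>\<le>\<^sub>0 - {c})" "closed (\<int>\<^sub>\<le>\<^sub>0 - {c} :: complex set)"
        by (auto intro!: closed_subset_Ints elim!: nonpos_Ints_cases)
      then have "\<forall>\<^sub>F w in nhds c. w \<in> - (\<int>\<^sub>\<le>\<^sub>0 - {c})"
        using eventually_nhds_in_open[OF open_Compl] by blast
      then show ?thesis unfolding eventually_at_filter by eventually_elim auto
    qed
    then show ?thesis by eventually_elim (simp add: assms(2))
  qed
  then have "((\<lambda>w. f w / Gamma w) \<longlongrightarrow> h c) (at c)"
    using assms(1) unfolding isCont_def by (rule Lim_transform_eventually[rotated])
  then show ?thesis
    using True by (simp add: div_Gamma_def tendsto_Lim)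
qed (use assms(2) in \<open>simp add: div_Gamma_def\<close>)

lemma isCont_holomorphic_UNIV: "f holomorphic_on UNIV \<Longrightarrow> isCont f (z::complex)"
  using holomorphic_on_imp_continuous_on continuous_on_eq_continuous_at open_UNIV by blast

lemma div_Gamma_hyp2F1_half:
  assumes "\<xi> \<in> slit_plane"
  shows "div_Gamma (\<lambda>c. hyp2F1 (1/2) b c \<xi> - 1) c = half2F1 b c \<xi> - rGamma c"
proof (rule div_Gamma_eq)
  have "(\<lambda>c. half2F1 b c \<xi> - rGamma c) holomorphic_on UNIV"
    by (intro holomorphic_on_diff holomorphic_rGamma half2F1_holomorphic_c assms)
  then show "isCont (\<lambda>c. half2F1 b c \<xi> - rGamma c) c"
    by (rule isCont_holomorphic_UNIV)
  fix w :: complex assume "w \<notin> \<int>\<^sub>\<le>\<^sub>0"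
  then show "(hyp2F1 (1/2) b w \<xi> - 1) / Gamma w = half2F1 b w \<xi> - rGamma w"
  proof -
    have "Gamma w \<noteq> 0" using \<open>w \<notin> \<int>\<^sub>\<le>\<^sub>0\<close> by (simp add: Gamma_eq_zero_iff)
    then show ?thesis using \<open>w \<notin> \<int>\<^sub>\<le>\<^sub>0\<close>
      by (simp add: hyp2F1_half assms diff_divide_distrib rGamma_inverse_Gamma inverse_eq_divide)
  qed
qed

text \<open>Subtracting \<open>rGamma c\<close> removes the constant term of the power series, so a
  factor \<xi> remains. With \<xi> of order 1/n^2 this makes the correction sum converge, locally
  uniformly in c.\<close>

lemma half2F1_diff_bound:
  obtains C \<rho> where "C \<ge> 0" "\<rho> > 0" "\<rho> < 1"
    "\<And>c \<xi>. norm c \<le> R \<Longrightarrow> norm \<xi> \<le> \<rho> \<Longrightarrow> norm (half2F1 b c \<xi> - rGamma c) \<le> C * norm \<xi>"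
proof -
  obtain B where B: "B \<ge> 0" "\<And>c n. norm (c::complex) \<le> R \<Longrightarrow> norm (rGamma (c + of_nat n)) \<le> B * 4 ^ n / fact n"
    using rGamma_shift_bound[of R] by metis
  define k where "k = nat \<lceil>1 + R\<rceil>"
  \<comment> \<open>The 8 keeps the geometric ratio \<open>q = 4 * (norm b + 1) * norm \<xi>\<close>
    at most 1/2, and k keeps \<xi> inside the disc of \<open>reg2F1_sums\<close>.\<close>
  define \<rho> where "\<rho> = 1 / (8 * (norm b + 1) + real k)"
  have den: "8 * (norm b + 1) + real k \<ge> 8" by simp
  then have pos: "8 * (norm b + 1) + real k > 0" by linarith
  then have "\<rho> \<le> 1 / 8" unfolding \<rho>_def by (intro divide_left_mono den) auto
  then have \<rho>: "\<rho> < 1" "\<rho> > 0" by linarith (use pos in \<open>simp add: \<rho>_def\<close>)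
  have "norm (half2F1 b c \<xi> - rGamma c) \<le> (B * (8 * (norm b + 1))) * norm \<xi>"
    if c: "norm c \<le> R" and \<xi>: "norm \<xi> \<le> \<rho>" for c \<xi>
  proof -
    define u where "u n = pochhammer (1/2) n * pochhammer b n * rGamma (c + of_nat n) / fact n * \<xi> ^ n" for n
    define q where "q = 4 * (norm b + 1) * norm \<xi>"
    have \<xi>': "norm \<xi> * (8 * (norm b + 1) + real k) \<le> 1"
    proof -
      have "norm \<xi> * (8 * (norm b + 1) + real k) \<le> \<rho> * (8 * (norm b + 1) + real k)"
        using \<xi> pos by (intro mult_right_mono) auto
      then show ?thesis using pos by (simp add: \<rho>_def)
    qed
    have "2 * q \<le> norm \<xi> * (8 * (norm b + 1) + real k)"
      unfolding q_def by (simp add: algebra_simps)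
    then have q: "q \<le> 1/2" "q \<ge> 0" using \<xi>' by (auto simp: q_def)
    have "norm \<xi> < 1" using \<xi> \<rho> by simp
    then have slit: "\<xi> \<in> slit_plane" by (rule norm_lt_1_slit_plane)
    have "u sums reg2F1 k (1/2) b c \<xi>"
      unfolding u_def[abs_def]
    proof (rule reg2F1_sums)
      show "Re (1/2) - real k < Re c"
        using abs_Re_le_cmod[of c] c unfolding k_def by (simp; linarith)
      show "(norm b + 1 + real k) * norm \<xi> < 1"
      proof (cases "\<xi> = 0")
        case False
        then have "(norm b + 1 + real k) * norm \<xi> < (8 * (norm b + 1) + real k) * norm \<xi>"
          using norm_ge_zero[of b] by (intro mult_strict_right_mono) (simp_all add: add_pos_nonneg, linarith?)
        then show ?thesis using \<xi>' by (simp add: mult.commute)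
      qed simp
    qed auto
    also have "reg2F1 k (1/2) b c \<xi> = half2F1 b c \<xi>"
      using abs_Re_le_cmod[of c] c slit unfolding k_def
      by (intro half2F1_eq[symmetric]) (simp_all, linarith)
    finally have us: "u sums half2F1 b c \<xi>" .
    have s: "(\<lambda>n. u (Suc n)) sums (half2F1 b c \<xi> - rGamma c)"
      using us by (subst sums_Suc_iff) (simp add: u_def[of 0])
    have ub: "norm (u n) \<le> B * q ^ n" for n
    proof -
      have "norm (u n) = norm (pochhammer (1/2 :: complex) n) * norm (pochhammer b n) * norm (rGamma (c + of_nat n)) / fact n * norm \<xi> ^ n"
        by (simp add: u_def norm_mult norm_divide norm_power)
      also have "\<dots> \<le> fact n * ((norm b + 1) ^ n * fact n) * (B * 4 ^ n / fact n) / fact n * norm \<xi> ^ n"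
        by (intro mult_mono divide_right_mono norm_pochhammer_le norm_pochhammer_le_fact B(2) c)
           (auto intro!: mult_nonneg_nonneg B)
      also have "\<dots> = B * q ^ n"
        unfolding q_def power_mult_distrib by simp
      finally show ?thesis .
    qed
    have g: "(\<lambda>n. B * q * q ^ n) sums (B * q * (1 / (1 - q)))"
      using q by (intro sums_mult geometric_sums) auto
    have "norm (half2F1 b c \<xi> - rGamma c) \<le> B * q * (1 / (1 - q))"
      unfolding sums_unique[OF s] sums_unique[OF g]
      using ub[of "Suc _"] by (intro norm_suminf_le sums_summable[OF g]) (auto simp: mult_ac)
    also have "\<dots> \<le> B * q * 2"
      using q B by (intro mult_left_mono) (auto simp: field_simps)
    finally show ?thesis by (simp add: q_def mult_ac)
  qed
  with \<rho> B(1) show ?thesis by (intro that[of "B * (8 * (norm b + 1))" \<rho>]) auto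
qed

subsection \<open>The modified Bessel function K_0\<close>


abbreviation halfline_lborel :: "real measure" where
  "halfline_lborel \<equiv> restrict_space lborel {0..}"

lemma measurable_halfline_lborel:
  fixes f :: "real \<Rightarrow> 'a::topological_space"
  shows "continuous_on {0..} f \<Longrightarrow> f \<in> borel_measurable halfline_lborel"
  using borel_measurable_continuous_on_restrict[of "{0..}" f]
  by (simp cong: measurable_cong_sets add: measurable_def space_restrict_space sets_restrict_space)

text \<open>Nonnegativity makes integrability part of the conclusion; the vector-valued version that
  follows has to assume it.\<close>

lemma has_integral_FTC_halfline:
  fixes f F :: "real \<Rightarrow> real"
  assumes "\<And>x. 0 \<le> x \<Longrightarrow> (F has_real_derivative f x) (at x)" "\<And>x. 0 \<le> x \<Longrightarrow> 0 \<le> f x"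
    and "continuous_on {0..} f" and lim: "(F \<longlongrightarrow> T) at_top"
  shows "has_bochner_integral halfline_lborel f (T - F 0)"
proof -
  define g where "g x = indicator {0..} x * f x" for x
  have m: "g \<in> borel_measurable borel"
    using borel_measurable_continuous_on_indicator[OF _ assms(3)] by (simp add: g_def[abs_def])
  have nn: "0 \<le> g x" for x using assms(2) by (auto simp: g_def indicator_def)
  have eq: "(\<integral>\<^sup>+x. ennreal (g x) * indicator {0..} x \<partial>lborel) = ennreal (T - F 0)"
    by (rule nn_integral_FTC_atLeast[OF m _ _ lim]) (use assms in \<open>auto simp: g_def\<close>)
  have "F 0 \<le> T"
  proof (rule tendsto_lowerbound[OF lim])
    show "\<forall>\<^sub>F x in at_top. F 0 \<le> F x"
      using eventually_ge_at_top[of 0]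
    proof eventually_elim
      case (elim x)
      show ?case
        by (rule DERIV_nonneg_imp_nondecreasing[OF elim]) (use assms in blast)
    qed
  qed simp
  moreover have "(\<integral>\<^sup>+x. ennreal (g x) * indicator {0..} x \<partial>lborel) = (\<integral>\<^sup>+x. ennreal (g x) \<partial>lborel)"
    by (intro nn_integral_cong) (auto simp: g_def indicator_def)
  ultimately have "has_bochner_integral lborel g (T - F 0)"
    using eq m nn by (intro has_bochner_integral_nn_integral) auto
  then show ?thesis by (simp add: has_bochner_integral_restrict_space g_def[abs_def])
qed

lemma integral_FTC_halfline:
  fixes f F :: "real \<Rightarrow> 'a::euclidean_space"
  assumes "\<And>x. 0 \<le> x \<Longrightarrow> (F has_vector_derivative f x) (at x)"
    and "continuous_on {0..} f" and "integrable halfline_lborel f" and lim: "(F \<longlongrightarrow> T) at_top"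
  shows "(\<integral>x. f x \<partial>halfline_lborel) = T - F 0"
proof -
  let ?g = "\<lambda>x. indicator {0..} x *\<^sub>R f x"
  have "integrable lborel ?g" using assms(3) by (simp add: integrable_restrict_space)
  from tendsto_integral_at_top[OF _ this]
  have l1: "((\<lambda>y. \<integral>x. indicator {..y} x *\<^sub>R ?g x \<partial>lborel) \<longlongrightarrow> (\<integral>x. f x \<partial>halfline_lborel)) at_top"
    by (simp add: integral_restrict_space)
  have l2: "((\<lambda>y. F y - F 0) \<longlongrightarrow> T - F 0) at_top" by (intro tendsto_intros lim)
  have "\<forall>\<^sub>F y in at_top. F y - F 0 = (\<integral>x. indicator {..y} x *\<^sub>R ?g x \<partial>lborel)"
    using eventually_ge_at_top[of 0]
  proof eventually_elim
    case (elim y)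
    have "(\<integral>x. indicator {0..y} x *\<^sub>R f x \<partial>lborel) = F y - F 0"
      by (rule integral_FTC_Icc)
         (use elim assms in \<open>auto intro: has_vector_derivative_at_within continuous_on_subset\<close>)
    moreover have "(\<lambda>x. indicator {..y} x *\<^sub>R ?g x) = (\<lambda>x. indicator {0..y} x *\<^sub>R f x)"
      by (auto simp: fun_eq_iff indicator_def)
    ultimately show ?case by simp
  qed
  from tendsto_cong[THEN iffD1, OF this l2] show ?thesis
    by (rule tendsto_unique[OF _ l1, rotated]) simp
qed

lemma has_integral_exp_halfline:
  assumes "a > (0::real)"
  shows "has_bochner_integral halfline_lborel (\<lambda>x. exp (- a * x)) (1 / a)"
proof -
  have "has_bochner_integral halfline_lborel (\<lambda>x. exp (- a * x)) (0 - (- exp (- a * 0) / a))"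
  proof (rule has_integral_FTC_halfline)
    show "((\<lambda>x. - exp (- a * x) / a) \<longlongrightarrow> 0) at_top"
      using assms by real_asymp
  qed (use assms in \<open>auto intro!: derivative_eq_intros continuous_intros\<close>)
  then show ?thesis by simp
qed

definition besselK0 :: "complex \<Rightarrow> complex" where
  "besselK0 y = (\<integral>t. exp (- y * of_real (cosh t)) \<partial>halfline_lborel)"

lemma cosh_real_ge_exp: "cosh (t::real) \<ge> exp t / 2"
  by (simp add: cosh_def)

lemma exp_neg_le_powr:
  assumes "u > 0" "p > (0::real)"
  shows "exp (- u) \<le> p powr p * u powr (- p)"
proof -
  have "u / p \<le> exp (u / p)" using exp_ge_add_one_self[of "u / p"] by linarith
  then have "(u / p) powr p \<le> exp (u / p) powr p"
    using assms by (intro powr_mono2) auto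
  also have "\<dots> = exp u" using assms by (simp add: exp_powr_real)
  finally have "u powr p / p powr p \<le> exp u" using assms by (simp add: powr_divide)
  then show ?thesis using assms by (simp add: exp_minus powr_minus field_simps)
qed

text \<open>Since cosh t >= e^t / 2, decay of order p in the argument becomes exponential decay in
  t.\<close>

lemma besselK0_integrand_bound:
  assumes "0 < r" "r \<le> Re y" "p > 0"
  shows "norm (exp (- y * of_real (cosh t))) \<le> (2 * p) powr p * r powr (- p) * exp (- p * t)"
proof -
  have c: "cosh t \<ge> exp t / 2" "cosh t > 0" using cosh_real_ge_exp[of t] by (auto simp: cosh_real_pos)
  have "norm (exp (- y * of_real (cosh t))) = exp (- (Re y * cosh t))" by simp
  also have "\<dots> \<le> exp (- (r * (exp t / 2)))"
    using mult_mono[of r "Re y" "exp t / 2" "cosh t"] assms c by simp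
  also have "\<dots> \<le> p powr p * (r * (exp t / 2)) powr (- p)"
    using assms by (intro exp_neg_le_powr) auto
  also have "\<dots> = (2 * p) powr p * r powr (- p) * exp (- p * t)"
    using assms by (simp add: powr_mult powr_divide exp_powr_real powr_minus field_simps exp_minus)
  finally show ?thesis .
qed

lemma besselK0_integrand_continuous: "continuous_on A (\<lambda>t. exp (- y * complex_of_real (cosh t)))"
  by (intro continuous_intros)

lemma integrable_besselK0:
  assumes "Re y > 0" shows "integrable halfline_lborel (\<lambda>t. exp (- y * complex_of_real (cosh t)))"
proof (rule Bochner_Integration.integrable_bound)
  show "integrable halfline_lborel (\<lambda>t. (2 * 1) powr 1 * (Re y) powr (- 1) * exp (- 1 * t))"
    using has_integral_exp_halfline[of 1] by (intro integrable_mult_right) (simp add: has_bochner_integral_iff)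
  show "AE t in halfline_lborel. norm (exp (- y * complex_of_real (cosh t)))
      \<le> norm ((2 * 1) powr 1 * (Re y) powr (- 1) * exp (- 1 * t))"
    using besselK0_integrand_bound[of "Re y" y 1] assms by (intro AE_I2) simp
qed (intro measurable_halfline_lborel besselK0_integrand_continuous)

text \<open>The order p stays free: summation over n needs p > 1, while integrating K_0 (y sqrt v)
  against v^(s-1) needs p < 2 Re s.\<close>

lemma besselK0_bound:
  assumes "Re y > 0" "p > 0"
  shows "norm (besselK0 y) \<le> (2 * p) powr p / p * (Re y) powr (- p)"
proof -
  let ?C = "(2 * p) powr p * (Re y) powr (- p)"
  have i: "has_bochner_integral halfline_lborel (\<lambda>t. ?C * exp (- p * t)) (?C * (1 / p))"
    by (intro has_bochner_integral_mult_right has_integral_exp_halfline assms)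
  have "norm (besselK0 y) \<le> (\<integral>t. norm (exp (- y * complex_of_real (cosh t))) \<partial>halfline_lborel)"
    unfolding besselK0_def by (rule integral_norm_bound)
  also have "\<dots> \<le> (\<integral>t. ?C * exp (- p * t) \<partial>halfline_lborel)"
    using i besselK0_integrand_bound[of "Re y" y p] assms
    by (intro integral_mono integrable_norm integrable_besselK0) (auto simp: has_bochner_integral_iff)
  also have "\<dots> = ?C * (1 / p)" using i by (simp add: has_bochner_integral_iff)
  finally show ?thesis by simp
qed

lemma holomorphic_besselK0_aux:
  shows "besselK0 holomorphic_on {y. Re y > 0}"
    and "Re y > 0 \<Longrightarrow> integrable halfline_lborel (\<lambda>t. deriv (\<lambda>y. exp (- y * of_real (cosh t))) y)"
    and "Re y > 0 \<Longrightarrow> (besselK0 has_field_derivative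
          (\<integral>t. deriv (\<lambda>y. exp (- y * of_real (cosh t))) y \<partial>halfline_lborel)) (at y)"
proof -
  have bd: "\<exists>r g. r > 0 \<and> integrable halfline_lborel g \<and> (\<forall>z\<in>ball y0 r \<inter> {y. Re y > 0}.
       \<forall>t\<in>space halfline_lborel. norm (exp (- z * complex_of_real (cosh t))) \<le> g t)"
    if "y0 \<in> {y. Re y > 0}" for y0
  proof -
    have "norm (exp (- z * complex_of_real (cosh t))) \<le> (2 * 1) powr 1 * (Re y0 / 2) powr (- 1) * exp (- 1 * t)"
      if "z \<in> ball y0 (Re y0 / 2)" for z t
      using ball_Re[OF that] \<open>y0 \<in> _\<close> by (intro besselK0_integrand_bound) auto
    moreover have "integrable halfline_lborel (\<lambda>t. (2 * 1) powr 1 * (Re y0 / 2) powr (- 1) * exp (- 1 * t))"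
      using has_integral_exp_halfline[of 1] by (intro integrable_mult_right) (simp add: has_bochner_integral_iff)
    ultimately show ?thesis using that
      by (intro exI[of _ "Re y0 / 2"] exI[of _ "\<lambda>t. (2 * 1) powr 1 * (Re y0 / 2) powr (- 1) * exp (- 1 * t)"] conjI ballI)
         auto
  qed
  have 1: "\<And>z. z \<in> {y. Re y > 0} \<Longrightarrow> (\<lambda>t. exp (- z * complex_of_real (cosh t))) \<in> borel_measurable halfline_lborel"
    by (intro measurable_halfline_lborel besselK0_integrand_continuous)
  have 2: "open {y. Re y > 0}" by (rule open_halfspace_Re_gt)
  have 3: "\<And>t. t \<in> space halfline_lborel \<Longrightarrow> (\<lambda>z. exp (- z * complex_of_real (cosh t))) holomorphic_on {y. Re y > 0}"
    by (intro holomorphic_intros)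
  note p = holomorphic_on_integral_param[OF 1 2 3 bd]
  show "besselK0 holomorphic_on {y. Re y > 0}" using p(1) by (simp add: besselK0_def[abs_def])
  assume "Re y > 0"
  then show "integrable halfline_lborel (\<lambda>t. deriv (\<lambda>y. exp (- y * of_real (cosh t))) y)"
    "(besselK0 has_field_derivative
          (\<integral>t. deriv (\<lambda>y. exp (- y * of_real (cosh t))) y \<partial>halfline_lborel)) (at y)"
    using p(2,3)[of y] by (simp_all add: besselK0_def[abs_def])
qed

section \<open>Partial fractions of 1/(e^u - 1)\<close>

text \<open>The logarithmic derivative of the reflection formula is Digamma z - Digamma (1 - z) = -
  pi cot (pi z), and the limit formula for Digamma turns the left side into a series in which the
  logarithms cancel.\<close>

lemma pi_cot_partial_fractions:
  assumes z: "z \<notin> (\<int> :: complex set)"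
  shows "(\<lambda>n. 1 / (z + of_nat (Suc n)) + 1 / (z - of_nat (Suc n))) sums (of_real pi * cot (of_real pi * z) - 1 / z)"
proof -
  have z1: "1 - z \<notin> \<int>" using z Ints_diff[of 1 "1 - z"] by auto
  have nz: "z \<notin> \<int>\<^sub>\<le>\<^sub>0" "1 - z \<notin> \<int>\<^sub>\<le>\<^sub>0"
    using z z1 nonpos_Ints_subset_Ints by blast+
  have refl: "Digamma z - Digamma (1 - z) = - (of_real pi * cot (of_real pi * z))"
  proof -
    have op: "open (- \<int> :: complex set)" by (simp add: open_Compl)
    have s0: "sin (of_real pi * z) \<noteq> 0"
      using z sin_eq_0[of "of_real pi * z"] by (auto simp: sin_eq_0)
    have "((\<lambda>z. Gamma z * Gamma (1 - z)) has_field_derivative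
        (Gamma z * Gamma (1 - z) * (Digamma z - Digamma (1 - z)))) (at z)"
      using nz by (auto intro!: derivative_eq_intros simp: algebra_simps)
    moreover have "((\<lambda>z. of_real pi / sin (of_real pi * z)) has_field_derivative
        (- (of_real pi * of_real pi * cos (of_real pi * z)) / (sin (of_real pi * z) * sin (of_real pi * z)))) (at z)"
      using s0 by (auto intro!: derivative_eq_intros simp: field_simps)
    ultimately have "Gamma z * Gamma (1 - z) * (Digamma z - Digamma (1 - z)) =
       - (of_real pi * of_real pi * cos (of_real pi * z)) / (sin (of_real pi * z) * sin (of_real pi * z))"
      unfolding Gamma_reflection_complex by (rule DERIV_unique)
    then have "sin (of_real pi * z) / of_real pi * (of_real pi / sin (of_real pi * z) * (Digamma z - Digamma (1 - z))) =
       sin (of_real pi * z) / of_real pi * (- (of_real pi * of_real pi * cos (of_real pi * z)) / (sin (of_real pi * z) * sin (of_real pi * z)))"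
      unfolding Gamma_reflection_complex by simp
    then show ?thesis using s0 unfolding cot_def by simp
  qed
  have zn: "z \<noteq> 0" "1 - z \<noteq> 0" using z z1 by auto
  have "(\<lambda>m. (of_real (ln (real m)) - (\<Sum>n<m. inverse (z + of_nat n))) -
      (of_real (ln (real m)) - (\<Sum>n<m. inverse (1 - z + of_nat n)))) \<longlonglongrightarrow> Digamma z - Digamma (1 - z)"
    by (intro tendsto_diff Digamma_LIMSEQ zn)
  then have 1: "(\<lambda>m. (\<Sum>n<m. inverse (1 - z + of_nat n) - inverse (z + of_nat n))) \<longlonglongrightarrow> Digamma z - Digamma (1 - z)"
    by (simp add: sum_subtractf)
  have 2: "(\<lambda>m. 1 / (z + of_nat m)) \<longlonglongrightarrow> 0"
  proof -
    have "filterlim (\<lambda>m. z + of_nat m) at_infinity sequentially"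
      using tendsto_add_filterlim_at_infinity[OF tendsto_const[of z] tendsto_of_nat] .
    then show ?thesis by (rule tendsto_divide_0[OF tendsto_const])
  qed
  \<comment> \<open>The sum for Digamma z starts at 1/z, the wanted one at 1/(z + 1): hence the
    boundary terms 1/(z + m) and - 1/z.\<close>
  have "(\<Sum>n<m. 1 / (z + of_nat (Suc n)) + 1 / (z - of_nat (Suc n))) =
     - (\<Sum>n<m. inverse (1 - z + of_nat n) - inverse (z + of_nat n)) + 1 / (z + of_nat m) - 1 / z" for m
  proof (induction m)
    case (Suc m)
    have "1 / (z - of_nat (Suc m)) = - inverse (1 - z + of_nat m)"
    proof -
      have "1 - z + of_nat m = - (z - of_nat (Suc m))" by simp
      then show ?thesis by (simp only: inverse_eq_divide[symmetric] inverse_minus_eq minus_minus)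
    qed
    then show ?case using Suc.IH by (simp add: inverse_eq_divide)
  qed simp
  moreover have "(\<lambda>m. - (\<Sum>n<m. inverse (1 - z + of_nat n) - inverse (z + of_nat n)) + 1 / (z + of_nat m) - 1 / z)
     \<longlonglongrightarrow> - (Digamma z - Digamma (1 - z)) + 0 - 1 / z"
    by (intro tendsto_intros 1 2)
  ultimately show ?thesis unfolding sums_def refl by simp
qed

lemma inverse_exp_minus_1_partial_fractions:
  assumes u: "u > (0::real)"
  shows "(\<lambda>n. 2 * u / (u\<^sup>2 + 4 * pi\<^sup>2 * (real (Suc n))\<^sup>2)) sums (1 / (exp u - 1) - 1 / u + 1 / 2)"
proof -
  \<comment> \<open>At this imaginary z, pi cot (pi z) equals - i pi (e^u + 1)/(e^u - 1); the factor
    i / (2 pi) makes the whole identity real.\<close>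
  define z where "z = \<i> * of_real u / (2 * of_real pi)"
  have z: "z \<notin> \<int>" using u by (auto simp: z_def Ints_def complex_eq_iff)
  have uz: "of_real pi * z = \<i> * of_real u / 2" by (simp add: z_def)
  define e where "e = exp (complex_of_real u)"
  have "e = of_real (exp u)" by (simp add: e_def exp_of_real)
  then have e1: "e \<noteq> 1" using u by (metis exp_eq_one_iff less_irrefl of_real_eq_1_iff)
  have cot: "of_real pi * cot (of_real pi * z) = - \<i> * of_real pi * ((e + 1) / (e - 1))"
  proof -
    define h where "h = exp (complex_of_real u / 2)"
    have h: "h * h = e" "h \<noteq> 0" unfolding h_def e_def by (simp_all flip: exp_add)
    have c: "cos (of_real pi * z) = (h + 1/h) / 2" "sin (of_real pi * z) = \<i> * (h - 1/h) / 2"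
      unfolding uz cos_exp_eq sin_exp_eq h_def by (simp_all add: exp_minus field_simps)
    have "(h + 1/h) = (e + 1) / h" "(h - 1/h) = (e - 1) / h" using h by (simp_all add: field_simps)
    then show ?thesis unfolding cot_def c using h e1 by (simp add: field_simps)
  qed
  have "(\<lambda>n. (\<i> / (2 * of_real pi)) * (1 / (z + of_nat (Suc n)) + 1 / (z - of_nat (Suc n)))) sums
     ((\<i> / (2 * of_real pi)) * (of_real pi * cot (of_real pi * z) - 1 / z))"
    by (intro sums_mult pi_cot_partial_fractions z)
  also have "(\<lambda>n. (\<i> / (2 * of_real pi)) * (1 / (z + of_nat (Suc n)) + 1 / (z - of_nat (Suc n)))) =
     (\<lambda>n. complex_of_real (2 * u / (u\<^sup>2 + 4 * pi\<^sup>2 * (real (Suc n))\<^sup>2)))"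
  proof
    fix n
    define m where "m = complex_of_nat (Suc n)"
    have m: "z + m \<noteq> 0" "z - m \<noteq> 0"
      using z Ints_minus[of m] by (auto simp: m_def add_eq_0_iff2)
    have "1 / (z + m) + 1 / (z - m) = 2 * z / ((z + m) * (z - m))"
      using m by (simp add: field_simps)
    also have "(z + m) * (z - m) = z\<^sup>2 - m\<^sup>2" by (simp add: algebra_simps power2_eq_square)
    also have "z\<^sup>2 = - (of_real u)\<^sup>2 / (4 * (of_real pi)\<^sup>2)"
      by (simp add: z_def power_divide power_mult_distrib)
    also have "\<dots> - m\<^sup>2 = - ((of_real u)\<^sup>2 + 4 * (of_real pi)\<^sup>2 * m\<^sup>2) / (4 * (of_real pi)\<^sup>2)"
      by (simp add: field_simps)
    finally have *: "1 / (z + m) + 1 / (z - m) = 2 * z / (- ((of_real u)\<^sup>2 + 4 * (of_real pi)\<^sup>2 * m\<^sup>2) / (4 * (of_real pi)\<^sup>2))" .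
    have G: "(\<i> / (2 * of_real pi)) * (2 * z / (- E / (4 * (of_real pi)\<^sup>2))) = 2 * of_real u / E" for E
      by (cases "E = 0") (simp_all add: z_def field_simps power2_eq_square)
    have "(\<i> / (2 * of_real pi)) * (1 / (z + m) + 1 / (z - m)) =
       2 * of_real u / ((of_real u)\<^sup>2 + 4 * (of_real pi)\<^sup>2 * m\<^sup>2)"
      unfolding * by (rule G)
    then show "(\<i> / (2 * of_real pi)) * (1 / (z + of_nat (Suc n)) + 1 / (z - of_nat (Suc n))) =
     complex_of_real (2 * u / (u\<^sup>2 + 4 * pi\<^sup>2 * (real (Suc n))\<^sup>2))" by (simp add: m_def)
  qed
  also have "(\<i> / (2 * of_real pi)) * (of_real pi * cot (of_real pi * z) - 1 / z) =
     complex_of_real (1 / (exp u - 1) - 1 / u + 1 / 2)"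
  proof -
    have 1: "complex_of_real (1 / (exp u - 1) - 1 / u + 1 / 2) = (1 / (e - 1) + 1 / 2) - 1 / of_real u"
      by (simp add: e_def exp_of_real)
    have 2: "1 / (e - 1) + 1 / 2 = (e + 1) / (e - 1) / 2" using e1 by (simp add: field_simps)
    have 3: "(\<i> / (2 * of_real pi)) * (1 / z) = 1 / of_real u" using u by (simp add: z_def field_simps)
    have "(\<i> / (2 * of_real pi)) * (- \<i> * of_real pi * Q) = Q / 2" for Q by simp
    then show ?thesis unfolding 1 2 right_diff_distrib 3 cot by (simp only:)
  qed
  finally show ?thesis by (simp only: sums_of_real_iff)
qed

section \<open>Integrating the partial fractions over the half-line\<close>

text \<open>In the variable sinh t the integrand is that of an arctan. The case b = 0 is included
  because it gives the integral of 2 / (x cosh t).\<close>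

lemma besselK0_term_integral:
  assumes x: "x > 0" and b: "b \<ge> 0"
  shows "has_bochner_integral halfline_lborel (\<lambda>t. 2 * (x * cosh t) / ((x * cosh t)\<^sup>2 + b\<^sup>2)) (pi / sqrt (x\<^sup>2 + b\<^sup>2))"
proof -
  define D where "D = x\<^sup>2 + b\<^sup>2"
  have D: "D > 0" using x by (simp add: D_def add_pos_nonneg)
  define F where "F t = 2 / sqrt D * arctan (x * sinh t / sqrt D)" for t
  have "has_bochner_integral halfline_lborel (\<lambda>t. 2 * (x * cosh t) / ((x * cosh t)\<^sup>2 + b\<^sup>2)) (pi / sqrt D - F 0)"
  proof (rule has_integral_FTC_halfline)
    fix t :: real
    have c: "(cosh t)\<^sup>2 = 1 + (sinh t)\<^sup>2" by (simp add: cosh_square_eq)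
    have p: "(x * cosh t)\<^sup>2 + b\<^sup>2 = D + x\<^sup>2 * (sinh t)\<^sup>2"
      by (simp add: D_def power_mult_distrib c algebra_simps)
    have p0: "D + x\<^sup>2 * (sinh t)\<^sup>2 > 0" using D by (simp add: add_pos_nonneg)
    have "(F has_real_derivative 2 / sqrt D * (x * cosh t / sqrt D / (1 + (x * sinh t / sqrt D)\<^sup>2))) (at t)"
      unfolding F_def using D by (auto intro!: derivative_eq_intros simp: divide_inverse)
    also have "2 / sqrt D * (x * cosh t / sqrt D / (1 + (x * sinh t / sqrt D)\<^sup>2)) =
        2 * (x * cosh t) / (D + x\<^sup>2 * (sinh t)\<^sup>2)"
    proof -
      have "1 + (x * sinh t / sqrt D)\<^sup>2 = (D + x\<^sup>2 * (sinh t)\<^sup>2) / D"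
        using D by (simp add: power_divide power_mult_distrib field_simps)
      moreover have "2 / r * (k / r / (E / D)) = 2 * k / (r * r) * (D / E)" for r k E :: real by simp
      ultimately have "2 / sqrt D * (x * cosh t / sqrt D / (1 + (x * sinh t / sqrt D)\<^sup>2)) =
          2 * (x * cosh t) / (sqrt D * sqrt D) * (D / (D + x\<^sup>2 * (sinh t)\<^sup>2))" by (simp only:)
      also have "sqrt D * sqrt D = D" using D by simp
      finally show ?thesis using D by simp
    qed
    finally show "(F has_real_derivative 2 * (x * cosh t) / ((x * cosh t)\<^sup>2 + b\<^sup>2)) (at t)"
      by (simp only: p)
    show "0 \<le> 2 * (x * cosh t) / ((x * cosh t)\<^sup>2 + b\<^sup>2)"
      using x by (intro divide_nonneg_nonneg) (auto simp: cosh_real_nonneg)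
  next
    have "(x * cosh t)\<^sup>2 + b\<^sup>2 \<noteq> 0" for t
      using x cosh_real_pos[of t] by (simp add: sum_power2_eq_zero_iff)
    then show "continuous_on {0..} (\<lambda>t. 2 * (x * cosh t) / ((x * cosh t)\<^sup>2 + b\<^sup>2))"
      by (intro continuous_intros) auto
  next
    have "filterlim (\<lambda>t::real. x / sqrt D * sinh t) at_top at_top"
      using x D by (intro filterlim_tendsto_pos_mult_at_top[OF tendsto_const] sinh_real_at_top) auto
    then have "((\<lambda>t. arctan (x / sqrt D * sinh t)) \<longlongrightarrow> pi / 2) at_top"
      by (rule filterlim_compose[OF tendsto_arctan_at_top])
    then have "((\<lambda>t. 2 / sqrt D * arctan (x / sqrt D * sinh t)) \<longlongrightarrow> 2 / sqrt D * (pi / 2)) at_top"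
      by (intro tendsto_intros)
    then show "(F \<longlongrightarrow> pi / sqrt D) at_top" by (simp add: F_def[abs_def])
  qed
  then show ?thesis by (simp add: F_def D_def)
qed

text \<open>Tonelli: up to 1/pi the arctan is itself the integral over \<nu> in [0, N] of the
  integrand of \<open>besselK0_term_integral\<close> with b = 2 pi \<nu>. Integrating over t at
  fixed \<nu> leaves pi / sqrt (x^2 + (2 pi \<nu>)^2), the derivative of arsinh (2 pi \<nu> / x) /
  2.\<close>

lemma has_integral_arctan_cosh:
  assumes x: "x > 0" and N: "N \<ge> 0"
  shows "has_bochner_integral halfline_lborel (\<lambda>t. arctan (2 * pi * N / (x * cosh t)) / pi)
           (arsinh (2 * pi * N / x) / 2)"
proof -
  define h where "h \<nu> t = 2 * (x * cosh t) / ((x * cosh t)\<^sup>2 + (2 * pi * \<nu>)\<^sup>2) * indicator {0..N} \<nu> * indicator {0..} t"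
    for \<nu> t :: real
  have c0: "x * cosh t > 0" for t using x by (simp add: cosh_real_pos)
  have h0: "h \<nu> t \<ge> 0" for \<nu> t
    unfolding h_def using c0[of t] by (auto simp: indicator_def intro!: divide_nonneg_nonneg)
  have mc [measurable]: "(cosh :: real \<Rightarrow> real) \<in> borel_measurable borel"
    by (intro borel_measurable_continuous_onI continuous_intros)
  have meas: "case_prod (\<lambda>\<nu> t. ennreal (h \<nu> t)) \<in> borel_measurable (lborel \<Otimes>\<^sub>M lborel)"
  proof -
    have "case_prod (\<lambda>\<nu> t. ennreal (h \<nu> t)) \<in> borel_measurable (borel \<Otimes>\<^sub>M borel)"
      unfolding h_def case_prod_beta by measurable
    moreover have "sets (lborel \<Otimes>\<^sub>M lborel) = sets (borel \<Otimes>\<^sub>M borel :: (real \<times> real) measure)"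
      by (intro sets_pair_measure_cong) auto
    ultimately show ?thesis by (simp cong: measurable_cong_sets)
  qed
  have inner1: "(\<integral>\<^sup>+t. ennreal (h \<nu> t) \<partial>lborel) = ennreal (pi / sqrt (x\<^sup>2 + (2 * pi * \<nu>)\<^sup>2) * indicator {0..N} \<nu>)" for \<nu>
  proof (cases "\<nu> \<in> {0..N}")
    case True
    have "has_bochner_integral lborel (\<lambda>t. indicator {0..} t * (2 * (x * cosh t) / ((x * cosh t)\<^sup>2 + (2 * pi * \<nu>)\<^sup>2)))
       (pi / sqrt (x\<^sup>2 + (2 * pi * \<nu>)\<^sup>2))"
      using besselK0_term_integral[OF x, of "2 * pi * \<nu>"] True
      by (simp add: has_bochner_integral_restrict_space)
    also have "(\<lambda>t. indicator {0..} t * (2 * (x * cosh t) / ((x * cosh t)\<^sup>2 + (2 * pi * \<nu>)\<^sup>2))) = h \<nu>"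
      using True by (simp add: h_def fun_eq_iff)
    finally have i: "has_bochner_integral lborel (h \<nu>) (pi / sqrt (x\<^sup>2 + (2 * pi * \<nu>)\<^sup>2))" .
    show ?thesis
      using True h0 i by (subst nn_integral_eq_integral) (auto simp: has_bochner_integral_iff)
  qed (simp add: h_def)
  have inner2: "(\<integral>\<^sup>+\<nu>. ennreal (h \<nu> t) \<partial>lborel) = ennreal (arctan (2 * pi * N / (x * cosh t)) / pi * indicator {0..} t)" for t
  proof (cases "t \<ge> 0")
    case True
    let ?z = "x * cosh t"
    have "(\<integral>\<^sup>+\<nu>. ennreal (2 * ?z / (?z\<^sup>2 + (2 * pi * \<nu>)\<^sup>2)) * indicator {0..N} \<nu> \<partial>lborel)
       = ennreal (arctan (2 * pi * N / ?z) / pi - arctan (2 * pi * 0 / ?z) / pi)"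
    proof (rule nn_integral_FTC_Icc)
      fix \<nu> :: real
      have "((\<lambda>\<nu>. arctan (2 * pi * \<nu> / ?z) / pi) has_real_derivative (2 * pi / ?z) / (1 + (2 * pi * \<nu> / ?z)\<^sup>2) / pi) (at \<nu>)"
        using c0[of t] x by (auto intro!: derivative_eq_intros simp: divide_inverse)
      also have "(2 * pi / ?z) / (1 + (2 * pi * \<nu> / ?z)\<^sup>2) / pi = 2 * ?z / (?z\<^sup>2 + (2 * pi * \<nu>)\<^sup>2)"
      proof -
        have "1 + (2 * pi * \<nu> / ?z)\<^sup>2 = (?z\<^sup>2 + (2 * pi * \<nu>)\<^sup>2) / ?z\<^sup>2"
        proof -
          have "1 + (k / w)\<^sup>2 = (w\<^sup>2 + k\<^sup>2) / w\<^sup>2" if "w > 0" for w k :: real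
            using that by (simp add: power_divide field_simps)
          then show ?thesis using c0[of t] by blast
        qed
        then have eq: "1 + (2 * pi * \<nu> / ?z)\<^sup>2 = (?z\<^sup>2 + (2 * pi * \<nu>)\<^sup>2) / ?z\<^sup>2" .
        have "(2 * pi / w) / (E / w\<^sup>2) / pi = 2 * w / E" if "w > 0" for w E :: real
          using that by (simp add: power2_eq_square)
        from this[OF c0] show ?thesis unfolding eq .
      qed
      finally show "((\<lambda>\<nu>. arctan (2 * pi * \<nu> / ?z) / pi) has_real_derivative 2 * ?z / (?z\<^sup>2 + (2 * pi * \<nu>)\<^sup>2)) (at \<nu>)" .
      show "0 \<le> 2 * ?z / (?z\<^sup>2 + (2 * pi * \<nu>)\<^sup>2)" using c0[of t] by (intro divide_nonneg_nonneg) auto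
    qed (use N in auto)
    moreover have "(\<integral>\<^sup>+\<nu>. ennreal (h \<nu> t) \<partial>lborel) =
        (\<integral>\<^sup>+\<nu>. ennreal (2 * ?z / (?z\<^sup>2 + (2 * pi * \<nu>)\<^sup>2)) * indicator {0..N} \<nu> \<partial>lborel)"
      using True by (intro nn_integral_cong) (auto simp: h_def indicator_def)
    ultimately show ?thesis using True by simp
  qed (simp add: h_def)
  have "(\<integral>\<^sup>+t. ennreal (arctan (2 * pi * N / (x * cosh t)) / pi * indicator {0..} t) \<partial>lborel) =
      (\<integral>\<^sup>+\<nu>. ennreal (pi / sqrt (x\<^sup>2 + (2 * pi * \<nu>)\<^sup>2) * indicator {0..N} \<nu>) \<partial>lborel)"
    using lborel_pair.Fubini'[OF meas] unfolding inner1 inner2 .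
  also have "\<dots> = (\<integral>\<^sup>+\<nu>. ennreal (pi / sqrt (x\<^sup>2 + (2 * pi * \<nu>)\<^sup>2)) * indicator {0..N} \<nu> \<partial>lborel)"
    by (intro nn_integral_cong) (auto simp: indicator_def)
  also have "\<dots> = ennreal (arsinh (2 * pi * N / x) / 2 - arsinh (2 * pi * 0 / x) / 2)"
  proof (rule nn_integral_FTC_Icc)
    fix \<nu> :: real
    have "((\<lambda>\<nu>. 2 * pi * \<nu> / x) has_real_derivative 2 * pi / x) (at \<nu>)"
      using x by (auto intro!: derivative_eq_intros)
    from DERIV_cdivide[OF DERIV_chain2[OF arsinh_real_has_field_derivative this], of 2]
    have "((\<lambda>\<nu>. arsinh (2 * pi * \<nu> / x) / 2) has_real_derivative ((2 * pi / x) / sqrt ((2 * pi * \<nu> / x)\<^sup>2 + 1)) / 2) (at \<nu>)"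
      by (simp add: mult.commute)
    also have "((2 * pi / x) / sqrt ((2 * pi * \<nu> / x)\<^sup>2 + 1)) / 2 = pi / sqrt (x\<^sup>2 + (2 * pi * \<nu>)\<^sup>2)"
    proof -
      have "(2 * pi * \<nu> / x)\<^sup>2 + 1 = (x\<^sup>2 + (2 * pi * \<nu>)\<^sup>2) / x\<^sup>2"
        using x by (simp add: power_divide field_simps)
      then have "sqrt ((2 * pi * \<nu> / x)\<^sup>2 + 1) = sqrt (x\<^sup>2 + (2 * pi * \<nu>)\<^sup>2) / x"
        using x by (simp add: real_sqrt_divide)
      then show ?thesis using x by simp
    qed
    finally show "((\<lambda>\<nu>. arsinh (2 * pi * \<nu> / x) / 2) has_real_derivative pi / sqrt (x\<^sup>2 + (2 * pi * \<nu>)\<^sup>2)) (at \<nu>)" .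
  qed (use N in auto)
  finally have eq: "(\<integral>\<^sup>+t. ennreal (indicator {0..} t * (arctan (2 * pi * N / (x * cosh t)) / pi)) \<partial>lborel) = ennreal (arsinh (2 * pi * N / x) / 2)"
    by (simp add: mult.commute)
  have "has_bochner_integral lborel (\<lambda>t. indicator {0..} t * (arctan (2 * pi * N / (x * cosh t)) / pi)) (arsinh (2 * pi * N / x) / 2)"
  proof (rule has_bochner_integral_nn_integral[OF _ _ _ eq])
    have cn: "cosh t \<noteq> 0" for t :: real using cosh_real_pos[of t] by simp
    have "continuous_on {0..} (\<lambda>t. arctan (2 * pi * N / (x * cosh t)) / pi)"
      using x by (intro continuous_intros) (auto simp: cn)
    then show "(\<lambda>t. indicator {0..} t * (arctan (2 * pi * N / (x * cosh t)) / pi)) \<in> borel_measurable lborel"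
      using borel_measurable_continuous_on_indicator by fastforce
    have "arctan (2 * pi * N / (x * cosh t)) \<ge> 0" for t
      using c0[of t] N by (simp add: zero_le_arctan_iff divide_nonneg_nonneg)
    then show "AE t in lborel. 0 \<le> indicator {0..} t * (arctan (2 * pi * N / (x * cosh t)) / pi)"
      by (auto simp: indicator_def)
    have "0 \<le> arsinh y" if "y \<ge> 0" for y :: real
    proof -
      have "1 \<le> sqrt (y\<^sup>2 + 1)" by simp
      with that have "1 \<le> y + sqrt (y\<^sup>2 + 1)" by linarith
      then show ?thesis unfolding arsinh_real_def by (rule ln_ge_zero)
    qed
    then show "0 \<le> arsinh (2 * pi * N / x) / 2" using x N by simp
  qed
  then show ?thesis by (simp add: has_bochner_integral_restrict_space)
qed

subsection \<open>Summing K_0 over multiples\<close>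


lemma besselK0_of_real:
  "besselK0 (of_real x) = of_real (\<integral>t. exp (- (x * cosh t)) \<partial>halfline_lborel)"
proof -
  have "exp (- complex_of_real x * of_real (cosh t)) = of_real (exp (- (x * cosh t)))" for t
    by (simp flip: exp_of_real)
  then show ?thesis unfolding besselK0_def by (simp del: of_real_exp)
qed

lemma integrable_exp_cosh:
  assumes "x > 0" shows "integrable halfline_lborel (\<lambda>t. exp (- (x * cosh t)))"
proof -
  have "integrable halfline_lborel (\<lambda>t. Re (exp (- complex_of_real x * of_real (cosh t))))"
    using integrable_besselK0[of "of_real x"] assms by (intro integrable_Re) simp
  then show ?thesis by (simp add: Re_exp)
qed

lemma exp_minus_1_series:
  assumes "z > (0::real)" shows "(\<lambda>n. exp (- (real (Suc n) * z))) sums (1 / (exp z - 1))"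
proof -
  have "(\<lambda>n. exp (- z) * exp (- z) ^ n) sums (exp (- z) * (1 / (1 - exp (- z))))"
    using assms by (intro sums_mult geometric_sums) simp
  also have "(\<lambda>n. exp (- z) * exp (- z) ^ n) = (\<lambda>n. exp (- (real (Suc n) * z)))"
  proof
    fix n
    have "exp (- z) * exp (- z) ^ n = exp (- z) ^ Suc n" by simp
    also have "\<dots> = exp (real (Suc n) * (- z))" by (rule exp_of_nat_mult[symmetric])
    finally show "exp (- z) * exp (- z) ^ n = exp (- (real (Suc n) * z))" by simp
  qed
  also have "exp (- z) * (1 / (1 - exp (- z))) = 1 / (exp z - 1)"
    using assms by (simp add: exp_minus field_simps)
  finally show ?thesis .
qed

lemma besselK0_real_bound:
  assumes "x > 0"
  shows "(\<integral>t. exp (- (x * cosh t)) \<partial>halfline_lborel) \<le> 8 / x\<^sup>2"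
proof -
  have "norm (besselK0 (of_real x)) \<le> (2 * 2) powr 2 / 2 * x powr (- 2)"
    using besselK0_bound[of "of_real x" 2] assms by (simp only: Re_complex_of_real)
  also have "\<dots> = 8 / x\<^sup>2"
  proof -
    have "(4::real) powr 2 = 16" "x powr (-2) = 1 / x\<^sup>2"
      using assms powr_realpow[of "4::real" 2] powr_realpow[of x 2] by (simp_all add: powr_minus_divide)
    then show ?thesis by simp
  qed
  finally show ?thesis unfolding besselK0_of_real norm_of_real by simp
qed

lemma besselK0_sum_integral:
  assumes x: "x > 0"
  shows "integrable halfline_lborel (\<lambda>t. 1 / (exp (x * cosh t) - 1))"
    and "(\<lambda>n. \<integral>t. exp (- (real (Suc n) * x * cosh t)) \<partial>halfline_lborel) sums
           (\<integral>t. 1 / (exp (x * cosh t) - 1) \<partial>halfline_lborel)"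
proof -
  define f where "f n t = exp (- (real (Suc n) * x * cosh t))" for n t
  have z: "x * cosh t > 0" for t using x by (simp add: cosh_real_pos)
  have s: "(\<lambda>n. f n t) sums (1 / (exp (x * cosh t) - 1))" for t
    using exp_minus_1_series[OF z[of t]] by (simp add: f_def mult.assoc)
  have i: "integrable halfline_lborel (f n)" for n
    unfolding f_def using x by (intro integrable_exp_cosh) simp
  have sn: "AE t in halfline_lborel. summable (\<lambda>n. norm (f n t))"
    using sums_summable[OF s] by (intro AE_I2) (simp add: f_def)
  have si: "summable (\<lambda>n. \<integral>t. norm (f n t) \<partial>halfline_lborel)"
  proof (rule summable_comparison_test'[where N=0])
    show "summable (\<lambda>n. 8 / x\<^sup>2 * (1 / (real (Suc n))\<^sup>2))"
      using inverse_power_summable[of 2, where ?'a=real]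
      by (intro summable_mult) (subst summable_Suc_iff, simp add: inverse_eq_divide)
    fix n
    have "(\<integral>t. norm (f n t) \<partial>halfline_lborel) = (\<integral>t. exp (- ((real (Suc n) * x) * cosh t)) \<partial>halfline_lborel)"
      by (simp add: f_def)
    also have "\<dots> \<le> 8 / (real (Suc n) * x)\<^sup>2" using x by (intro besselK0_real_bound) simp
    also have "\<dots> = 8 / x\<^sup>2 * (1 / (real (Suc n))\<^sup>2)" by (simp add: power_mult_distrib)
    finally show "norm (\<integral>t. norm (f n t) \<partial>halfline_lborel) \<le> 8 / x\<^sup>2 * (1 / (real (Suc n))\<^sup>2)"
      by simp
  qed
  have u: "(\<Sum>n. f n t) = 1 / (exp (x * cosh t) - 1)" for t
    using s by (simp add: sums_iff)
  show "integrable halfline_lborel (\<lambda>t. 1 / (exp (x * cosh t) - 1))"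
    using integrable_suminf[OF i sn si] by (simp add: u)
  show "(\<lambda>n. \<integral>t. exp (- (real (Suc n) * x * cosh t)) \<partial>halfline_lborel) sums
           (\<integral>t. 1 / (exp (x * cosh t) - 1) \<partial>halfline_lborel)"
    using sums_integral[OF i sn si] by (simp add: u) (simp add: f_def)
qed

text \<open>The term h decreases in the index and A is its antiderivative, so the mean value theorem
  places each increment of A between neighbouring values of h. Telescoping traps the difference
  between h N - h 0 and 0, with h 0 = 2 / z.\<close>

lemma partial_fraction_remainder_bound:
  assumes z: "z > (0::real)"
  shows "\<bar>(\<Sum>n<N. 2 * z / (z\<^sup>2 + (2 * pi * real (Suc n))\<^sup>2)) - arctan (2 * pi * real N / z) / pi\<bar> \<le> 2 / z"
proof -
  define h where "h \<nu> = 2 * z / (z\<^sup>2 + (2 * pi * \<nu>)\<^sup>2)" for \<nu>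
  define A where "A \<nu> = arctan (2 * pi * \<nu> / z) / pi" for \<nu>
  have h_mono: "h v \<le> h u" if "0 \<le> u" "u \<le> v" for u v
    unfolding h_def using that z by (intro divide_left_mono add_left_mono power_mono mult_left_mono mult_pos_pos)
      (auto intro!: add_pos_nonneg)
  have A': "(A has_real_derivative h \<nu>) (at \<nu>)" for \<nu>
  proof -
    have eq: "1 + (2 * pi * \<nu> / z)\<^sup>2 = (z\<^sup>2 + (2 * pi * \<nu>)\<^sup>2) / z\<^sup>2"
      using z by (simp add: power_divide field_simps)
    have "(A has_real_derivative (2 * pi / z) / (1 + (2 * pi * \<nu> / z)\<^sup>2) / pi) (at \<nu>)"
      unfolding A_def using z by (auto intro!: derivative_eq_intros simp: divide_inverse)
    also have "(2 * pi / z) / (1 + (2 * pi * \<nu> / z)\<^sup>2) / pi = h \<nu>"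
      unfolding eq h_def using z by (simp add: power2_eq_square)
    finally show ?thesis .
  qed
  have step: "h (real (Suc n)) \<le> A (real (Suc n)) - A (real n)" "A (real (Suc n)) - A (real n) \<le> h (real n)" for n
  proof -
    obtain u where u: "real n < u" "u < real (Suc n)" "A (real (Suc n)) - A (real n) = (real (Suc n) - real n) * h u"
      using MVT2[of "real n" "real (Suc n)" A h] A' by auto
    then show "h (real (Suc n)) \<le> A (real (Suc n)) - A (real n)" "A (real (Suc n)) - A (real n) \<le> h (real n)"
      by (auto intro!: h_mono)
  qed
  have A0: "A 0 = 0" by (simp add: A_def)
  have upper: "(\<Sum>n<N. h (real (Suc n))) - A (real N) \<le> 0"
  proof (induction N)
    case (Suc N) then show ?case using step(1)[of N] by simp
  qed (simp add: A0)
  have lower: "(\<Sum>n<N. h (real (Suc n))) - A (real N) \<ge> h (real N) - h 0"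
  proof (induction N)
    case (Suc N) then show ?case using step(2)[of N] by simp
  qed (simp add: A0)
  have "h 0 = 2 / z" "h (real N) \<ge> 0" using z by (auto simp: h_def power2_eq_square)
  then show ?thesis using upper lower unfolding h_def A_def by linarith
qed

lemma besselK0_sum_real_aux:
  assumes x: "x > 0"
  defines "K \<equiv> (\<lambda>y. \<integral>t. exp (- (y * cosh t)) \<partial>halfline_lborel)"
  shows "(\<lambda>N. (\<Sum>n<N. pi / sqrt (x\<^sup>2 + (2 * pi * real (Suc n))\<^sup>2)) - arsinh (2 * pi * real N / x) / 2)
            \<longlonglongrightarrow> (\<Sum>n. K (real (Suc n) * x)) - pi / (2 * x)"
proof -
  let ?M = halfline_lborel
  define T where "T N t = (\<Sum>n<N. 2 * (x * cosh t) / ((x * cosh t)\<^sup>2 + (2 * pi * real (Suc n))\<^sup>2))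
     - arctan (2 * pi * real N / (x * cosh t)) / pi" for N t
  have z: "x * cosh t > 0" for t using x by (simp add: cosh_real_pos)
  have iT: "has_bochner_integral ?M (T N) ((\<Sum>n<N. pi / sqrt (x\<^sup>2 + (2 * pi * real (Suc n))\<^sup>2)) - arsinh (2 * pi * real N / x) / 2)" for N
    unfolding T_def
    by (intro has_bochner_integral_diff has_bochner_integral_sum besselK0_term_integral has_integral_arctan_cosh x) auto
  have i2: "has_bochner_integral ?M (\<lambda>t. 2 / (x * cosh t)) (pi / x)"
  proof -
    have "2 * (x * cosh t) / ((x * cosh t)\<^sup>2 + 0\<^sup>2) = 2 / (x * cosh t)" for t
      using z[of t] by (simp add: power2_eq_square)
    then show ?thesis using besselK0_term_integral[OF x, of 0] x by simp
  qed
  \<comment> \<open>As N grows the arctan term tends to 1/2 and removes the constant 1/2 of the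
    partial fractions, which would not be integrable over the half-line.\<close>
  have lim: "(\<lambda>N. T N t) \<longlonglongrightarrow> 1 / (exp (x * cosh t) - 1) - 1 / (x * cosh t)" for t
  proof -
    have "(\<lambda>N. (\<Sum>n<N. 2 * (x * cosh t) / ((x * cosh t)\<^sup>2 + (2 * pi * real (Suc n))\<^sup>2))) \<longlonglongrightarrow>
        1 / (exp (x * cosh t) - 1) - 1 / (x * cosh t) + 1 / 2"
      using inverse_exp_minus_1_partial_fractions[OF z[of t]] by (simp add: sums_def power_mult_distrib)
    moreover have "(\<lambda>N. arctan (2 * pi * real N / (x * cosh t)) / pi) \<longlonglongrightarrow> (pi / 2) / pi"
    proof (intro tendsto_divide tendsto_const filterlim_compose[OF tendsto_arctan_at_top])
      have "filterlim (\<lambda>N. 2 * pi / (x * cosh t) * real N) at_top sequentially"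
        using z[of t] by (intro filterlim_tendsto_pos_mult_at_top[OF tendsto_const] filterlim_real_sequentially) auto
      then show "filterlim (\<lambda>N. 2 * pi * real N / (x * cosh t)) at_top sequentially"
        by simp
    qed auto
    ultimately have "(\<lambda>N. T N t) \<longlonglongrightarrow> (1 / (exp (x * cosh t) - 1) - 1 / (x * cosh t) + 1 / 2) - (pi / 2) / pi"
      unfolding T_def by (rule tendsto_diff)
    then show ?thesis by simp
  qed
  have i1: "has_bochner_integral ?M (\<lambda>t. 1 / (x * cosh t)) (pi / (2 * x))"
    using has_bochner_integral_mult_right[of "1/2" ?M "\<lambda>t. 2 / (x * cosh t)" "pi / x"] i2 by simp
  have iL: "integrable ?M (\<lambda>t. 1 / (exp (x * cosh t) - 1) - 1 / (x * cosh t))"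
    using besselK0_sum_integral(1)[OF x] i1
    by (intro Bochner_Integration.integrable_diff) (simp_all add: has_bochner_integral_iff)
  have "(\<lambda>N. \<integral>t. T N t \<partial>?M) \<longlonglongrightarrow> (\<integral>t. 1 / (exp (x * cosh t) - 1) - 1 / (x * cosh t) \<partial>?M)"
  proof (rule integral_dominated_convergence)
    show "integrable ?M (\<lambda>t. 2 / (x * cosh t))" using i2 by (simp add: has_bochner_integral_iff)
    show "AE t in ?M. norm (T N t) \<le> 2 / (x * cosh t)" for N
      using partial_fraction_remainder_bound[OF z, where N=N] by (intro AE_I2) (simp add: T_def)
    show "T N \<in> borel_measurable ?M" for N using iT[of N] by (auto simp: has_bochner_integral_iff)
    show "(\<lambda>t. 1 / (exp (x * cosh t) - 1) - 1 / (x * cosh t)) \<in> borel_measurable ?M" using iL by simp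
    show "AE t in ?M. (\<lambda>N. T N t) \<longlonglongrightarrow> 1 / (exp (x * cosh t) - 1) - 1 / (x * cosh t)" using lim by simp
  qed
  moreover have "(\<integral>t. 1 / (exp (x * cosh t) - 1) - 1 / (x * cosh t) \<partial>?M) = (\<Sum>n. K (real (Suc n) * x)) - pi / (2 * x)"
    using besselK0_sum_integral[OF x] i1 unfolding K_def by (simp add: sums_iff has_bochner_integral_iff)
  moreover have "(\<integral>t. T N t \<partial>?M) = (\<Sum>n<N. pi / sqrt (x\<^sup>2 + (2 * pi * real (Suc n))\<^sup>2)) - arsinh (2 * pi * real N / x) / 2" for N
    using iT[of N] by (simp add: has_bochner_integral_iff)
  ultimately show ?thesis by simp
qed

text \<open>arsinh (2 pi N / x) and the harmonic number both equal ln N up to a convergent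
  remainder, with limits ln (4 pi / x) and Euler's constant. Trading one for the other turns the
  limit into a convergent series.\<close>

lemma besselK0_sum_real:
  assumes x: "x > 0"
  defines "K \<equiv> (\<lambda>y. \<integral>t. exp (- (y * cosh t)) \<partial>halfline_lborel)"
  shows "(\<lambda>n. 2 * pi / sqrt (x\<^sup>2 + (2 * pi * real (Suc n))\<^sup>2) - 1 / real (Suc n)) sums
           (2 * (\<Sum>n. K (real (Suc n) * x)) - pi / x - euler_mascheroni - ln (x / (4 * pi)))"
proof -
  have l1: "(\<lambda>N. 2 * ((\<Sum>n<N. pi / sqrt (x\<^sup>2 + (2 * pi * real (Suc n))\<^sup>2)) - arsinh (2 * pi * real N / x) / 2))
            \<longlonglongrightarrow> 2 * ((\<Sum>n. K (real (Suc n) * x)) - pi / (2 * x))"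
    unfolding K_def by (intro tendsto_mult tendsto_const besselK0_sum_real_aux x)
  have l2: "(\<lambda>N. harm N - ln (real N) :: real) \<longlonglongrightarrow> euler_mascheroni"
    by (rule euler_mascheroni_LIMSEQ)
  have l3: "(\<lambda>N. arsinh (2 * pi * real N / x) - ln (real N)) \<longlonglongrightarrow> ln (4 * pi / x)"
  proof -
    have "(\<lambda>N. ln (2 * pi / x + sqrt ((2 * pi / x)\<^sup>2 + (inverse (real N))\<^sup>2))) \<longlonglongrightarrow> ln (2 * pi / x + sqrt ((2 * pi / x)\<^sup>2 + 0\<^sup>2))"
      using x by (intro tendsto_intros lim_inverse_n) auto
    also have "2 * pi / x + sqrt ((2 * pi / x)\<^sup>2 + 0\<^sup>2) = 4 * pi / x" using x by simp
    finally show ?thesis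
    proof (rule Lim_transform_eventually)
      show "\<forall>\<^sub>F N in sequentially. ln (2 * pi / x + sqrt ((2 * pi / x)\<^sup>2 + (inverse (real N))\<^sup>2)) =
          arsinh (2 * pi * real N / x) - ln (real N)"
        using eventually_gt_at_top[of 0]
      proof eventually_elim
        case (elim N)
        define a where "a = 2 * pi / x"
        have a: "a > 0" using x by (simp add: a_def)
        have "a * N + sqrt ((a * N)\<^sup>2 + 1) = N * (a + sqrt (a\<^sup>2 + (inverse (real N))\<^sup>2))"
        proof -
          have "(a * N)\<^sup>2 + 1 = (real N)\<^sup>2 * (a\<^sup>2 + (inverse (real N))\<^sup>2)"
            using elim by (simp add: power_mult_distrib field_simps)
          then have "sqrt ((a * N)\<^sup>2 + 1) = N * sqrt (a\<^sup>2 + (inverse (real N))\<^sup>2)"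
            by (simp add: real_sqrt_mult)
          then show ?thesis by (simp add: algebra_simps)
        qed
        then have "arsinh (a * N) = ln (N * (a + sqrt (a\<^sup>2 + (inverse (real N))\<^sup>2)))"
          by (simp add: arsinh_real_def)
        also have "\<dots> = ln N + ln (a + sqrt (a\<^sup>2 + (inverse (real N))\<^sup>2))"
          using a elim by (intro ln_mult_pos) (auto intro!: add_pos_nonneg)
        finally show ?case by (simp add: a_def)
      qed
    qed
  qed
  have "(\<lambda>N. 2 * ((\<Sum>n<N. pi / sqrt (x\<^sup>2 + (2 * pi * real (Suc n))\<^sup>2)) - arsinh (2 * pi * real N / x) / 2)
      + (arsinh (2 * pi * real N / x) - ln (real N)) - (harm N - ln (real N))) \<longlonglongrightarrow>
      2 * ((\<Sum>n. K (real (Suc n) * x)) - pi / (2 * x)) + ln (4 * pi / x) - euler_mascheroni"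
    by (intro tendsto_diff tendsto_add l1 l2 l3)
  also have "(\<lambda>N. 2 * ((\<Sum>n<N. pi / sqrt (x\<^sup>2 + (2 * pi * real (Suc n))\<^sup>2)) - arsinh (2 * pi * real N / x) / 2)
      + (arsinh (2 * pi * real N / x) - ln (real N)) - (harm N - ln (real N))) =
      (\<lambda>N. \<Sum>n<N. 2 * pi / sqrt (x\<^sup>2 + (2 * pi * real (Suc n))\<^sup>2) - 1 / real (Suc n))"
  proof
    fix N
    have "harm N = (\<Sum>n<N. 1 / real (Suc n))"
      by (simp add: harm_def sum.atLeast1_atMost_eq inverse_eq_divide)
    then show "2 * ((\<Sum>n<N. pi / sqrt (x\<^sup>2 + (2 * pi * real (Suc n))\<^sup>2)) - arsinh (2 * pi * real N / x) / 2)
      + (arsinh (2 * pi * real N / x) - ln (real N)) - (harm N - ln (real N)) =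
      (\<Sum>n<N. 2 * pi / sqrt (x\<^sup>2 + (2 * pi * real (Suc n))\<^sup>2) - 1 / real (Suc n))"
      by (simp add: sum_subtractf sum_distrib_left)
  qed
  also have "2 * ((\<Sum>n. K (real (Suc n) * x)) - pi / (2 * x)) + ln (4 * pi / x) - euler_mascheroni =
      2 * (\<Sum>n. K (real (Suc n) * x)) - pi / x - euler_mascheroni - ln (x / (4 * pi))"
    using x by (simp add: ln_div ring_distribs)
  finally show ?thesis by (simp add: sums_def)
qed

section \<open>From positive x to the right half-plane\<close>

text \<open>In 1 + t x^2 = x (1/x + t x) both summands of the second factor have nonnegative real
  part, and Re (1/x) = Re x / |x|^2. This keeps the product away from 0 uniformly in t.\<close>

lemma one_plus_square_facts:
  assumes x: "Re x > 0" and t: "t \<ge> (0::real)"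
  shows "norm (1 + of_real t * x\<^sup>2) \<ge> Re x / norm x"
    and "- (of_real t * x\<^sup>2) \<in> - (complex_of_real ` {1..})"
    and "1 + of_real t * x\<^sup>2 \<notin> \<real>\<^sub>\<le>\<^sub>0"
    and "norm ((1 + of_real t * x\<^sup>2) powr (-1/2) - 1) \<le> t * (norm x)\<^sup>2 * sqrt (norm x / Re x)"
proof -
  have x0: "x \<noteq> 0" "norm x > 0" using x by auto
  have e: "1 + of_real t * x\<^sup>2 = x * (inverse x + of_real t * x)"
    using x0 by (simp add: algebra_simps power2_eq_square)
  have "Re (inverse x) = Re x / (norm x)\<^sup>2" by (simp add: cmod_power2)
  then have "Re x / (norm x)\<^sup>2 \<le> Re (inverse x + of_real t * x)" using x t by simp
  also have "\<dots> \<le> norm (inverse x + of_real t * x)" by (rule complex_Re_le_cmod)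
  finally have "norm x * (Re x / (norm x)\<^sup>2) \<le> norm (1 + of_real t * x\<^sup>2)"
    unfolding e norm_mult by (intro mult_left_mono) auto
  then show b: "norm (1 + of_real t * x\<^sup>2) \<ge> Re x / norm x" using x0 by (simp add: power2_eq_square)
  show nr: "1 + of_real t * x\<^sup>2 \<notin> \<real>\<^sub>\<le>\<^sub>0"
  proof
    assume "1 + of_real t * x\<^sup>2 \<in> \<real>\<^sub>\<le>\<^sub>0"
    then have *: "Im (of_real t * x\<^sup>2) = 0" "Re (of_real t * x\<^sup>2) \<le> -1"
      by (auto simp: complex_nonpos_Reals_iff)
    then have "t > 0" using t by (cases "t = 0") auto
    with *(1) have "Re x * Im x = 0" by (simp add: Im_power2)
    then have "Im x = 0" using x by simp
    then have "Re (of_real t * x\<^sup>2) \<ge> 0" using t by (simp add: Re_power2)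
    with *(2) show False by simp
  qed
  show "- (of_real t * x\<^sup>2) \<in> - (complex_of_real ` {1..})"
  proof
    assume "- (of_real t * x\<^sup>2) \<in> complex_of_real ` {1..}"
    then obtain r where "r \<ge> 1" "- (of_real t * x\<^sup>2) = complex_of_real r" by auto
    then have "of_real t * x\<^sup>2 = - complex_of_real r" by (metis minus_minus)
    then have "1 + of_real t * x\<^sup>2 = of_real (1 - r)" by simp
    then show False using nr \<open>r \<ge> 1\<close> by (simp only: nonpos_Reals_of_real_iff)
  qed
  define w where "w = csqrt (1 + of_real t * x\<^sup>2)"
  have w2: "w\<^sup>2 = 1 + of_real t * x\<^sup>2" by (simp add: w_def)
  have "(norm w)\<^sup>2 \<ge> Re x / norm x" using b by (simp add: w2[symmetric] norm_power)
  then have wn: "norm w \<ge> sqrt (Re x / norm x)" by (simp add: real_le_lsqrt)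
  have q: "sqrt (Re x / norm x) > 0" using x x0 by simp
  then have w0: "w \<noteq> 0" using wn by auto
  have "0 \<le> Re w" unfolding w_def using Re_csqrt by blast
  then have w1: "norm (1 + w) \<ge> 1" using complex_Re_le_cmod[of "1 + w"] by simp
  have "1 + of_real t * x\<^sup>2 \<noteq> 0" using w0 w2 by auto
  then have "w = (1 + of_real t * x\<^sup>2) powr (1/2)" by (simp add: w_def csqrt_conv_powr)
  then have p: "(1 + of_real t * x\<^sup>2) powr (-1/2) = 1 / w"
    by (metis divide_minus_left powr_minus_divide)
  \<comment> \<open>The factor t becomes visible in 1 - w^2, while Re w >= 0 keeps |1 + w| at least
    1 and the lower bound \<open>wn\<close> controls |w|.\<close>
  have "1 / w - 1 = (1 - w\<^sup>2) / (w * (1 + w))"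
  proof -
    have "1 + w \<noteq> 0" using w1 by auto
    moreover have "1 - w\<^sup>2 = (1 - w) * (1 + w)" by (simp add: algebra_simps power2_eq_square)
    ultimately show ?thesis using w0 by (simp add: diff_divide_distrib)
  qed
  also have "1 - w\<^sup>2 = - (of_real t * x\<^sup>2)" by (simp add: w2)
  finally have "norm ((1 + of_real t * x\<^sup>2) powr (-1/2) - 1) = (t * (norm x)\<^sup>2) / (norm w * norm (1 + w))"
    unfolding p using t by (simp add: norm_divide norm_mult norm_power)
  also have "\<dots> \<le> (t * (norm x)\<^sup>2) / (sqrt (Re x / norm x) * 1)"
    using wn w1 q t by (intro divide_left_mono mult_mono mult_pos_pos mult_nonneg_nonneg) auto
  also have "\<dots> = t * (norm x)\<^sup>2 * sqrt (norm x / Re x)"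
    by (simp add: real_sqrt_divide)
  finally show "norm ((1 + of_real t * x\<^sup>2) powr (-1/2) - 1) \<le> t * (norm x)\<^sup>2 * sqrt (norm x / Re x)" .
qed

lemma summable_inverse_Suc_powr: "p > 1 \<Longrightarrow> summable (\<lambda>n. real (Suc n) powr (- p))"
  by (subst summable_Suc_iff) (simp add: summable_real_powr_iff)

definition besselK0_corr :: "nat \<Rightarrow> complex \<Rightarrow> complex" where
  "besselK0_corr n x = 1 / of_nat (Suc n) *
     ((1 + of_real (1 / (4 * pi\<^sup>2 * (real (Suc n))\<^sup>2)) * x\<^sup>2) powr (-1/2) - 1)"

lemma norm_besselK0_corr:
  assumes "Re x > 0"
  shows "norm (besselK0_corr n x) \<le> (norm x)\<^sup>2 * sqrt (norm x / Re x) * real (Suc n) powr (- 3)"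
proof -
  define t where "t = 1 / (4 * pi\<^sup>2 * (real (Suc n))\<^sup>2)"
  have "4 * pi\<^sup>2 \<ge> 1 * 1\<^sup>2" using pi_gt3 by (intro mult_mono power_mono) auto
  then have "t \<le> 1 / (1 * (real (Suc n))\<^sup>2)" unfolding t_def
    by (intro divide_left_mono mult_right_mono mult_pos_pos) auto
  then have t: "0 \<le> t" "t \<le> 1 / (real (Suc n))\<^sup>2" by (auto simp: t_def)
  have "norm (besselK0_corr n x) = 1 / real (Suc n) * norm ((1 + of_real t * x\<^sup>2) powr (-1/2) - 1)"
    unfolding besselK0_corr_def t_def[symmetric] norm_mult norm_divide norm_one norm_of_nat ..
  also have "\<dots> \<le> 1 / real (Suc n) * (t * (norm x)\<^sup>2 * sqrt (norm x / Re x))"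
    by (intro mult_left_mono one_plus_square_facts assms t) auto
  also have "\<dots> \<le> 1 / real (Suc n) * ((1 / (real (Suc n))\<^sup>2) * (norm x)\<^sup>2 * sqrt (norm x / Re x))"
    using assms by (intro mult_left_mono mult_right_mono t) auto
  also have "\<dots> = (norm x)\<^sup>2 * sqrt (norm x / Re x) * real (Suc n) powr (- 3)"
    by (simp add: powr_minus divide_inverse power3_eq_cube power2_eq_square)
  finally show ?thesis .
qed

text \<open>The identity theorem extends the real formula; both series have locally uniform
  majorants, of order n^(-2) for K_0 and n^(-3) for the corrections.\<close>

lemma besselK0_sum:
  assumes "Re x > 0"
  shows "summable (\<lambda>n. norm (besselK0 (of_nat (Suc n) * x)))"
    and "(\<Sum>n. besselK0_corr n x) =
           2 * (\<Sum>n. besselK0 (of_nat (Suc n) * x)) - of_real pi / x - euler_mascheroni - Ln (x / (4 * of_real pi))"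
proof -
  let ?H = "{x. Re x > 0}"
  have op: "open ?H" by (rule open_halfspace_Re_gt)
  have near: "Re y \<ge> Re x / 2" "norm y \<le> norm x + Re x" if "y \<in> ball x (Re x / 2)" "Re x > 0" for x y
    using ball_Re[OF that(1)] that norm_triangle_ineq2[of y x] by (auto simp: dist_norm norm_minus_commute)
  have K: "(\<lambda>n x. besselK0 (of_nat (Suc n) * x)) n holomorphic_on ?H" for n
    by (rule holomorphic_on_compose_gen[OF _ holomorphic_besselK0_aux(1), unfolded o_def])
       (auto intro!: holomorphic_intros simp del: of_nat_Suc)
  have C: "besselK0_corr n holomorphic_on ?H" for n
    unfolding besselK0_corr_def using one_plus_square_facts(3)[of _ "1 / (4 * pi\<^sup>2 * (real (Suc n))\<^sup>2)"]
    by (intro holomorphic_intros) (auto simp del: of_nat_Suc)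
  have bK: "\<exists>d h. 0 < d \<and> summable h \<and> (\<forall>n. \<forall>y\<in>ball x d \<inter> ?H. norm (besselK0 (of_nat (Suc n) * y)) \<le> h n)"
    if x: "x \<in> ?H" for x
  proof (intro exI conjI allI ballI)
    show "0 < Re x / 2" using x by simp
    show "summable (\<lambda>n. (2 * 2) powr 2 / 2 * (Re x / 2) powr (-2) * real (Suc n) powr (- 2))"
      by (intro summable_mult summable_inverse_Suc_powr) simp
    fix n y assume y: "y \<in> ball x (Re x / 2) \<inter> ?H"
    have "norm (besselK0 (of_nat (Suc n) * y)) \<le> (2 * 2) powr 2 / 2 * (Re (of_nat (Suc n) * y)) powr (- 2)"
      using y by (intro besselK0_bound) auto
    also have "Re (of_nat (Suc n) * y) = real (Suc n) * Re y" by simp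
    also have "(2 * 2) powr 2 / 2 * (real (Suc n) * Re y) powr (- 2) \<le>
       (2 * 2) powr 2 / 2 * (real (Suc n) * (Re x / 2)) powr (- 2)"
      using near[of y x] y x by (intro mult_left_mono powr_mono2' mult_left_mono) (auto intro!: mult_pos_pos)
    also have "\<dots> = (2 * 2) powr 2 / 2 * (Re x / 2) powr (-2) * real (Suc n) powr (- 2)"
      using x by (subst powr_mult) auto
    finally show "norm (besselK0 (of_nat (Suc n) * y)) \<le> (2 * 2) powr 2 / 2 * (Re x / 2) powr (-2) * real (Suc n) powr (- 2)" .
  qed
  have bC: "\<exists>d h. 0 < d \<and> summable h \<and> (\<forall>n. \<forall>y\<in>ball x d \<inter> ?H. norm (besselK0_corr n y) \<le> h n)"
    if x: "x \<in> ?H" for x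
  proof (intro exI conjI allI ballI)
    show "0 < Re x / 2" using x by simp
    let ?D = "(norm x + Re x)\<^sup>2 * sqrt ((norm x + Re x) / (Re x / 2))"
    show "summable (\<lambda>n. ?D * real (Suc n) powr (- 3))"
      by (intro summable_mult summable_inverse_Suc_powr) simp
    fix n y assume y: "y \<in> ball x (Re x / 2) \<inter> ?H"
    have "norm (besselK0_corr n y) \<le> (norm y)\<^sup>2 * sqrt (norm y / Re y) * real (Suc n) powr (- 3)"
      using y by (intro norm_besselK0_corr) auto
    also have "\<dots> \<le> ?D * real (Suc n) powr (- 3)"
      using near[of y x] y x
      by (intro mult_right_mono mult_mono power_mono real_sqrt_le_mono frac_le) auto
    finally show "norm (besselK0_corr n y) \<le> ?D * real (Suc n) powr (- 3)" .
  qed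
  note hK = holomorphic_on_series[OF op K bK]
  note hC = holomorphic_on_series[OF op C bC]
  show "summable (\<lambda>n. norm (besselK0 (of_nat (Suc n) * x)))" using hK(2) assms by simp
  have Lnok: "x / (4 * of_real pi) \<notin> \<real>\<^sub>\<le>\<^sub>0" if "Re x > 0" for x
  proof -
    have "x / (4 * of_real pi) = x / of_real (4 * pi)" by simp
    then have "Re (x / (4 * of_real pi)) = Re x / (4 * pi)" by (simp only: Re_divide_of_real)
    then show ?thesis using that by (simp add: complex_nonpos_Reals_iff field_simps)
  qed
  show "(\<Sum>n. besselK0_corr n x) =
           2 * (\<Sum>n. besselK0 (of_nat (Suc n) * x)) - of_real pi / x - euler_mascheroni - Ln (x / (4 * of_real pi))"
  proof (rule holomorphic_eq_from_pos_reals[OF hC(1) _ _ assms])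
    show "(\<lambda>x. 2 * (\<Sum>n. besselK0 (of_nat (Suc n) * x)) - of_real pi / x - euler_mascheroni - Ln (x / (4 * of_real pi))) holomorphic_on ?H"
      by (intro holomorphic_intros hK(1)) (use Lnok in auto)
    fix r :: real assume r: "r > 0"
    define k where "k y = (\<integral>t. exp (- (y * cosh t)) \<partial>halfline_lborel)" for y :: real
    have c: "besselK0_corr n (of_real r) = of_real (2 * pi / sqrt (r\<^sup>2 + (2 * pi * real (Suc n))\<^sup>2) - 1 / real (Suc n))" for n
    proof -
      define m where "m = real (Suc n)"
      have m: "m > 0" by (simp add: m_def)
      define v where "v = 1 + 1 / (4 * pi\<^sup>2 * m\<^sup>2) * r\<^sup>2"
      have v: "v > 0" using m by (auto simp: v_def intro!: add_pos_nonneg)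
      have "v = (r\<^sup>2 + (2 * pi * m)\<^sup>2) / (2 * pi * m)\<^sup>2" using m by (simp add: v_def field_simps)
      then have sv: "sqrt v = sqrt (r\<^sup>2 + (2 * pi * m)\<^sup>2) / (2 * pi * m)" using m by (simp add: real_sqrt_divide)
      have "v powr (-1/2) = 1 / sqrt v" using v by (simp add: powr_minus_divide powr_half_sqrt)
      have "besselK0_corr n (of_real r) = 1 / of_real m * (of_real v powr of_real (-1/2) - 1)"
        by (simp add: besselK0_corr_def v_def m_def)
      also have "\<dots> = of_real (1 / m * (v powr (-1/2) - 1))"
        using v by (subst powr_of_real) auto
      also have "1 / m * (v powr (-1/2) - 1) = 2 * pi / sqrt (r\<^sup>2 + (2 * pi * m)\<^sup>2) - 1 / m"
        unfolding \<open>v powr (-1/2) = 1 / sqrt v\<close> sv using m by (simp add: right_diff_distrib)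
      finally show ?thesis by (simp add: m_def)
    qed
    have K0: "besselK0 (of_nat (Suc n) * of_real r) = of_real (k (real (Suc n) * r))" for n
      using besselK0_of_real[of "real (Suc n) * r"] by (simp add: k_def)
    have "summable (\<lambda>n. norm (besselK0 (of_nat (Suc n) * of_real r)))" using hK(2)[of "of_real r"] r by simp
    then have sk: "summable (\<lambda>n. k (real (Suc n) * r))" unfolding K0 norm_of_real by (rule summable_rabs_cancel)
    have "(\<lambda>n. besselK0_corr n (of_real r)) sums of_real (2 * (\<Sum>n. k (real (Suc n) * r)) - pi / r - euler_mascheroni - ln (r / (4 * pi)))"
      unfolding c k_def by (intro sums_of_real besselK0_sum_real r)
    then have "(\<Sum>n. besselK0_corr n (of_real r)) = of_real (2 * (\<Sum>n. k (real (Suc n) * r)) - pi / r - euler_mascheroni - ln (r / (4 * pi)))"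
      by (simp add: sums_iff)
    also have "\<dots> = 2 * (\<Sum>n. besselK0 (of_nat (Suc n) * of_real r)) - of_real pi / of_real r - euler_mascheroni - Ln (of_real r / (4 * of_real pi))"
    proof -
      have "Ln (of_real r / (4 * of_real pi)) = of_real (ln (r / (4 * pi)))"
        using r Ln_of_real[of "r / (4 * pi)"] by simp
      then show ?thesis unfolding K0 using sk by (simp add: suminf_of_real)
    qed
    finally show "(\<Sum>n. besselK0_corr n (of_real r)) = 2 * (\<Sum>n. besselK0 (of_nat (Suc n) * of_real r)) - of_real pi / of_real r - euler_mascheroni - Ln (of_real r / (4 * of_real pi))" .
  qed
qed

subsection \<open>K_0 at the origin\<close>


lemma integrable_halfline_bound:
  fixes f :: "real \<Rightarrow> 'a::{banach,second_countable_topology}"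
  assumes "continuous_on {0..} f" "a > 0" "\<And>t. t \<ge> 0 \<Longrightarrow> norm (f t) \<le> C * exp (- a * t)"
  shows "integrable halfline_lborel f"
proof (rule Bochner_Integration.integrable_bound)
  show "integrable halfline_lborel (\<lambda>t. C * exp (- a * t))"
    using has_integral_exp_halfline[OF assms(2)] by (intro integrable_mult_right) (simp add: has_bochner_integral_iff)
  show "AE t in halfline_lborel. norm (f t) \<le> norm (C * exp (- a * t))"
    using assms(3) by (intro AE_I2 order.trans[OF assms(3)]) (auto simp: space_restrict_space)
qed (intro measurable_halfline_lborel assms)

lemma norm_exp_minus_1_le:
  assumes "Re w \<ge> 0" shows "norm (1 - exp (- w)) \<le> norm w"
proof -
  have "norm (exp (- w) - exp (- 0)) \<le> 1 * norm (w - 0)"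
  proof (rule field_differentiable_bound)
    show "convex {z. Re z \<ge> 0}" by (rule convex_halfspace_Re_ge)
    show "((\<lambda>z. exp (- z)) has_field_derivative - exp (- z)) (at z within {z. Re z \<ge> 0})" for z
      by (auto intro!: derivative_eq_intros)
    show "norm (- exp (- z)) \<le> 1" if "z \<in> {z. Re z \<ge> 0}" for z using that by simp
  qed (use assms in auto)
  then show ?thesis by (simp add: norm_minus_commute)
qed

section \<open>Exponential integrals and Euler's constant\<close>

text \<open>With u = e^t this is the exponential integral E_1(z), the integral of e^(-z u) / u over
  u > 1.\<close>

definition expint1 :: "complex \<Rightarrow> complex" where
  "expint1 z = (\<integral>t. exp (- z * of_real (exp t)) \<partial>halfline_lborel)"

text \<open>With u = e^(-t) this is the entire exponential integral Ein(z), the integral of (1 -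
  e^(-z u)) / u over 0 < u < 1.\<close>

definition expint_ent :: "complex \<Rightarrow> complex" where
  "expint_ent z = (\<integral>t. 1 - exp (- z * of_real (exp (- t))) \<partial>halfline_lborel)"

lemma exp_exp_bound:
  assumes "0 < r" "r \<le> Re z" "t \<ge> 0"
  shows "norm (exp (- z * of_real (exp t))) \<le> exp (- r * t)"
proof -
  have "exp t \<ge> t" using exp_ge_add_one_self[of t] by linarith
  then have "r * t \<le> Re z * exp t" using assms by (intro mult_mono) auto
  then show ?thesis by simp
qed

text \<open>The z-derivative of the integrand is the t-derivative of exp (- z e^t) / z, so the
  differentiated integral is elementary.\<close>

lemma expint1_deriv:
  assumes z: "Re z > 0"
  shows "(expint1 has_field_derivative - exp (- z) / z) (at z)"
proof -
  let ?M = halfline_lborel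
  have bd: "norm (exp (- w * of_real (exp t))) \<le> exp (- (Re z / 2) * t)"
    if "w \<in> ball z (Re z / 2)" "t \<in> space ?M" for w t
    using ball_Re[OF that(1)] that z by (intro exp_exp_bound) (auto simp: space_restrict_space)
  have 1: "\<And>w::complex. (\<lambda>t. exp (- w * of_real (exp t))) \<in> borel_measurable ?M"
    by (intro measurable_halfline_lborel continuous_intros)
  have 2: "\<And>t. t \<in> space ?M \<Longrightarrow> (\<lambda>w. exp (- w * of_real (exp t))) holomorphic_on ball z (Re z / 2)"
    by (intro holomorphic_intros)
  have 3: "integrable ?M (\<lambda>t. exp (- (Re z / 2) * t))"
    using has_integral_exp_halfline[of "Re z / 2"] z by (simp add: has_bochner_integral_iff)
  have r: "Re z / 2 > 0" using z by simp
  note p = has_field_derivative_integral_param[OF r 1 2 bd 3]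
  have d: "deriv (\<lambda>w. exp (- w * of_real (exp t))) z = - of_real (exp t) * exp (- z * of_real (exp t))" for t
    by (rule DERIV_imp_deriv) (auto intro!: derivative_eq_intros)
  have "(\<integral>t. - of_real (exp t) * exp (- z * of_real (exp t)) \<partial>?M) = 0 - (exp (- z * of_real (exp 0)) / z)"
  proof (rule integral_FTC_halfline)
    fix t :: real
    have "((\<lambda>w. exp (- z * exp w) / z) has_field_derivative - exp (complex_of_real t) * exp (- z * exp (of_real t))) (at (of_real t))"
      using z by (auto intro!: derivative_eq_intros simp: field_simps)
    from has_vector_derivative_real_field[OF this]
    show "((\<lambda>t. exp (- z * of_real (exp t)) / z) has_vector_derivative
        - of_real (exp t) * exp (- z * of_real (exp t))) (at t)"
      by (simp add: exp_of_real)
  next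
    show "integrable ?M (\<lambda>t. - of_real (exp t) * exp (- z * of_real (exp t)))"
      using p(1) unfolding d .
    show "continuous_on {0..} (\<lambda>t. - complex_of_real (exp t) * exp (- z * of_real (exp t)))"
      by (intro continuous_intros)
    have l: "((\<lambda>t. exp (- Re z * t)) \<longlongrightarrow> 0) at_top"
      using z by real_asymp
    have "((\<lambda>t. exp (- z * of_real (exp t))) \<longlongrightarrow> 0) at_top"
    proof (rule Lim_null_comparison[OF _ l])
      show "\<forall>\<^sub>F t in at_top. norm (exp (- z * of_real (exp t))) \<le> exp (- Re z * t)"
        using eventually_ge_at_top[of 0]
        by eventually_elim (rule exp_exp_bound, use z in auto)
    qed
    then show "((\<lambda>t. exp (- z * of_real (exp t)) / z) \<longlongrightarrow> 0) at_top"
      by (rule tendsto_divide_zero)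
  qed
  then show ?thesis using p(2) unfolding d expint1_def[abs_def] by simp
qed

lemma expint_ent_integrand_bound:
  assumes "Re z \<ge> 0"
  shows "norm (1 - exp (- z * of_real (exp (- t)))) \<le> norm z * exp (- 1 * t)"
  using norm_exp_minus_1_le[of "z * of_real (exp (- t))"] assms by (simp add: norm_mult)

lemma expint_ent_deriv:
  assumes z: "Re z > 0"
  shows "(expint_ent has_field_derivative (1 - exp (- z)) / z) (at z)"
proof -
  let ?M = halfline_lborel
  have bd: "norm (1 - exp (- w * of_real (exp (- t)))) \<le> (norm z + Re z) * exp (- 1 * t)"
    if "w \<in> ball z (Re z / 2)" "t \<in> space ?M" for w t
  proof -
    have "norm w \<le> norm z + Re z"
      using that z norm_triangle_ineq2[of w z] by (auto simp: dist_norm norm_minus_commute)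
    then have "norm w * exp (- 1 * t) \<le> (norm z + Re z) * exp (- 1 * t)" by (intro mult_right_mono) auto
    moreover have "Re w \<ge> 0" using ball_Re[OF that(1)] z by simp
    ultimately show ?thesis using expint_ent_integrand_bound[of w t] by linarith
  qed
  have 1: "\<And>w::complex. (\<lambda>t. 1 - exp (- w * of_real (exp (- t)))) \<in> borel_measurable ?M"
    by (intro measurable_halfline_lborel continuous_intros)
  have 2: "\<And>t. t \<in> space ?M \<Longrightarrow> (\<lambda>w. 1 - exp (- w * of_real (exp (- t)))) holomorphic_on ball z (Re z / 2)"
    by (intro holomorphic_intros)
  have 3: "integrable ?M (\<lambda>t. (norm z + Re z) * exp (- 1 * t))"
    using has_integral_exp_halfline[of 1] by (intro integrable_mult_right) (simp add: has_bochner_integral_iff)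
  have r: "Re z / 2 > 0" using z by simp
  note p = has_field_derivative_integral_param[OF r 1 2 bd 3]
  have d: "deriv (\<lambda>w. 1 - exp (- w * of_real (exp (- t)))) z = of_real (exp (- t)) * exp (- z * of_real (exp (- t)))" for t
    by (rule DERIV_imp_deriv) (auto intro!: derivative_eq_intros)
  have "(\<integral>t. of_real (exp (- t)) * exp (- z * of_real (exp (- t))) \<partial>?M) = exp (- z * of_real 0) / z - (exp (- z * of_real (exp (- 0))) / z)"
  proof (rule integral_FTC_halfline)
    fix t :: real
    have "((\<lambda>w. exp (- z * exp (- w)) / z) has_field_derivative exp (- complex_of_real t) * exp (- z * exp (- of_real t))) (at (of_real t))"
      using z by (auto intro!: derivative_eq_intros simp: field_simps)
    from has_vector_derivative_real_field[OF this]
    show "((\<lambda>t. exp (- z * of_real (exp (- t))) / z) has_vector_derivative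
        of_real (exp (- t)) * exp (- z * of_real (exp (- t)))) (at t)"
      by (simp flip: exp_of_real)
  next
    show "integrable ?M (\<lambda>t. of_real (exp (- t)) * exp (- z * of_real (exp (- t))))"
      using p(1) unfolding d .
    show "continuous_on {0..} (\<lambda>t. complex_of_real (exp (- t)) * exp (- z * of_real (exp (- t))))"
      by (intro continuous_intros)
    have "((\<lambda>t::real. exp (- t)) \<longlongrightarrow> 0) at_top" by real_asymp
    then show "((\<lambda>t. exp (- z * of_real (exp (- t))) / z) \<longlongrightarrow> exp (- z * of_real 0) / z) at_top"
      by (intro tendsto_intros) (use z in auto)
  qed
  then show ?thesis using p(2) unfolding d expint_ent_def[abs_def] by (simp add: diff_divide_distrib)
qed

text \<open>With u = e^(-t) this is the integral of (1 - (1 - u)^n) / u over (0, 1). Raising n by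
  one adds the integral of (1 - u)^n, which is 1/(n + 1).\<close>

lemma harm_integral:
  "has_bochner_integral halfline_lborel (\<lambda>t. 1 - (1 - exp (- t)) ^ n) (harm n)"
proof (induction n)
  case 0 then show ?case by (simp add: harm_def has_bochner_integral_zero)
next
  case (Suc n)
  have "has_bochner_integral halfline_lborel (\<lambda>t. (1 - exp (- t)) ^ n * exp (- t))
     (1 / real (Suc n) - (1 - exp (- 0)) ^ Suc n / real (Suc n))"
  proof (rule has_integral_FTC_halfline)
    show "((\<lambda>t. (1 - exp (- t)) ^ Suc n / real (Suc n)) has_real_derivative (1 - exp (- t)) ^ n * exp (- t)) (at t)" for t :: real
      by (auto intro!: derivative_eq_intros simp del: power_Suc of_nat_Suc)
    have "((\<lambda>t::real. exp (- t)) \<longlongrightarrow> 0) at_top" by real_asymp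
    then have "((\<lambda>t::real. (1 - exp (- t)) ^ Suc n / real (Suc n)) \<longlongrightarrow> (1 - 0) ^ Suc n / real (Suc n)) at_top"
      by (intro tendsto_intros) auto
    then show "((\<lambda>t::real. (1 - exp (- t)) ^ Suc n / real (Suc n)) \<longlongrightarrow> 1 / real (Suc n)) at_top" by simp
  qed (auto intro!: continuous_intros mult_nonneg_nonneg zero_le_power)
  from has_bochner_integral_add[OF Suc.IH this]
  have "has_bochner_integral halfline_lborel (\<lambda>t. 1 - (1 - exp (- t)) ^ n + (1 - exp (- t)) ^ n * exp (- t)) (harm n + 1 / real (Suc n))"
    by simp
  moreover have "1 - (1 - exp (- t)) ^ n + (1 - exp (- t)) ^ n * exp (- t) = 1 - (1 - exp (- t)) ^ Suc n" for t :: real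
    by (simp add: algebra_simps)
  ultimately show ?case by (simp add: harm_Suc inverse_eq_divide)
qed

text \<open>a = e^(-x) and b = 1 - x differ by at most x^2, so a^n - b^n <= x^2 n a^(n-1). Here n x
  e^(-n x) <= 1 absorbs n, and the missing factor a costs e^x <= e. A bound free of n is what
  dominated convergence needs next.\<close>

lemma exp_power_diff_bound:
  assumes x: "0 < x" "x \<le> (1::real)"
  shows "\<bar>exp (- (real n * x)) - (1 - x) ^ n\<bar> \<le> exp 1 * x"
proof (cases n)
  case (Suc m)
  define a where "a = exp (- x)"
  define b where "b = 1 - x"
  have ab: "0 \<le> b" "b \<le> a" "a - b \<le> x\<^sup>2" "a \<le> 1"
  proof -
    show "0 \<le> b" "b \<le> a" using x exp_ge_add_one_self[of "- x"] by (auto simp: a_def b_def)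
    show "a \<le> 1" using x by (simp add: a_def)
    have "exp (- x) \<le> 1 / (1 + x)"
      using exp_ge_add_one_self[of x] x by (simp add: exp_minus field_simps)
    also have "\<dots> \<le> 1 - x + x\<^sup>2" using x by (simp add: field_simps power2_eq_square)
    finally show "a - b \<le> x\<^sup>2" by (simp add: a_def b_def)
  qed
  have "a ^ n - b ^ n = (a - b) * (\<Sum>i<n. b ^ (n - Suc i) * a ^ i)"
    by (rule power_diff_sumr2)
  also have "\<dots> \<le> x\<^sup>2 * (\<Sum>i<n. a ^ m)"
  proof (intro mult_mono ab sum_mono)
    fix i assume i: "i \<in> {..<n}"
    have "b ^ (n - Suc i) * a ^ i \<le> a ^ (n - Suc i) * a ^ i"
      using ab by (intro mult_right_mono power_mono) auto
    also have "\<dots> = a ^ m" using i Suc by (simp flip: power_add)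
    finally show "b ^ (n - Suc i) * a ^ i \<le> a ^ m" .
  qed (use ab in \<open>auto intro!: sum_nonneg mult_nonneg_nonneg\<close>)
  also have "(\<Sum>i<n. a ^ m) = real n * a ^ m" by simp
  also have "x\<^sup>2 * (real n * a ^ m) \<le> exp 1 * x"
  proof -
    have "a ^ m = exp x * exp (- (real n * x))"
      unfolding a_def Suc by (simp add: algebra_simps flip: exp_of_nat_mult exp_add)
    then have "x\<^sup>2 * (real n * a ^ m) = x * (exp x * ((real n * x) * exp (- (real n * x))))"
      by (simp add: power2_eq_square)
    also have "\<dots> \<le> x * (exp 1 * 1)"
    proof (intro mult_left_mono mult_mono)
      have "u * exp (- u) \<le> 1" for u :: real
      proof -
        have "u \<le> exp u" using exp_ge_add_one_self[of u] by linarith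
        then have "u * exp (- u) \<le> exp u * exp (- u)" by (intro mult_right_mono) auto
        then show ?thesis by (simp add: exp_minus_inverse)
      qed
      then show "(real n * x) * exp (- (real n * x)) \<le> 1" .
    qed (use x in auto)
    finally show ?thesis by (simp add: mult.commute)
  qed
  finally have "a ^ n - b ^ n \<le> exp 1 * x" .
  moreover have "a ^ n - b ^ n \<ge> 0" using ab by (simp add: power_mono)
  moreover have "a ^ n = exp (- (real n * x))" unfolding a_def by (simp flip: exp_of_nat_mult)
  ultimately show ?thesis by (simp add: b_def)
qed (use x in simp)

text \<open>With u = e^(-t) the difference is the integral over t of (1 - u)^n - e^(-n u), which
  tends to 0 pointwise and is at most e u in absolute value.\<close>

lemma expint_ent_harm:
  "(\<lambda>n. expint_ent (of_nat n) - of_real (harm n)) \<longlonglongrightarrow> 0"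
proof -
  let ?M = halfline_lborel
  define f where "f n t = (1 - exp (- t)) ^ n - exp (- (real n * exp (- t)))" for n t
  have x: "0 < exp (- t)" "exp (- t) \<le> 1" if "t \<in> space ?M" for t :: real
    using that by (auto simp: space_restrict_space)
  have int: "integrable ?M (\<lambda>t. 1 - exp (- (real n * exp (- t))))" for n
  proof (rule integrable_halfline_bound[where a=1 and C="real n"])
    show "norm (1 - exp (- (real n * exp (- t)))) \<le> real n * exp (- 1 * t)" for t
    proof -
      have "norm (complex_of_real (1 - exp (- (real n * exp (- t))))) \<le> norm (complex_of_nat n) * exp (- 1 * t)"
        using expint_ent_integrand_bound[of "of_nat n" t] by (simp flip: exp_of_real)
      then show ?thesis by (simp only: norm_of_real norm_of_nat real_norm_def)
    qed
  qed (auto intro!: continuous_intros)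
  have e: "expint_ent (of_nat n) = of_real (\<integral>t. 1 - exp (- (real n * exp (- t))) \<partial>?M)" for n
  proof -
    have "1 - exp (- of_nat n * of_real (exp (- t))) = complex_of_real (1 - exp (- (real n * exp (- t))))" for t
      by (simp flip: exp_of_real)
    then show ?thesis unfolding expint_ent_def by (simp only: integral_complex_of_real)
  qed
  have diff: "expint_ent (of_nat n) - of_real (harm n) = of_real (\<integral>t. f n t \<partial>?M)" for n
  proof -
    have "(\<integral>t. f n t \<partial>?M) = (\<integral>t. (1 - exp (- (real n * exp (- t)))) - (1 - (1 - exp (- t)) ^ n) \<partial>?M)"
      by (intro Bochner_Integration.integral_cong) (auto simp: f_def)
    also have "\<dots> = (\<integral>t. 1 - exp (- (real n * exp (- t))) \<partial>?M) - harm n"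
      using harm_integral[of n] int[of n] by (subst Bochner_Integration.integral_diff) (auto simp: has_bochner_integral_iff)
    finally show ?thesis unfolding e by simp
  qed
  have "(\<lambda>n. \<integral>t. f n t \<partial>?M) \<longlonglongrightarrow> (\<integral>t. 0 \<partial>?M)"
  proof (rule integral_dominated_convergence)
    show "integrable ?M (\<lambda>t. exp 1 * exp (- 1 * t))"
      using has_integral_exp_halfline[of 1] by (intro integrable_mult_right) (simp add: has_bochner_integral_iff)
    show "f n \<in> borel_measurable ?M" for n
      unfolding f_def by (intro measurable_halfline_lborel continuous_intros)
    show "AE t in ?M. norm (f n t) \<le> exp 1 * exp (- 1 * t)" for n
      using exp_power_diff_bound[OF x, of _ n] by (intro AE_I2) (simp add: f_def abs_minus_commute)
    show "AE t in ?M. (\<lambda>n. f n t) \<longlonglongrightarrow> 0"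
    proof (intro AE_I2)
      fix t assume t: "t \<in> space ?M"
      have "(\<lambda>n. (1 - exp (- t)) ^ n) \<longlonglongrightarrow> 0" using x[OF t] by (intro LIMSEQ_power_zero) auto
      moreover have "(\<lambda>n. exp (- exp (- t)) ^ n) \<longlonglongrightarrow> 0" by (intro LIMSEQ_power_zero) auto
      ultimately have "(\<lambda>n. (1 - exp (- t)) ^ n - exp (- exp (- t)) ^ n) \<longlonglongrightarrow> 0 - 0" by (rule tendsto_diff)
      then show "(\<lambda>n. f n t) \<longlonglongrightarrow> 0" by (simp add: f_def flip: exp_of_nat_mult)
    qed
  qed auto
  then have "(\<lambda>n. complex_of_real (\<integral>t. f n t \<partial>?M)) \<longlonglongrightarrow> of_real 0"
    by (intro tendsto_of_real) simp
  then show ?thesis by (simp add: diff)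
qed

text \<open>E_1 + Ln - Ein has derivative 0. The constant is read off along the integers, where
  E_1(n) and Ein(n) - H_n tend to 0 and H_n - ln n tends to Euler's constant.\<close>

lemma expint1_eq:
  assumes "Re z > 0"
  shows "expint1 z + Ln z + euler_mascheroni = expint_ent z"
proof -
  define g where "g z = expint1 z + Ln z - expint_ent z" for z
  have *: "(g has_field_derivative 0) (at w)" if w: "w \<in> {w. Re w > 0}" for w
  proof -
    have "(g has_field_derivative - exp (- w) / w + inverse w - (1 - exp (- w)) / w) (at w)"
      unfolding g_def using w
      by (intro derivative_intros expint1_deriv expint_ent_deriv) (auto simp: complex_nonpos_Reals_iff)
    then show ?thesis by (simp add: diff_divide_distrib inverse_eq_divide)
  qed
  then obtain C where C: "\<And>w. Re w > 0 \<Longrightarrow> g w = C"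
  proof -
    have "g constant_on {w. Re w > 0}"
      by (rule has_field_derivative_0_imp_constant_on[OF * connected_Re_gt open_halfspace_Re_gt])
    then obtain C where "\<forall>w\<in>{w. Re w > 0}. g w = C" unfolding constant_on_def by blast
    then show ?thesis using that by auto
  qed
  have E0: "(\<lambda>n. expint1 (of_nat n)) \<longlonglongrightarrow> 0"
  proof (rule Lim_null_comparison[OF _ lim_inverse_n])
    show "\<forall>\<^sub>F n in sequentially. norm (expint1 (of_nat n)) \<le> inverse (real n)"
      using eventually_gt_at_top[of 0]
    proof eventually_elim
      case (elim n)
      have i: "has_bochner_integral halfline_lborel (\<lambda>t. exp (- real n * t)) (1 / real n)"
        using elim by (intro has_integral_exp_halfline) simp
      have b: "norm (exp (- of_nat n * complex_of_real (exp t))) \<le> exp (- real n * t)" if "t \<ge> 0" for t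
        using elim that by (intro exp_exp_bound) auto
      have "integrable halfline_lborel (\<lambda>t. exp (- of_nat n * complex_of_real (exp t)))"
      proof (rule integrable_halfline_bound[where a="real n" and C=1])
        show "continuous_on {0..} (\<lambda>t. exp (- of_nat n * complex_of_real (exp t)))" by (intro continuous_intros)
      qed (use elim b in auto)
      note ii = this
      have i': "integrable halfline_lborel (\<lambda>t. exp (- real n * t))"
        using i by (simp only: has_bochner_integral_iff)
      have "norm (expint1 (of_nat n)) \<le> (\<integral>t. norm (exp (- of_nat n * complex_of_real (exp t))) \<partial>halfline_lborel)"
        unfolding expint1_def by (rule integral_norm_bound)
      also have "\<dots> \<le> (\<integral>t. exp (- real n * t) \<partial>halfline_lborel)"
        by (rule integral_mono[OF integrable_norm[OF ii] i' b]) (simp add: space_restrict_space)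
      finally have "norm (expint1 (of_nat n)) \<le> (\<integral>t. exp (- real n * t) \<partial>halfline_lborel)" .
      then show ?case using has_bochner_integral_integral_eq[OF i] by (simp add: inverse_eq_divide)
    qed
  qed
  have "(\<lambda>n. expint1 (of_nat n) - of_real (harm n - ln (of_nat n)) - (expint_ent (of_nat n) - of_real (harm n))) \<longlonglongrightarrow> 0 - euler_mascheroni - 0"
    by (intro tendsto_diff E0 euler_mascheroni_LIMSEQ_of_real expint_ent_harm)
  moreover have "\<forall>\<^sub>F n in sequentially. expint1 (of_nat n) - of_real (harm n - ln (of_nat n)) - (expint_ent (of_nat n) - of_real (harm n)) = C"
    using eventually_gt_at_top[of 0]
  proof eventually_elim
    case (elim n)
    have "Ln (of_nat n) = of_real (ln (real n))" using elim Ln_of_real[of "real n"] by simp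
    then show ?case using C[of "of_nat n"] elim by (simp add: g_def algebra_simps)
  qed
  ultimately have "(\<lambda>n::nat. C) \<longlonglongrightarrow> - euler_mascheroni"
    by (simp add: tendsto_cong)
  then have "C = - euler_mascheroni" by (simp add: LIMSEQ_const_iff)
  then show ?thesis using C[OF assms] by (simp add: g_def algebra_simps)
qed

text \<open>As r cosh t = (r/2) e^t + (r/2) e^(-t), dropping the second exponential replaces K_0(r)
  by E_1(r/2) at a cost of r/2; another r/2 bounds Ein(r/2).\<close>

lemma besselK0_small:
  assumes r: "r > 0"
  shows "norm (besselK0 (of_real r) + Ln (of_real r / 2) + euler_mascheroni) \<le> r"
proof -
  let ?M = halfline_lborel
  define \<epsilon> where "\<epsilon> = r / 2"
  have \<epsilon>: "\<epsilon> > 0" using r by (simp add: \<epsilon>_def)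
  have i1: "integrable ?M (\<lambda>t. exp (- of_real \<epsilon> * complex_of_real (exp t)))"
    using \<epsilon> exp_exp_bound[of \<epsilon> "of_real \<epsilon>"] by (intro integrable_halfline_bound[where a=\<epsilon> and C=1] continuous_intros) auto
  have i2: "integrable ?M (\<lambda>t. exp (- of_real r * complex_of_real (cosh t)))"
    using r by (intro integrable_besselK0) simp
  have i3: "has_bochner_integral ?M (\<lambda>t. \<epsilon> * exp (- 1 * t)) (\<epsilon> * (1 / 1))"
    by (intro has_bochner_integral_mult_right has_integral_exp_halfline) simp
  have b: "norm (exp (- of_real \<epsilon> * complex_of_real (exp t)) - exp (- of_real r * complex_of_real (cosh t))) \<le> \<epsilon> * exp (- 1 * t)" for t
  proof -
    have "r * cosh t = \<epsilon> * exp t + \<epsilon> * exp (- t)" by (simp add: \<epsilon>_def cosh_def field_simps)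
    then have "exp (- of_real r * complex_of_real (cosh t)) = of_real (exp (- (\<epsilon> * exp t)) * exp (- (\<epsilon> * exp (- t))))"
      by (simp flip: exp_of_real exp_add of_real_mult of_real_add of_real_minus)
    moreover have "exp (- of_real \<epsilon> * complex_of_real (exp t)) = of_real (exp (- (\<epsilon> * exp t)))"
      by (simp flip: exp_of_real)
    ultimately have "norm (exp (- of_real \<epsilon> * complex_of_real (exp t)) - exp (- of_real r * complex_of_real (cosh t))) =
        \<bar>exp (- (\<epsilon> * exp t)) * (1 - exp (- (\<epsilon> * exp (- t))))\<bar>"
      by (simp only: of_real_diff[symmetric] norm_of_real) (simp add: right_diff_distrib)
    also have "\<dots> = exp (- (\<epsilon> * exp t)) * (1 - exp (- (\<epsilon> * exp (- t))))" using \<epsilon> by simp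
    also have "\<dots> \<le> 1 * (\<epsilon> * exp (- t))"
      using \<epsilon> exp_ge_add_one_self[of "- (\<epsilon> * exp (- t))"] by (intro mult_mono) auto
    finally show ?thesis by simp
  qed
  have "expint1 (of_real \<epsilon>) - besselK0 (of_real r) = (\<integral>t. exp (- of_real \<epsilon> * complex_of_real (exp t)) - exp (- of_real r * complex_of_real (cosh t)) \<partial>?M)"
    unfolding expint1_def besselK0_def by (rule Bochner_Integration.integral_diff[OF i1 i2, symmetric])
  also have "norm \<dots> \<le> (\<integral>t. \<epsilon> * exp (- 1 * t) \<partial>?M)"
    using i1 i2 i3 b by (intro order.trans[OF integral_norm_bound] integral_mono) (auto simp: has_bochner_integral_iff)
  finally have 1: "norm (expint1 (of_real \<epsilon>) - besselK0 (of_real r)) \<le> \<epsilon>"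
    using has_bochner_integral_integral_eq[OF i3] \<epsilon> by simp
  have i4: "has_bochner_integral ?M (\<lambda>t. norm (complex_of_real \<epsilon>) * exp (- 1 * t)) (norm (complex_of_real \<epsilon>) * (1 / 1))"
    by (intro has_bochner_integral_mult_right has_integral_exp_halfline) simp
  have i5: "integrable ?M (\<lambda>t. 1 - exp (- of_real \<epsilon> * complex_of_real (exp (- t))))"
    using \<epsilon> expint_ent_integrand_bound[of "of_real \<epsilon>"]
    by (intro integrable_halfline_bound[where a=1 and C=\<epsilon>] continuous_intros) auto
  have "norm (expint_ent (of_real \<epsilon>)) \<le> (\<integral>t. norm (complex_of_real \<epsilon>) * exp (- 1 * t) \<partial>?M)"
    unfolding expint_ent_def using i4 i5 \<epsilon> expint_ent_integrand_bound[of "of_real \<epsilon>"]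
    by (intro order.trans[OF integral_norm_bound] integral_mono) (auto simp: has_bochner_integral_iff)
  then have 2: "norm (expint_ent (of_real \<epsilon>)) \<le> \<epsilon>" using has_bochner_integral_integral_eq[OF i4] \<epsilon> by simp
  have "besselK0 (of_real r) + Ln (of_real r / 2) + euler_mascheroni =
     expint_ent (of_real \<epsilon>) - (expint1 (of_real \<epsilon>) - besselK0 (of_real r))"
    using expint1_eq[of "of_real \<epsilon>"] \<epsilon> by (simp add: \<epsilon>_def algebra_simps)
  also have "norm \<dots> \<le> \<epsilon> + \<epsilon>"
    by (rule order.trans[OF norm_triangle_ineq4]) (use 1 2 in simp)
  finally show ?thesis by (simp add: \<epsilon>_def)
qed

subsection \<open>Logarithmic series\<close>


text \<open>Frobenius form for a double exponent 0 at the origin: P is the regular part, and the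
  series with coefficients A multiplies the logarithm. In the variable y^2/4 the operator y/2 d/dy
  multiplies a power by its index n.\<close>

definition logser :: "(nat \<Rightarrow> complex) \<Rightarrow> (nat \<Rightarrow> complex) \<Rightarrow> complex \<Rightarrow> complex" where
  "logser P A y = (\<Sum>n. P n * (y\<^sup>2 / 4) ^ n) - 2 * Ln (y / 2) * (\<Sum>n. A n * (y\<^sup>2 / 4) ^ n)"

definition entire_coeffs :: "(nat \<Rightarrow> complex) \<Rightarrow> bool" where
  "entire_coeffs A \<longleftrightarrow> (\<forall>q. summable (\<lambda>n. A n * q ^ n))"

lemma entire_coeffs_mult_n:
  assumes "entire_coeffs A" shows "entire_coeffs (\<lambda>n. of_nat n * A n)"
  unfolding entire_coeffs_def
proof
  fix q
  have "summable (\<lambda>n. diffs A n * q ^ n)"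
    using assms by (intro termdiff_converges_all) (simp add: entire_coeffs_def)
  then have "summable (\<lambda>n. diffs A n * q ^ n * q)" by (rule summable_mult2)
  then have "summable (\<lambda>n. of_nat (Suc n) * A (Suc n) * q ^ Suc n)"
    by (simp add: diffs_def mult_ac)
  then show "summable (\<lambda>n. of_nat n * A n * q ^ n)" by (subst (asm) summable_Suc_iff)
qed

lemma entire_coeffs_diff: "entire_coeffs A \<Longrightarrow> entire_coeffs B \<Longrightarrow> entire_coeffs (\<lambda>n. A n - B n)"
  by (simp add: entire_coeffs_def left_diff_distrib summable_diff)

lemma entire_coeffs_norm:
  assumes "entire_coeffs A" shows "summable (\<lambda>n. norm (A n * q ^ n))"
proof (rule powser_insidea)
  show "summable (\<lambda>n. A n * (of_real (norm q + 1)) ^ n)"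
    using assms by (simp add: entire_coeffs_def)
  show "norm q < norm (complex_of_real (norm q + 1))" by (simp only: norm_of_real)
qed

lemma entire_coeffs_deriv:
  assumes "entire_coeffs A"
  shows "((\<lambda>y. \<Sum>n. A n * (y\<^sup>2 / 4) ^ n) has_field_derivative
           (2 / y) * (\<Sum>n. of_nat n * A n * (y\<^sup>2 / 4) ^ n)) (at y)"
proof -
  let ?q = "y\<^sup>2 / 4"
  have "((\<lambda>q. \<Sum>n. A n * q ^ n) has_field_derivative (\<Sum>n. diffs A n * ?q ^ n)) (at ?q)"
    using assms by (intro termdiffs_strong_converges_everywhere) (simp add: entire_coeffs_def)
  moreover have "((\<lambda>y. y\<^sup>2 / 4) has_field_derivative y / 2) (at y)"
    by (auto intro!: derivative_eq_intros)
  ultimately have "((\<lambda>y. \<Sum>n. A n * (y\<^sup>2 / 4) ^ n) has_field_derivative (\<Sum>n. diffs A n * ?q ^ n) * (y / 2)) (at y)"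
    by (rule DERIV_chain2)
  also have "(\<Sum>n. diffs A n * ?q ^ n) * (y / 2) = (2 / y) * (\<Sum>n. of_nat n * A n * (y\<^sup>2 / 4) ^ n)"
  \<comment> \<open>At y = 0 both sides are 0, the right one because 2 / 0 = 0.\<close>
  proof (cases "y = 0")
    case False
    have s: "summable (\<lambda>n. diffs A n * ?q ^ n)"
      using assms by (intro termdiff_converges_all) (simp add: entire_coeffs_def)
    have "(\<lambda>n. diffs A n * ?q ^ n * ?q) sums ((\<Sum>n. diffs A n * ?q ^ n) * ?q)"
      by (intro sums_mult2 summable_sums s)
    also have "(\<lambda>n. diffs A n * ?q ^ n * ?q) = (\<lambda>n. of_nat (Suc n) * A (Suc n) * ?q ^ Suc n)"
      by (simp add: diffs_def mult_ac)
    finally have "(\<lambda>n. of_nat n * A n * ?q ^ n) sums ((\<Sum>n. diffs A n * ?q ^ n) * ?q)"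
      by (subst (asm) sums_Suc_iff) simp
    then have eq: "(\<Sum>n. of_nat n * A n * ?q ^ n) = (\<Sum>n. diffs A n * ?q ^ n) * ?q" by (rule sums_unique[symmetric])
    have "T * (y / 2) = (2 / y) * (T * ?q)" for T using False by (simp add: power2_eq_square)
    then show ?thesis unfolding eq .
  qed simp
  finally show ?thesis .
qed

lemma Re_pos_half: "Re y > 0 \<Longrightarrow> y / 2 \<notin> \<real>\<^sub>\<le>\<^sub>0"
  by (auto simp: complex_nonpos_Reals_iff)

text \<open>The operator y/2 d/dy sends the pair (P, A) to (n P - A, n A), since differentiating
  \<open>2 * Ln (y / 2)\<close> releases one copy of A. Logarithmic series are closed under
  it.\<close>

lemma logser_deriv:
  assumes "entire_coeffs P" "entire_coeffs A" and y: "Re y > 0"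
  shows "(logser P A has_field_derivative
           (2 / y) * logser (\<lambda>n. of_nat n * P n - A n) (\<lambda>n. of_nat n * A n) y) (at y)"
proof -
  let ?S = "\<lambda>A. \<Sum>n. A n * (y\<^sup>2 / 4) ^ n"
  have y0: "y \<noteq> 0" using y by auto
  have "((\<lambda>y. Ln (y / 2)) has_field_derivative 1 / y) (at y)"
    using Re_pos_half[OF y] y0 by (auto intro!: derivative_eq_intros simp: field_simps)
  then have "(logser P A has_field_derivative
     (2 / y) * ?S (\<lambda>n. of_nat n * P n) - (2 * Ln (y / 2) * ((2 / y) * ?S (\<lambda>n. of_nat n * A n)) + 2 * (1 / y) * ?S A)) (at y)"
    unfolding logser_def[abs_def]
    by (intro DERIV_diff DERIV_mult' DERIV_cmult entire_coeffs_deriv assms)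
  moreover have eq: "?S (\<lambda>n. of_nat n * P n - A n) = ?S (\<lambda>n. of_nat n * P n) - ?S A"
    using assms(2) entire_coeffs_mult_n[OF assms(1)]
    by (simp add: left_diff_distrib suminf_diff entire_coeffs_def)
  moreover have "(2 / y) * T - (2 * Ln (y / 2) * ((2 / y) * V) + 2 * (1 / y) * U) = (2 / y) * (T - U - 2 * Ln (y / 2) * V)" for T U V
    by (simp add: algebra_simps diff_divide_distrib)
  ultimately show ?thesis
    unfolding logser_def eq by simp
qed

section \<open>The two-parameter family of coefficients\<close>

text \<open>The true growth is logarithmic; the crude 2^n falls out of the recurrence and disappears
  against the factorials.\<close>

lemma norm_Digamma_shift:
  assumes "Re s > 0"
  obtains D where "D \<ge> 0" "\<And>n. norm (Digamma (s + of_nat n)) \<le> D * 2 ^ n"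
proof -
  define D where "D = norm (Digamma s) + 1 / Re s"
  have D: "norm (Digamma s) \<le> D" "1 / Re s \<le> D" using assms by (auto simp: D_def)
  have "norm (Digamma (s + of_nat n)) \<le> D * 2 ^ n" for n
  proof (induction n)
    case (Suc n)
    have r: "Re s \<le> norm (s + of_nat n)" using complex_Re_le_cmod[of "s + of_nat n"] by simp
    then have "s + of_nat n \<noteq> 0" using assms by auto
    then have "Digamma (s + of_nat (Suc n)) = Digamma (s + of_nat n) + 1 / (s + of_nat n)"
      using Digamma_plus1[of "s + of_nat n"] by (simp add: add_ac)
    moreover have "norm (1 / (s + of_nat n)) \<le> 1 / Re s"
      using r assms by (simp add: norm_divide frac_le)
    ultimately have "norm (Digamma (s + of_nat (Suc n))) \<le> D * 2 ^ n + D"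
      using Suc.IH D norm_triangle_ineq[of "Digamma (s + of_nat n)" "1 / (s + of_nat n)"] by simp
    also have "\<dots> \<le> D * 2 ^ n + D * 2 ^ n" using assms mult_left_mono[of 1 "2 ^ n" D] by (intro add_left_mono) (simp add: D_def)
    finally show ?case by simp
  qed (use D in simp)
  moreover have "D \<ge> 0" using assms by (simp add: D_def)
  ultimately show ?thesis by (rule that[rotated])
qed

definition coefA :: "complex \<Rightarrow> complex \<Rightarrow> nat \<Rightarrow> complex" where
  "coefA s c n = Gamma (s + of_nat n) / (fact n)\<^sup>2 * rGamma (c + of_nat n)"

text \<open>Where c + n is not a pole of Gamma this is \<open>coefA s c n\<close> times 2 psi(1 + n)
  - psi(s + n) + psi(c + n). Writing the last term with \<open>deriv rGamma\<close> makes it entire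
  in c.\<close>

definition coefP :: "complex \<Rightarrow> complex \<Rightarrow> nat \<Rightarrow> complex" where
  "coefP s c n = Gamma (s + of_nat n) / (fact n)\<^sup>2 *
     (rGamma (c + of_nat n) * (2 * Digamma (1 + of_nat n) - Digamma (s + of_nat n)) - deriv rGamma (c + of_nat n))"

lemma pochhammer_Gamma_pos: "Re s > 0 \<Longrightarrow> Gamma (s + of_nat n) = pochhammer s n * Gamma (s::complex)"
  by (subst pochhammer_Gamma) (auto elim!: nonpos_Ints_cases simp: Gamma_eq_zero_iff)

lemma coef_bounds:
  assumes s: "Re s > 0"
  obtains C K where "C \<ge> 0" "K \<ge> 0"
    "\<And>c n. norm c \<le> R \<Longrightarrow> norm (coefA s c n) \<le> C * K ^ n / fact n"
    "\<And>c n. norm c \<le> R \<Longrightarrow> norm (coefP s c n) \<le> C * K ^ n / fact n"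
proof -
  obtain B1 where B1: "B1 \<ge> 0" "\<forall>c n. norm (c::complex) \<le> R \<longrightarrow> norm (rGamma (c + of_nat n)) \<le> B1 * 4 ^ n / fact n"
    using rGamma_shift_bound[of R] by metis
  obtain B2 where B2: "B2 \<ge> 0" "\<forall>c n. norm (c::complex) \<le> R \<longrightarrow> norm (deriv rGamma (c + of_nat n)) \<le> B2 * 4 ^ n / fact n"
    using deriv_rGamma_shift_bound[of R] by metis
  obtain D1 where D1: "D1 \<ge> 0" "\<forall>n. norm (Digamma (1 + of_nat n :: complex)) \<le> D1 * 2 ^ n"
    using norm_Digamma_shift[of 1] by (metis one_complex.sel(1) zero_less_one)
  obtain D2 where D2: "D2 \<ge> 0" "\<forall>n. norm (Digamma (s + of_nat n)) \<le> D2 * 2 ^ n"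
    using norm_Digamma_shift[OF s] by metis
  define G where "G = norm (Gamma s)"
  define D where "D = 2 * D1 + D2 + 1"
  define C where "C = G * (B1 + B2) * D"
  \<comment> \<open>The 8 combines 4 from the shifted rGamma and 2 from the shifted Digamma;
    \<open>norm s + 1\<close> comes from the Pochhammer symbol.\<close>
  define K where "K = 8 * (norm s + 1)"
  have G: "norm (Gamma (s + of_nat n)) \<le> G * (norm s + 1) ^ n * fact n" for n
    using mult_right_mono[OF norm_pochhammer_le[of s n], of G]
    by (simp add: pochhammer_Gamma_pos[OF s] norm_mult G_def mult_ac)
  have main: "norm (Gamma (s + of_nat n) / (fact n)\<^sup>2 * X) \<le> C * K ^ n / fact n"
    if X: "norm X \<le> (B1 + B2) * D * 8 ^ n / fact n" for X :: complex and n
  proof -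
    have "norm (Gamma (s + of_nat n) / (fact n)\<^sup>2 * X) = norm (Gamma (s + of_nat n)) / (fact n)\<^sup>2 * norm X"
      by (simp add: norm_mult norm_divide norm_power)
    also have "\<dots> \<le> (G * (norm s + 1) ^ n * fact n) / (fact n)\<^sup>2 * ((B1 + B2) * D * 8 ^ n / fact n)"
      using G[of n] by (intro mult_mono divide_right_mono X) (auto simp: G_def)
    also have "\<dots> = C * K ^ n / ((fact n)\<^sup>2)"
      unfolding C_def K_def power_mult_distrib by (simp add: field_simps power2_eq_square)
    also have "\<dots> \<le> C * K ^ n / fact n"
    proof (rule divide_left_mono)
      have "(1::real) \<le> fact n" by simp
      then have "fact n * (1::real) \<le> fact n * fact n" by (intro mult_left_mono) auto
      then show "(fact n::real) \<le> (fact n)\<^sup>2" by (simp add: power2_eq_square)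
      show "0 \<le> C * K ^ n" using B1 B2 D1 D2 by (auto simp: C_def K_def G_def D_def intro!: mult_nonneg_nonneg)
    qed auto
    finally show ?thesis .
  qed
  have 8: "(8::real) ^ n = 4 ^ n * 2 ^ n" for n by (simp flip: power_mult_distrib)
  have Dge: "D \<ge> 1" using D1 D2 by (simp add: D_def)
  have A: "norm (coefA s c n) \<le> C * K ^ n / fact n" if c: "norm c \<le> R" for c n
    unfolding coefA_def
  proof (rule main)
    have "norm (rGamma (c + of_nat n)) \<le> B1 * 4 ^ n / fact n" using B1 c by blast
    also have "\<dots> \<le> (B1 + B2) * D * 8 ^ n / fact n"
    proof (intro divide_right_mono mult_mono)
      show "B1 \<le> (B1 + B2) * D" using B1 B2 Dge mult_mono[of B1 "B1 + B2" 1 D] by simp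
      show "(4::real) ^ n \<le> 8 ^ n" by (intro power_mono) auto
    qed (use B1 B2 Dge in auto)
    finally show "norm (rGamma (c + of_nat n)) \<le> (B1 + B2) * D * 8 ^ n / fact n" .
  qed
  have P: "norm (coefP s c n) \<le> C * K ^ n / fact n" if c: "norm c \<le> R" for c n
    unfolding coefP_def
  proof (rule main)
    let ?U = "rGamma (c + of_nat n)" and ?V = "2 * Digamma (1 + of_nat n) - Digamma (s + of_nat n)"
    have V: "norm ?V \<le> (2 * D1 + D2) * 2 ^ n"
      using D1(2)[rule_format, of n] D2(2)[rule_format, of n]
        norm_triangle_ineq4[of "2 * Digamma (1 + of_nat n)" "Digamma (s + of_nat n)"]
      by (simp add: norm_mult algebra_simps)
    have "norm (?U * ?V - deriv rGamma (c + of_nat n)) \<le> norm ?U * norm ?V + norm (deriv rGamma (c + of_nat n))"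
      by (rule order.trans[OF norm_triangle_ineq4]) (simp add: norm_mult)
    also have "\<dots> \<le> (B1 * 4 ^ n / fact n) * ((2 * D1 + D2) * 2 ^ n) + B2 * 4 ^ n / fact n"
      using B1 B2 c V by (intro add_mono mult_mono) auto
    also have "\<dots> = (B1 * (2 * D1 + D2) * 8 ^ n + B2 * 4 ^ n) / fact n"
      by (simp add: 8 add_divide_distrib mult_ac)
    also have "\<dots> \<le> (B1 * D * 8 ^ n + B2 * D * 8 ^ n) / fact n"
    proof (intro divide_right_mono add_mono mult_mono)
      show "B2 \<le> B2 * D" using B2 Dge by (simp add: mult_le_cancel_left1)
      show "(4::real) ^ n \<le> 8 ^ n" by (intro power_mono) auto
    qed (use B1 B2 D1 D2 in \<open>auto simp: D_def\<close>)
    also have "\<dots> = (B1 + B2) * D * 8 ^ n / fact n" by (simp add: algebra_simps)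
    finally show "norm (?U * ?V - deriv rGamma (c + of_nat n)) \<le> (B1 + B2) * D * 8 ^ n / fact n" .
  qed
  have "C \<ge> 0" "K \<ge> 0" using B1 B2 Dge by (auto simp: C_def K_def G_def)
  then show ?thesis using A P by (rule that)
qed

lemma summable_exp_bound: "summable (\<lambda>n. C * K ^ n / fact n * r ^ n)" for r :: real
proof -
  have "summable (\<lambda>n. C * (inverse (fact n) * (K * r) ^ n))"
    by (intro summable_mult summable_exp)
  then show ?thesis by (simp add: power_mult_distrib field_simps)
qed

lemma entire_coeffs_coef:
  assumes "Re s > 0" shows "entire_coeffs (coefA s c)" "entire_coeffs (coefP s c)"
proof -
  obtain C K where CK: "C \<ge> 0" "K \<ge> 0" "\<forall>n. norm (coefA s c n) \<le> C * K ^ n / fact n" "\<forall>n. norm (coefP s c n) \<le> C * K ^ n / fact n"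
    using coef_bounds[OF assms, of "norm c"] by (metis order_refl)
  have "norm (coefA s c n * q ^ n) \<le> C * K ^ n / fact n * norm q ^ n"
    "norm (coefP s c n * q ^ n) \<le> C * K ^ n / fact n * norm q ^ n" for q n
    unfolding norm_mult norm_power using CK by (intro mult_right_mono; simp)+
  then show "entire_coeffs (coefA s c)" "entire_coeffs (coefP s c)"
    unfolding entire_coeffs_def
    by (blast intro: summable_comparison_test'[OF summable_exp_bound])+
qed

text \<open>For Re y > 0 and s = \<mu> + lam + 1/2, c = lam + 1/2 this is \<open>gen_besselK\<close>
  at z = 0 up to the factor \<open>y powr lam * 2 powr (\<mu> - 1)\<close>, as
  \<open>gen_besselK_0\<close> will show.\<close>

definition besselFC :: "complex \<Rightarrow> complex \<Rightarrow> complex \<Rightarrow> complex" where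
  "besselFC s c = logser (coefP s c) (coefA s c)"

lemma besselFC_deriv:
  assumes "Re s > 0" "Re y > 0"
  shows "(besselFC s c has_field_derivative
     (2 / y) * logser (\<lambda>n. of_nat n * coefP s c n - coefA s c n) (\<lambda>n. of_nat n * coefA s c n) y) (at y)"
  unfolding besselFC_def using assms by (intro logser_deriv entire_coeffs_coef)

lemma besselFC_holomorphic: "Re s > 0 \<Longrightarrow> besselFC s c holomorphic_on {y. Re y > 0}"
  using besselFC_deriv open_halfspace_Re_gt[of 0] by (subst holomorphic_on_open) auto

lemma coefA_rec: "coefA s c n = (c + of_nat n) * coefA s (c + 1) n"
  using rGamma_Suc[of c n] by (simp add: coefA_def add_ac)

text \<open>The extra term comes from differentiating the factor w in rGamma w = w rGamma (w +
  1).\<close>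

lemma coefP_rec: "coefP s c n = (c + of_nat n) * coefP s (c + 1) n - coefA s (c + 1) n"
proof -
  define w where "w = c + of_nat n"
  have "((\<lambda>z. z * rGamma (z + 1)) has_field_derivative w * deriv rGamma (w + 1) + rGamma (w + 1)) (at w)"
  proof -
    have "(rGamma has_field_derivative deriv rGamma (w + 1)) (at (w + 1))"
      by (rule holomorphic_derivI[of _ UNIV]) (auto intro!: holomorphic_intros)
    then have "((\<lambda>z. rGamma (z + 1)) has_field_derivative deriv rGamma (w + 1)) (at w)"
      by (subst (asm) DERIV_shift)
    from DERIV_mult[OF DERIV_ident this] show ?thesis by (simp add: algebra_simps)
  qed
  moreover have "(\<lambda>z. z * rGamma (z + 1)) = (rGamma :: complex \<Rightarrow> complex)"
    by (rule ext) (rule rGamma_plus1)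
  ultimately have d: "deriv rGamma w = w * deriv rGamma (w + 1) + rGamma (w + 1)"
    by (simp add: DERIV_imp_deriv)
  have g: "rGamma w = w * rGamma (w + 1)" by (simp add: rGamma_plus1)
  have e: "c + 1 + of_nat n = w + 1" "c + of_nat n = w" by (auto simp: w_def)
  show ?thesis unfolding coefP_def coefA_def e d g by (simp add: algebra_simps diff_divide_distrib add_divide_distrib)
qed

text \<open>The factor c + n of the coefficient recurrences splits into c and the index n, which y/2
  d/dy produces; the extra \<open>- coefA\<close> in \<open>coefP_rec\<close> is precisely what this
  operator obtains from the logarithm. Lowering c thus costs one derivative in y.\<close>

lemma besselFC_rec:
  assumes s: "Re s > 0" and y: "Re y > 0"
  shows "besselFC s c y = c * besselFC s (c + 1) y + y / 2 * deriv (besselFC s (c + 1)) y"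
proof -
  have y0: "y \<noteq> 0" using y by auto
  let ?P = "coefP s (c + 1)" and ?A = "coefA s (c + 1)"
  let ?S = "\<lambda>A. \<Sum>n. A n * (y\<^sup>2 / 4) ^ n"
  have E: "entire_coeffs ?P" "entire_coeffs ?A" "entire_coeffs (\<lambda>n. of_nat n * ?A n)"
     "entire_coeffs (\<lambda>n. of_nat n * ?P n - ?A n)"
    using s by (intro entire_coeffs_coef entire_coeffs_mult_n entire_coeffs_diff; simp)+
  then have S: "summable (\<lambda>n. ?P n * (y\<^sup>2 / 4) ^ n)" "summable (\<lambda>n. ?A n * (y\<^sup>2 / 4) ^ n)"
     "summable (\<lambda>n. of_nat n * ?A n * (y\<^sup>2 / 4) ^ n)" "summable (\<lambda>n. (of_nat n * ?P n - ?A n) * (y\<^sup>2 / 4) ^ n)"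
    by (auto simp: entire_coeffs_def)
  have "?S (coefA s c) = (\<Sum>n. c * (?A n * (y\<^sup>2 / 4) ^ n) + of_nat n * ?A n * (y\<^sup>2 / 4) ^ n)"
    by (intro suminf_cong) (subst coefA_rec, simp add: algebra_simps)
  also have "\<dots> = c * ?S ?A + ?S (\<lambda>n. of_nat n * ?A n)"
    using S by (simp add: suminf_add[symmetric] suminf_mult summable_mult)
  finally have 1: "?S (coefA s c) = c * ?S ?A + ?S (\<lambda>n. of_nat n * ?A n)" .
  have "?S (coefP s c) = (\<Sum>n. c * (?P n * (y\<^sup>2 / 4) ^ n) + (of_nat n * ?P n - ?A n) * (y\<^sup>2 / 4) ^ n)"
    by (intro suminf_cong) (subst coefP_rec, simp add: algebra_simps)
  also have "\<dots> = c * ?S ?P + ?S (\<lambda>n. of_nat n * ?P n - ?A n)"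
    using S by (simp add: suminf_add[symmetric] suminf_mult summable_mult)
  finally have 2: "?S (coefP s c) = c * ?S ?P + ?S (\<lambda>n. of_nat n * ?P n - ?A n)" .
  have "deriv (besselFC s (c + 1)) y = (2 / y) * logser (\<lambda>n. of_nat n * ?P n - ?A n) (\<lambda>n. of_nat n * ?A n) y"
    by (rule DERIV_imp_deriv[OF besselFC_deriv[OF s y]])
  then have "y / 2 * deriv (besselFC s (c + 1)) y = logser (\<lambda>n. of_nat n * ?P n - ?A n) (\<lambda>n. of_nat n * ?A n) y"
    using y0 by simp
  then show ?thesis unfolding besselFC_def logser_def 1 2 by (simp add: algebra_simps)
qed

lemma besselFC_holomorphic_c:
  assumes s: "Re s > 0"
  shows "(\<lambda>c. besselFC s c y) holomorphic_on UNIV"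
proof -
  let ?q = "y\<^sup>2 / 4"
  have bd: "\<exists>d h. 0 < d \<and> summable h \<and> (\<forall>n. \<forall>c\<in>ball c0 d \<inter> UNIV. norm (coefA s c n * ?q ^ n) \<le> h n)"
     "\<exists>d h. 0 < d \<and> summable h \<and> (\<forall>n. \<forall>c\<in>ball c0 d \<inter> UNIV. norm (coefP s c n * ?q ^ n) \<le> h n)" for c0
  proof -
    obtain C K where CK: "\<forall>c n. norm c \<le> norm c0 + 1 \<longrightarrow> norm (coefA s c n) \<le> C * K ^ n / fact n"
        "\<forall>c n. norm c \<le> norm c0 + 1 \<longrightarrow> norm (coefP s c n) \<le> C * K ^ n / fact n"
      using coef_bounds[OF s, of "norm c0 + 1"] by metis
    have n: "norm c \<le> norm c0 + 1" if "c \<in> ball c0 1 \<inter> UNIV" for c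
      using that norm_triangle_ineq2[of c c0] by (simp add: dist_norm norm_minus_commute)
    have "norm (coefA s c n * ?q ^ n) \<le> C * K ^ n / fact n * norm ?q ^ n"
      "norm (coefP s c n * ?q ^ n) \<le> C * K ^ n / fact n * norm ?q ^ n" if "c \<in> ball c0 1 \<inter> UNIV" for c n
      unfolding norm_mult norm_power using CK n[OF that] by (intro mult_right_mono; simp)+
    then show "\<exists>d h. 0 < d \<and> summable h \<and> (\<forall>n. \<forall>c\<in>ball c0 d \<inter> UNIV. norm (coefA s c n * ?q ^ n) \<le> h n)"
       "\<exists>d h. 0 < d \<and> summable h \<and> (\<forall>n. \<forall>c\<in>ball c0 d \<inter> UNIV. norm (coefP s c n * ?q ^ n) \<le> h n)"
      using summable_exp_bound[of C K "norm ?q"]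
      by (intro exI[of _ 1] exI[of _ "\<lambda>n. C * K ^ n / fact n * norm ?q ^ n"]; simp)+
  qed
  have h: "(\<lambda>c. coefA s c n * ?q ^ n) holomorphic_on UNIV" "(\<lambda>c. coefP s c n * ?q ^ n) holomorphic_on UNIV" for n
  proof -
    have "(\<lambda>c. deriv rGamma (c + of_nat n)) holomorphic_on UNIV"
      by (rule holomorphic_on_shift) (auto intro!: holomorphic_intros)
    then show "(\<lambda>c. coefA s c n * ?q ^ n) holomorphic_on UNIV" "(\<lambda>c. coefP s c n * ?q ^ n) holomorphic_on UNIV"
      unfolding coefA_def coefP_def by (auto intro!: holomorphic_intros)
  qed
  show ?thesis unfolding besselFC_def logser_def
    by (intro holomorphic_on_diff holomorphic_on_mult holomorphic_on_const
         holomorphic_on_series(1)[OF open_UNIV h(1) bd(1)] holomorphic_on_series(1)[OF open_UNIV h(2) bd(2)])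
qed

subsection \<open>The logarithmic series of K_0\<close>


lemma deriv_rGamma_eq: "z \<notin> \<int>\<^sub>\<le>\<^sub>0 \<Longrightarrow> deriv rGamma z = - (rGamma z * Digamma (z::complex))"
  using DERIV_imp_deriv[OF has_field_derivative_rGamma_no_nonpos_int[of z UNIV]] by (simp add: mult.commute)

section \<open>Bessel's equation\<close>

lemma besselK0_cosh_bound:
  assumes "0 < r" "r \<le> Re y"
  shows "norm (of_real (cosh t) * exp (- y * of_real (cosh t))) \<le> 8 / r\<^sup>2 * exp (- 1 * t)"
proof -
  have c: "cosh t > 0" by (rule cosh_real_pos)
  \<comment> \<open>This is half of the exponent: one factor exp (- u) absorbs cosh t, the other
    supplies the decay in t.\<close>
  define u where "u = r / 2 * cosh t"
  have "u \<le> exp u" using exp_ge_add_one_self[of u] by linarith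
  then have "u * exp (- u) \<le> exp u * exp (- u)" by (intro mult_right_mono) auto
  then have u1: "u * exp (- u) \<le> 1" by (simp add: exp_minus_inverse)
  have "norm (exp (- of_real (r / 2) * complex_of_real (cosh t))) \<le> (2 * 1) powr 1 * (r / 2) powr (- 1) * exp (- 1 * t)"
    using assms by (intro besselK0_integrand_bound) auto
  also have "(2 * 1) powr 1 * (r / 2) powr (- 1) = 4 / r" using assms by (simp add: powr_minus_divide)
  finally have u2: "exp (- u) \<le> 4 / r * exp (- 1 * t)" by (simp add: u_def)
  have "norm (of_real (cosh t) * exp (- y * of_real (cosh t))) = cosh t * exp (- (Re y * cosh t))"
    using c by (simp add: norm_mult)
  also have "\<dots> \<le> cosh t * exp (- (r * cosh t))" using assms c by (intro mult_left_mono) auto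
  also have "\<dots> = 2 / r * (u * exp (- u)) * exp (- u)"
    using assms by (simp add: u_def field_simps flip: exp_add)
  also have "\<dots> \<le> 2 / r * 1 * (4 / r * exp (- 1 * t))"
    using assms u1 u2 c by (intro mult_mono) (auto simp: u_def)
  also have "\<dots> = 8 / r\<^sup>2 * exp (- 1 * t)" by (simp add: power2_eq_square)
  finally show ?thesis .
qed

text \<open>Bessel's equation in the form (y K')' = y K. The combination (y cosh^2 t - cosh t - y)
  exp (- y cosh t) is the t-derivative of - sinh t exp (- y cosh t), which vanishes at 0 and at
  infinity.\<close>

lemma besselK0_ode:
  assumes y: "Re y > 0"
  obtains K' where "\<And>y. Re y > 0 \<Longrightarrow> (besselK0 has_field_derivative K' y) (at y)"
    "\<And>y. Re y > 0 \<Longrightarrow> ((\<lambda>y. y * K' y) has_field_derivative y * besselK0 y) (at y)"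
proof -
  let ?M = halfline_lborel
  have sinh_of_real: "sinh (complex_of_real t) = of_real (sinh t)" and cosh_of_real: "cosh (complex_of_real t) = of_real (cosh t)" for t
    by (simp_all add: sinh_def cosh_def scaleR_conv_of_real exp_of_real flip: of_real_minus)
  let ?e = "\<lambda>y t. exp (- y * complex_of_real (cosh t))"
  define K' where "K' y = (\<integral>t. - (of_real (cosh t) * ?e y t) \<partial>?M)" for y
  have d1: "deriv (\<lambda>y. ?e y t) y = - (of_real (cosh t) * ?e y t)" for t y
    by (rule DERIV_imp_deriv) (auto intro!: derivative_eq_intros)
  have 1: "(besselK0 has_field_derivative K' y) (at y)" if "Re y > 0" for y
    using holomorphic_besselK0_aux(3)[OF that] unfolding d1 K'_def .
  have iK': "integrable ?M (\<lambda>t. - (of_real (cosh t) * ?e y t))" if "Re y > 0" for y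
    using holomorphic_besselK0_aux(2)[OF that] unfolding d1 .
  have 2: "((\<lambda>y. y * K' y) has_field_derivative y * besselK0 y) (at y)" if y: "Re y > 0" for y
  proof -
    have bd: "norm (- (of_real (cosh t) * ?e w t)) \<le> 8 / (Re y / 2)\<^sup>2 * exp (- 1 * t)"
      if "w \<in> ball y (Re y / 2)" "t \<in> space ?M" for w t
      unfolding norm_minus_cancel using ball_Re[OF that(1)] y by (intro besselK0_cosh_bound) auto
    have m: "(\<lambda>t. - (of_real (cosh t) * ?e w t)) \<in> borel_measurable ?M" for w
      by (intro measurable_halfline_lborel continuous_intros)
    have h: "(\<lambda>w. - (of_real (cosh t) * ?e w t)) holomorphic_on ball y (Re y / 2)" for t
      by (intro holomorphic_intros)
    have i: "integrable ?M (\<lambda>t. 8 / (Re y / 2)\<^sup>2 * exp (- 1 * t))"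
      using has_integral_exp_halfline[of 1] by (intro integrable_mult_right) (simp add: has_bochner_integral_iff)
    have r: "Re y / 2 > 0" using y by simp
    note p = has_field_derivative_integral_param[OF r m h bd i]
    have d2: "deriv (\<lambda>w. - (of_real (cosh t) * ?e w t)) y = (of_real (cosh t))\<^sup>2 * ?e y t" for t
      by (rule DERIV_imp_deriv) (auto intro!: derivative_eq_intros simp: power2_eq_square)
    note p = p[unfolded d2]
    let ?g = "\<lambda>t. y * ((of_real (cosh t))\<^sup>2 * ?e y t) + (- (of_real (cosh t) * ?e y t)) - y * ?e y t"
    have int: "integrable ?M ?g"
      by (intro Bochner_Integration.integrable_add Bochner_Integration.integrable_diff integrable_mult_right p(1) iK' integrable_besselK0 y)
    have "(\<integral>t. ?g t \<partial>?M) = 0 - (- (of_real (sinh 0) * ?e y 0))"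
    proof (rule integral_FTC_halfline[OF _ _ int])
      show "continuous_on {0..} ?g" by (intro continuous_intros)
      fix t :: real
      have c2: "(complex_of_real (cosh t))\<^sup>2 = 1 + (of_real (sinh t))\<^sup>2"
        by (metis cosh_square_eq of_real_add of_real_1 of_real_power add.commute)
      have "((\<lambda>w. - (sinh w * exp (- y * cosh w))) has_field_derivative
          - (cosh (of_real t) * exp (- y * cosh (of_real t)) + sinh (of_real t) * (exp (- y * cosh (of_real t)) * (- y * sinh (of_real t))))) (at (complex_of_real t))"
        by (auto intro!: derivative_eq_intros)
      from has_vector_derivative_real_field[OF this]
      have "((\<lambda>t. - (of_real (sinh t) * ?e y t)) has_vector_derivative
         - (of_real (cosh t) * ?e y t + of_real (sinh t) * (?e y t * (- y * of_real (sinh t))))) (at t)"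
        by (simp only: sinh_of_real cosh_of_real)
      also have "- (of_real (cosh t) * ?e y t + of_real (sinh t) * (?e y t * (- y * of_real (sinh t)))) = ?g t"
        unfolding c2 by (simp add: algebra_simps power2_eq_square)
      finally show "((\<lambda>t. - (of_real (sinh t) * ?e y t)) has_vector_derivative ?g t) (at t)" .
    next
      have "((\<lambda>t. 8 / (Re y)\<^sup>2 * exp (- 1 * t)) \<longlongrightarrow> 0) at_top" by real_asymp
      moreover have "\<forall>\<^sub>F t in at_top. norm (- (of_real (sinh t) * ?e y t)) \<le> 8 / (Re y)\<^sup>2 * exp (- 1 * t)"
        using eventually_ge_at_top[of 0]
      proof eventually_elim
        case (elim t)
        have "norm (- (of_real (sinh t) * ?e y t)) \<le> norm (of_real (cosh t) * ?e y t)"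
          unfolding norm_minus_cancel norm_mult using elim sinh_le_cosh_real[of t]
          by (intro mult_right_mono) (auto simp: cosh_real_nonneg)
        also have "\<dots> \<le> 8 / (Re y)\<^sup>2 * exp (- 1 * t)" using y by (intro besselK0_cosh_bound) auto
        finally show ?case .
      qed
      ultimately show "((\<lambda>t. - (of_real (sinh t) * ?e y t)) \<longlongrightarrow> 0) at_top"
        by (rule Lim_null_comparison[rotated])
    qed
    then have "(\<integral>t. ?g t \<partial>?M) = 0" by simp
    moreover have "(\<integral>t. ?g t \<partial>?M) = y * (\<integral>t. (of_real (cosh t))\<^sup>2 * ?e y t \<partial>?M) + K' y - y * besselK0 y"
      unfolding K'_def besselK0_def
      by (simp only: Bochner_Integration.integral_add Bochner_Integration.integral_diff integral_mult_right_zero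
          Bochner_Integration.integrable_add integrable_mult_right p(1) iK' integrable_besselK0 y)
    ultimately have eq: "1 * K' y + (\<integral>t. (of_real (cosh t))\<^sup>2 * ?e y t \<partial>?M) * y = y * besselK0 y"
      by (simp add: algebra_simps)
    have "(K' has_field_derivative (\<integral>t. (of_real (cosh t))\<^sup>2 * ?e y t \<partial>?M)) (at y)"
      using p(2) unfolding K'_def[abs_def] .
    from DERIV_mult[OF DERIV_ident this] show ?thesis unfolding eq .
  qed
  show ?thesis using 1 2 by (rule that)
qed

lemma suminf_shift_coeffs:
  assumes "entire_coeffs A" "B 0 = 0" "\<And>n. B (Suc n) = A n"
  shows "(\<Sum>n. B n * q ^ n) = q * (\<Sum>n. A n * q ^ n)"
proof -
  have "(\<lambda>n. q * (A n * q ^ n)) sums (q * (\<Sum>n. A n * q ^ n))"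
    using assms(1) by (intro sums_mult summable_sums) (simp add: entire_coeffs_def)
  also have "(\<lambda>n. q * (A n * q ^ n)) = (\<lambda>n. B (Suc n) * q ^ Suc n)" by (simp add: assms mult_ac)
  finally have "(\<lambda>n. B n * q ^ n) sums (q * (\<Sum>n. A n * q ^ n))"
    by (subst (asm) sums_Suc_iff) (simp add: assms)
  then show ?thesis by (rule sums_unique[symmetric])
qed

text \<open>Applying (P, A) -> (n P - A, n A) twice gives n^2 P - 2 n A and n^2 A. The recurrences
  say that this shifts the index by one, which is multiplication by y^2/4.\<close>

lemma logser_ode:
  assumes E: "entire_coeffs P" "entire_coeffs A"
    and P: "\<And>n. (of_nat (Suc n))\<^sup>2 * P (Suc n) - 2 * of_nat (Suc n) * A (Suc n) = P n"
    and A: "\<And>n. (of_nat (Suc n))\<^sup>2 * A (Suc n) = A n"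
    and y: "Re y > 0"
  shows "(logser (\<lambda>n. of_nat n * P n - A n) (\<lambda>n. of_nat n * A n) has_field_derivative
      (2 / y) * (y\<^sup>2 / 4 * logser P A y)) (at y)"
proof -
  let ?P1 = "\<lambda>n. of_nat n * P n - A n" and ?A1 = "\<lambda>n. of_nat n * A n"
  have s1: "(\<Sum>n. (of_nat n * ?P1 n - ?A1 n) * (y\<^sup>2 / 4) ^ n) = y\<^sup>2 / 4 * (\<Sum>n. P n * (y\<^sup>2 / 4) ^ n)"
    by (rule suminf_shift_coeffs[OF E(1)]) (simp, subst P[symmetric], simp add: algebra_simps power2_eq_square)
  have s2: "(\<Sum>n. of_nat n * ?A1 n * (y\<^sup>2 / 4) ^ n) = y\<^sup>2 / 4 * (\<Sum>n. A n * (y\<^sup>2 / 4) ^ n)"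
    by (rule suminf_shift_coeffs[OF E(2)]) (simp, subst A[symmetric], simp add: algebra_simps power2_eq_square)
  have "logser (\<lambda>n. of_nat n * ?P1 n - ?A1 n) (\<lambda>n. of_nat n * ?A1 n) y = y\<^sup>2 / 4 * logser P A y"
    unfolding logser_def s1 s2 by (simp add: algebra_simps)
  then show ?thesis
    using logser_deriv[of ?P1 ?A1 y] E y by (simp only: entire_coeffs_mult_n entire_coeffs_diff)
qed

definition besselA :: "nat \<Rightarrow> complex" where "besselA n = 1 / (fact n)\<^sup>2"

definition besselP :: "nat \<Rightarrow> complex" where "besselP n = 2 * Digamma (1 + of_nat n) / (fact n)\<^sup>2"

text \<open>The series of K_0 is the member s = c = 1 of the family, so the convergence of its
  coefficient series is inherited.\<close>

lemma coef_1_1: "coefA 1 1 = besselA" "coefP 1 1 = besselP"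
proof -
  have np: "1 + of_nat n \<notin> (\<int>\<^sub>\<le>\<^sub>0 :: complex set)" for n
    by (auto elim!: nonpos_Ints_cases simp: complex_eq_iff)
  have g: "Gamma (1 + of_nat n :: complex) * rGamma (1 + of_nat n) = 1" for n
    using np[of n] by (simp add: rGamma_inverse_Gamma Gamma_eq_zero_iff)
  show "coefA 1 1 = besselA" by (rule ext) (use g in \<open>simp add: coefA_def besselA_def\<close>)
  show "coefP 1 1 = besselP"
  proof
    fix n
    have "coefP 1 1 n = (Gamma (1 + of_nat n) * rGamma (1 + of_nat n)) * (2 * Digamma (1 + of_nat n)) / (fact n)\<^sup>2"
      unfolding coefP_def deriv_rGamma_eq[OF np] by (simp add: algebra_simps)
    then show "coefP 1 1 n = besselP n" unfolding g by (simp add: besselP_def)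
  qed
qed

lemma besselA_entire: "entire_coeffs besselA" and besselP_entire: "entire_coeffs besselP"
  using entire_coeffs_coef[of 1 1] by (auto simp: coef_1_1)

lemma besselA_rec: "(of_nat (Suc n))\<^sup>2 * besselA (Suc n) = besselA n"
proof -
  have "of_nat (Suc n) \<noteq> (0::complex)" by (simp del: of_nat_Suc)
  then show ?thesis by (simp add: besselA_def power_mult_distrib del: of_nat_Suc)
qed

lemma besselP_rec: "(of_nat (Suc n))\<^sup>2 * besselP (Suc n) - 2 * of_nat (Suc n) * besselA (Suc n) = besselP n"
proof -
  define m where "m = (of_nat (Suc n) :: complex)"
  have m: "m \<noteq> 0" by (simp add: m_def del: of_nat_Suc)
  have "Digamma (1 + m) = Digamma m + 1 / m"
    using Digamma_plus1[OF m] by (simp add: add.commute)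
  then have e1: "besselP (Suc n) = 2 * (Digamma m + 1 / m) / (m\<^sup>2 * (fact n)\<^sup>2)"
    by (simp add: besselP_def m_def power_mult_distrib del: of_nat_Suc)
  have e2: "besselA (Suc n) = 1 / (m\<^sup>2 * (fact n)\<^sup>2)"
    by (simp add: besselA_def m_def power_mult_distrib del: of_nat_Suc)
  have e3: "besselP n = 2 * Digamma m / (fact n)\<^sup>2"
    by (simp add: besselP_def m_def add.commute)
  have "m\<^sup>2 * (2 * (d + 1 / m) / (m\<^sup>2 * F)) - 2 * m * (1 / (m\<^sup>2 * F)) = 2 * d / F" if "F \<noteq> 0" for d F
    using m that by (simp add: field_simps power2_eq_square)
  from this[of "(fact n)\<^sup>2"] show ?thesis unfolding e1 e2 e3 m_def[symmetric] by simp
qed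

text \<open>The series is I_0(r). The lower bound allows division by it, and the upper bound keeps 1
  / I_0(r)^2 away from 0.\<close>

lemma besselA_real_bounds:
  assumes "0 < r" "r \<le> 1"
  obtains i where "(\<Sum>n. besselA n * ((of_real r)\<^sup>2 / 4) ^ n) = of_real i" "1 \<le> i" "i \<le> exp 1"
proof -
  define f where "f n = (r\<^sup>2 / 4) ^ n / (fact n)\<^sup>2" for n
  have r2: "r\<^sup>2 / 4 \<le> 1" using assms power_le_one[of r 2] by simp
  have f: "f n \<le> 1 ^ n /\<^sub>R fact n" "f n \<ge> 0" for n
  proof -
    have "(1::real) \<le> fact n" by simp
    then have "fact n * (1::real) \<le> fact n * fact n" by (intro mult_left_mono) auto
    then have "(fact n :: real) \<le> (fact n)\<^sup>2" by (simp add: power2_eq_square)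
    moreover have "(r\<^sup>2 / 4) ^ n \<le> 1" using r2 by (intro power_le_one) auto
    ultimately have "(r\<^sup>2 / 4) ^ n / (fact n)\<^sup>2 \<le> 1 / fact n" by (rule frac_le[OF zero_le_one _ fact_gt_zero, rotated])
    then show "f n \<le> 1 ^ n /\<^sub>R fact n" by (simp add: f_def inverse_eq_divide)
    show "f n \<ge> 0" unfolding f_def using assms by (intro divide_nonneg_nonneg zero_le_power) simp_all
  qed
  have e: "(\<lambda>n. 1 ^ n /\<^sub>R fact n) sums exp (1::real)" by (rule exp_converges)
  have sf: "summable f" using f by (intro summable_comparison_test'[OF sums_summable[OF e], where N=0]) auto
  have eq: "besselA n * ((of_real r)\<^sup>2 / 4) ^ n = of_real (f n)" for n
    by (simp add: besselA_def f_def)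
  have "(\<Sum>n. besselA n * ((of_real r)\<^sup>2 / 4) ^ n) = of_real (suminf f)"
    unfolding eq by (rule suminf_of_real[OF sf, symmetric])
  moreover have "1 \<le> suminf f" using sum_le_suminf[OF sf, of "{0}"] f by (simp add: f_def)
  moreover have "suminf f \<le> exp 1" unfolding sums_unique[OF e] using f by (intro suminf_le sf sums_summable[OF e]) auto
  ultimately show ?thesis by (rule that)
qed

text \<open>K_0(r) + ln (r/2) + gamma tends to 0, and \<open>besselP 0\<close> is - 2 gamma. What
  remains of the logarithm multiplies the series of I_0 minus 1, which has a factor r^2.\<close>

lemma besselK0_minus_series_tendsto:
  "((\<lambda>r. 2 * besselK0 (of_real r) - logser besselP besselA (of_real r)) \<longlongrightarrow> 0) (at_right 0)"
proof -
  define q where "q r = (complex_of_real r)\<^sup>2 / 4" for r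
  have q: "(q \<longlongrightarrow> 0) (at_right 0)"
  proof -
    have "(q \<longlongrightarrow> (of_real 0)\<^sup>2 / 4) (at_right 0)" unfolding q_def by (intro tendsto_intros) auto
    then show ?thesis by simp
  qed
  have cont: "((\<lambda>r. \<Sum>n. A n * q r ^ n) \<longlongrightarrow> A 0) (at_right 0)" if "entire_coeffs A" for A
  proof -
    have "((\<lambda>q. \<Sum>n. A n * q ^ n) has_field_derivative (\<Sum>n. diffs A n * 0 ^ n)) (at 0)"
      using that by (intro termdiffs_strong_converges_everywhere) (simp add: entire_coeffs_def)
    then have "isCont (\<lambda>q. \<Sum>n. A n * q ^ n) 0" by (rule DERIV_isCont)
    from isCont_tendsto_compose[OF this q] show ?thesis by simp
  qed
  define B where "B n = besselA (Suc n)" for n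
  have B: "entire_coeffs B"
  proof -
    have "summable (\<lambda>n. B n * z ^ n)" for z
    proof -
      have "norm (B n * z ^ n) \<le> norm (besselA n * z ^ n)" for n
      proof -
        have "fact n \<le> (fact (Suc n) :: real)" by (rule fact_mono) simp
        then have "(fact n)\<^sup>2 \<le> (fact (Suc n) :: real)\<^sup>2" by (rule power_mono) simp
        then have le: "1 / (fact (Suc n))\<^sup>2 \<le> 1 / (fact n :: real)\<^sup>2"
          by (rule divide_left_mono) (simp_all del: fact_Suc)
        have nA: "norm (besselA k) = 1 / (fact k)\<^sup>2" for k
          by (simp add: besselA_def norm_divide norm_power)
        show ?thesis unfolding B_def norm_mult nA by (rule mult_right_mono[OF le]) simp
      qed
      moreover have "summable (\<lambda>n. norm (besselA n * z ^ n))"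
        by (rule entire_coeffs_norm[OF besselA_entire])
      ultimately show ?thesis
        using summable_comparison_test'[of "\<lambda>n. norm (besselA n * z ^ n)" 0 "\<lambda>n. B n * z ^ n"] by blast
    qed
    then show ?thesis by (simp add: entire_coeffs_def)
  qed
  have A1: "(\<Sum>n. besselA n * z ^ n) - 1 = z * (\<Sum>n. B n * z ^ n)" for z
  proof -
    have "(\<lambda>n. z * (B n * z ^ n)) sums (z * (\<Sum>n. B n * z ^ n))"
      using B by (intro sums_mult summable_sums) (simp add: entire_coeffs_def)
    also have "(\<lambda>n. z * (B n * z ^ n)) = (\<lambda>n. besselA (Suc n) * z ^ Suc n)" by (simp add: B_def mult_ac)
    finally have "(\<lambda>n. besselA n * z ^ n) sums (z * (\<Sum>n. B n * z ^ n) + 1)"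
      by (subst (asm) sums_Suc_iff) (simp add: besselA_def)
    then show ?thesis by (simp add: sums_iff)
  qed
  define e where "e r = besselK0 (of_real r) + Ln (of_real r / 2) + euler_mascheroni" for r
  have e: "(e \<longlongrightarrow> 0) (at_right 0)"
  proof (rule Lim_null_comparison)
    show "\<forall>\<^sub>F r in at_right 0. norm (e r) \<le> r"
      using eventually_at_right_less[of 0] by eventually_elim (auto simp: e_def intro!: besselK0_small)
  qed (rule tendsto_ident_at)
  have "((\<lambda>r::real. ln (r / 2) * (r\<^sup>2 / 4)) \<longlongrightarrow> 0) (at_right 0)" by real_asymp
  then have l: "((\<lambda>r. complex_of_real (ln (r / 2) * (r\<^sup>2 / 4))) \<longlongrightarrow> of_real 0) (at_right 0)" by (rule tendsto_of_real)
  have P0: "besselP 0 = - 2 * euler_mascheroni" by (simp add: besselP_def)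
  have "((\<lambda>r. 2 * e r - ((\<Sum>n. besselP n * q r ^ n) + 2 * euler_mascheroni) +
      2 * (of_real (ln (r / 2) * (r\<^sup>2 / 4)) * (\<Sum>n. B n * q r ^ n))) \<longlongrightarrow>
      2 * 0 - (besselP 0 + 2 * euler_mascheroni) + 2 * (of_real 0 * B 0)) (at_right 0)"
    by (intro tendsto_intros e l cont besselP_entire B)
  then have lim: "((\<lambda>r. 2 * e r - ((\<Sum>n. besselP n * q r ^ n) + 2 * euler_mascheroni) +
      2 * (of_real (ln (r / 2) * (r\<^sup>2 / 4)) * (\<Sum>n. B n * q r ^ n))) \<longlongrightarrow> 0) (at_right 0)"
    by (simp add: P0)
  show ?thesis
  proof (rule Lim_transform_eventually[OF lim])
    show "\<forall>\<^sub>F r in at_right 0. 2 * e r - ((\<Sum>n. besselP n * q r ^ n) + 2 * euler_mascheroni) +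
      2 * (of_real (ln (r / 2) * (r\<^sup>2 / 4)) * (\<Sum>n. B n * q r ^ n)) =
      2 * besselK0 (of_real r) - logser besselP besselA (of_real r)"
      using eventually_at_right_less[of 0]
    proof eventually_elim
      case (elim r)
      have Ln: "Ln (of_real r / 2) = complex_of_real (ln (r / 2))"
        using elim Ln_of_real[of "r / 2"] by simp
      have eq: "complex_of_real (ln (r / 2) * (r\<^sup>2 / 4)) * (\<Sum>n. B n * q r ^ n) = Ln (of_real r / 2) * ((\<Sum>n. besselA n * q r ^ n) - 1)"
        unfolding A1 Ln by (simp add: q_def)
      show ?case unfolding eq logser_def e_def q_def[symmetric] by (simp add: algebra_simps)
    qed
  qed
qed

lemma has_real_derivative_Re:
  assumes "(f has_field_derivative D) (at (complex_of_real r))"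
  shows "((\<lambda>r. Re (f (of_real r))) has_real_derivative Re D) (at r)"
  using has_vector_derivative_real_field[OF assms] bounded_linear.has_vector_derivative[OF bounded_linear_Re]
  unfolding has_real_derivative_iff_has_vector_derivative by blast

text \<open>The difference D of the two sides solves the same second-order equation as I_0, so their
  weighted Wronskian is a constant k and (D / I_0)' = 2 k / (y I_0^2). Since D tends to 0 at the
  origin, k = 0: otherwise D / I_0 would diverge logarithmically there. Hence D vanishes on (0, 1),
  and by the identity theorem on the half-plane.\<close>

lemma besselK0_series:
  assumes "Re y > 0"
  shows "2 * besselK0 y = logser besselP besselA y"
proof -
  let ?H = "{y. Re y > 0}"
  obtain K' where K: "\<And>y. Re y > 0 \<Longrightarrow> (besselK0 has_field_derivative K' y) (at y)"
    "\<And>y. Re y > 0 \<Longrightarrow> ((\<lambda>y. y * K' y) has_field_derivative y * besselK0 y) (at y)"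
    using besselK0_ode[OF assms] by metis
  define L where "L = logser besselP besselA"
  define L1 where "L1 = logser (\<lambda>n. of_nat n * besselP n - besselA n) (\<lambda>n. of_nat n * besselA n)"
  define I where "I = logser besselA (\<lambda>_. 0)"
  define I1 where "I1 = logser (\<lambda>n. of_nat n * besselA n - 0) (\<lambda>n. of_nat n * 0)"
  have z: "entire_coeffs (\<lambda>_. 0)" by (simp add: entire_coeffs_def)
  have L: "(L has_field_derivative (2 / y) * L1 y) (at y)" "(L1 has_field_derivative (2 / y) * (y\<^sup>2 / 4 * L y)) (at y)"
    if "Re y > 0" for y
    unfolding L_def L1_def
    by (intro logser_deriv logser_ode besselA_entire besselP_entire besselA_rec besselP_rec that)+
  have I: "(I has_field_derivative (2 / y) * I1 y) (at y)" "(I1 has_field_derivative (2 / y) * (y\<^sup>2 / 4 * I y)) (at y)"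
    if "Re y > 0" for y
    unfolding I_def I1_def
    by (intro logser_deriv logser_ode besselA_entire z that; simp add: besselA_rec del: of_nat_Suc)+
  define D where "D y = 2 * besselK0 y - L y" for y
  define D1 where "D1 y = y * K' y - L1 y" for y
  have D: "(D has_field_derivative (2 / y) * D1 y) (at y)" if "Re y > 0" for y
  proof -
    have "y \<noteq> 0" using that by auto
    have "(D has_field_derivative 2 * K' y - (2 / y) * L1 y) (at y)"
      unfolding D_def by (intro DERIV_diff DERIV_cmult K L that)
    also have "2 * K' y - (2 / y) * L1 y = (2 / y) * D1 y"
      using \<open>y \<noteq> 0\<close> by (simp add: D1_def field_simps)
    finally show ?thesis .
  qed
  have D1: "(D1 has_field_derivative (2 / y) * (y\<^sup>2 / 4 * D y)) (at y)" if "Re y > 0" for y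
  proof -
    have "y \<noteq> 0" using that by auto
    have "(D1 has_field_derivative y * besselK0 y - (2 / y) * (y\<^sup>2 / 4 * L y)) (at y)"
      unfolding D1_def by (intro DERIV_diff K L that)
    also have "y * besselK0 y - (2 / y) * (y\<^sup>2 / 4 * L y) = (2 / y) * (y\<^sup>2 / 4 * D y)"
      using \<open>y \<noteq> 0\<close> by (simp add: D_def field_simps power2_eq_square)
    finally show ?thesis .
  qed
  define W where "W y = D1 y * I y - D y * I1 y" for y
  have "(W has_field_derivative 0) (at y)" if "y \<in> ?H" for y
  proof -
    have y: "Re y > 0" using that by simp
    have "(W has_field_derivative (D1 y * ((2 / y) * I1 y) + (2 / y) * (y\<^sup>2 / 4 * D y) * I y) -
         (D y * ((2 / y) * (y\<^sup>2 / 4 * I y)) + (2 / y) * D1 y * I1 y)) (at y)"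
      unfolding W_def by (intro DERIV_diff DERIV_mult' D D1 I y)
    moreover have "(d1 * (c * i1) + c * (q * d) * i) - (d * (c * (q * i)) + c * d1 * i1) = 0" for c q d d1 i i1 :: complex
      by (simp add: algebra_simps)
    ultimately show ?thesis by (simp only:)
  qed
  from has_field_derivative_0_imp_constant_on[OF this connected_Re_gt open_halfspace_Re_gt]
  obtain k where "\<forall>y\<in>?H. W y = k" unfolding constant_on_def by blast
  then have k: "W y = k" if "Re y > 0" for y using that by simp
  have Ir: "\<exists>i. I (of_real r) = of_real i \<and> 1 \<le> i \<and> i \<le> exp 1" if r01: "0 < r" "r \<le> 1" for r
  proof -
    obtain i where "(\<Sum>n. besselA n * ((of_real r)\<^sup>2 / 4) ^ n) = of_real i" "1 \<le> i" "i \<le> exp 1"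
      using besselA_real_bounds[OF r01] by metis
    then show ?thesis unfolding I_def logser_def by (intro exI[of _ i]) simp
  qed
  have h': "((\<lambda>z. D z / I z) has_field_derivative (2 / z) * (k / (I z * I z))) (at z)"
    if "Re z > 0" "I z \<noteq> 0" for z
  proof -
    have "((\<lambda>z. D z / I z) has_field_derivative ((2 / z) * D1 z * I z - D z * ((2 / z) * I1 z)) / (I z * I z)) (at z)"
      by (intro DERIV_divide D I that)
    also have "(2 / z) * D1 z * I z - D z * ((2 / z) * I1 z) = (2 / z) * k"
      unfolding k[OF that(1), symmetric] W_def by (simp add: algebra_simps)
    also have "(2 / z) * k / (I z * I z) = (2 / z) * (k / (I z * I z))" by (rule times_divide_eq_right[symmetric])
    finally show ?thesis .
  qed
  have Dlim: "((\<lambda>r. D (of_real r)) \<longlongrightarrow> 0) (at_right 0)"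
    unfolding D_def L_def by (rule besselK0_minus_series_tendsto)
  have hlim: "((\<lambda>r. D (of_real r) / I (of_real r)) \<longlongrightarrow> 0) (at_right 0)"
  proof (rule Lim_null_comparison)
    show "((\<lambda>r. norm (D (of_real r))) \<longlongrightarrow> 0) (at_right 0)" using tendsto_norm[OF Dlim] by simp
    have "\<forall>\<^sub>F r in at_right (0::real). r < 1" by (rule eventually_at_rightI[of 0 1]) auto
    then show "\<forall>\<^sub>F r in at_right 0. norm (D (of_real r) / I (of_real r)) \<le> norm (D (of_real r))"
      using eventually_at_right_less[of 0]
    proof eventually_elim
      case (elim r)
      then obtain i where "I (of_real r) = of_real i" "1 \<le> i" using Ir[of r] by auto
      then show ?case using divide_left_mono[of 1 i "norm (D (of_real r))"] by (simp add: norm_divide)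
    qed
  qed
  have k0: "k = 0"
  proof (rule ccontr)
    assume "k \<noteq> 0"
    \<comment> \<open>Dividing by 2 k makes the derivative 1 / (r I_0(r)^2), real and at least c / r
      with c = 1 / e^2 because I_0 <= e on (0, 1]. Comparison with c ln r sends \<phi> to minus
      infinity at 0, against its limit 0.\<close>
    define \<phi> where "\<phi> r = Re (D (of_real r) / I (of_real r) / (2 * k))" for r
    define c where "c = 1 / (exp (1::real))\<^sup>2"
    have c: "c > 0" by (simp add: c_def)
    have phi': "\<exists>d. (\<phi> has_real_derivative d) (at r) \<and> d \<ge> c / r" if r: "0 < r" "r \<le> 1" for r
    proof -
      obtain i where i: "I (of_real r) = of_real i" "1 \<le> i" "i \<le> exp 1" using Ir[OF r] by auto
      have "((\<lambda>z. D z / I z / (2 * k)) has_field_derivative (2 / of_real r) * (k / (I (of_real r) * I (of_real r))) / (2 * k)) (at (of_real r))"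
        using r i by (intro DERIV_cdivide h') auto
      also have "(2 / of_real r) * (k / (I (of_real r) * I (of_real r))) / (2 * k) = of_real (1 / (r * i\<^sup>2))"
        using \<open>k \<noteq> 0\<close> by (simp add: i power2_eq_square)
      finally have "(\<phi> has_real_derivative Re (of_real (1 / (r * i\<^sup>2)))) (at r)"
        unfolding \<phi>_def by (rule has_real_derivative_Re)
      moreover have "c / r \<le> 1 / (r * i\<^sup>2)"
      proof -
        have "i\<^sup>2 \<le> (exp 1)\<^sup>2" using i by (intro power_mono) auto
        moreover have "i\<^sup>2 > 0" using i by simp
        ultimately have "1 / (exp 1)\<^sup>2 \<le> 1 / i\<^sup>2" by (intro divide_left_mono) auto
        then have "c / r \<le> 1 / i\<^sup>2 / r" unfolding c_def using r by (intro divide_right_mono) auto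
        then show ?thesis by (simp add: mult.commute)
      qed
      ultimately show ?thesis by (intro exI[of _ "1 / (r * i\<^sup>2)"]) auto
    qed
    have der: "\<exists>d. ((\<lambda>r. \<phi> r - c * ln r) has_real_derivative d) (at r) \<and> 0 \<le> d" if r: "0 < r" "r \<le> 1" for r
    proof -
      obtain d where "(\<phi> has_real_derivative d) (at r)" "d \<ge> c / r" using phi'[OF r] by blast
      moreover have "((\<lambda>r. c * ln r) has_real_derivative c * (1 / r)) (at r)"
        using r by (auto intro!: derivative_eq_intros)
      ultimately show ?thesis by (intro exI[of _ "d - c * (1 / r)"] conjI DERIV_diff) auto
    qed
    have le: "\<phi> r \<le> \<phi> 1 + c * ln r" if r: "0 < r" "r \<le> 1" for r
    proof -
      have "\<phi> r - c * ln r \<le> \<phi> 1 - c * ln 1"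
        by (rule DERIV_nonneg_imp_nondecreasing[OF r(2)]) (use der r in auto)
      then show ?thesis by simp
    qed
    have "((\<lambda>r. Re (D (of_real r) / I (of_real r) / (2 * k))) \<longlongrightarrow> Re (0 / (2 * k))) (at_right 0)"
      using \<open>k \<noteq> 0\<close> by (intro tendsto_intros hlim) auto
    then have "(\<phi> \<longlongrightarrow> 0) (at_right 0)" by (simp add: \<phi>_def[abs_def])
    then have e1: "\<forall>\<^sub>F r in at_right 0. \<phi> r > - 1" by (rule order_tendstoD) simp
    have "filterlim (\<lambda>r. \<phi> 1 + c * ln r) at_bot (at_right 0)"
      using c by real_asymp
    then have e2: "\<forall>\<^sub>F r in at_right 0. \<phi> 1 + c * ln r < - 1" by (simp add: filterlim_at_bot_dense)
    have e3: "\<forall>\<^sub>F r in at_right (0::real). r < 1" by (rule eventually_at_rightI[of 0 1]) auto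
    have "\<forall>\<^sub>F r in at_right (0::real). False"
      using e1 e2 e3 eventually_at_right_less[of 0]
    proof eventually_elim
      case (elim r) then show ?case using le[of r] by simp
    qed
    then show False by simp
  qed
  have zero: "D (of_real r) = 0" if r: "0 < r" "r < 1" for r
  proof -
    have "\<exists>c. \<forall>x\<in>{0<..<1}. D (of_real x) / I (of_real x) = c"
    proof (rule has_vector_derivative_zero_constant)
      show "convex {0<..<1::real}" by simp
      fix x :: real assume x: "x \<in> {0<..<1}"
      then obtain i where i: "I (of_real x) = of_real i" "1 \<le> i" using Ir[of x] by auto
      have "((\<lambda>z. D z / I z) has_field_derivative 0) (at (of_real x))"
        using h'[of "of_real x"] x i by (simp add: k0)
      from has_vector_derivative_real_field[OF this]
      show "((\<lambda>x. D (of_real x) / I (of_real x)) has_vector_derivative 0) (at x within {0<..<1})"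
        by (rule has_vector_derivative_at_within)
    qed blast
    then obtain c where c: "\<And>x. 0 < x \<Longrightarrow> x < 1 \<Longrightarrow> D (of_real x) / I (of_real x) = c" by auto
    have "\<forall>\<^sub>F x in at_right (0::real). D (of_real x) / I (of_real x) = c"
      by (rule eventually_at_rightI[of 0 1]) (auto intro: c)
    then have "((\<lambda>x. D (of_real x) / I (of_real x)) \<longlongrightarrow> c) (at_right 0)"
      by (rule tendsto_eventually)
    then have "c = 0" using hlim tendsto_unique[OF trivial_limit_at_right_real] by blast
    then show ?thesis using c[OF r] Ir[of r] r by auto
  qed
  have "D y = 0"
  proof (rule analytic_continuation[of D ?H "complex_of_real ` {0<..<1}" "of_real (1/2)"])
    show "D holomorphic_on ?H" using D open_halfspace_Re_gt[of 0] by (subst holomorphic_on_open) auto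
    show "complex_of_real (1/2) islimpt complex_of_real ` {0<..<1}"
      unfolding islimpt_sequential
    proof (intro exI conjI allI)
      fix n :: nat
      show "complex_of_real (1/2 + 1 / real (n + 3)) \<in> complex_of_real ` {0<..<1} - {of_real (1/2)}"
        by (auto simp del: of_real_add of_real_divide simp: of_real_eq_iff intro!: imageI)
           (simp_all add: field_simps)
    next
      have "(\<lambda>n. 1/2 + 1 / real (n + 3)) \<longlonglongrightarrow> (1/2 :: real)" by real_asymp
      then show "(\<lambda>n. complex_of_real (1/2 + 1 / real (n + 3))) \<longlonglongrightarrow> of_real (1/2)" by (rule tendsto_of_real)
    qed
  qed (use assms open_halfspace_Re_gt connected_Re_gt zero in auto)
  then show ?thesis by (simp add: D_def L_def)
qed

subsection \<open>Integral representation and decay\<close>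


lemma Ln_times_of_real_pos:
  "0 < t \<Longrightarrow> z \<noteq> 0 \<Longrightarrow> Ln (z * of_real t) = Ln z + of_real (ln t)"
  using Ln_times_of_real[of t z] by (simp add: mult.commute add.commute Ln_of_real)

text \<open>In the series of K_0 at y sqrt v the logarithm splits as 2 Ln (y sqrt v / 2) = 2 Ln (y /
  2) + ln v. Term by term there remain Beta integrals without and with ln v; the latter supply psi(s
  + n) - psi(c + n), by which the digamma part of \<open>coefP\<close> differs from that of
  \<open>besselP\<close>.\<close>

lemma besselFC_integral:
  assumes s: "Re s > 0" and c: "Re c > Re s" and y: "Re y > 0"
  shows "besselFC s c y = rGamma (c - s) *
     (\<integral>v. beta_weight s (c - s) v * (2 * besselK0 (y * of_real (sqrt v))) \<partial>unit_lborel)"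
proof -
  let ?M = unit_lborel
  define q where "q = y\<^sup>2 / 4"
  define l where "l = 2 * Ln (y / 2)"
  define w where "w = beta_weight s (c - s)"
  define g where "g n v = w v * of_real v ^ n * (q ^ n * (besselP n - (l + of_real (ln v)) * besselA n))" for n v
  have v01: "0 < v" "v < 1" if "v \<in> space ?M" for v using that by (auto simp: space_restrict_space)
  have cs: "Re (c - s) > 0" using c by simp
  have sn: "Re (s + of_nat n) > 0" for n using s by simp
  have gsum: "(\<lambda>n. g n v) sums (w v * (2 * besselK0 (y * of_real (sqrt v))))" if "v \<in> space ?M" for v
  proof -
    note v = v01[OF that]
    have Y: "Re (y * of_real (sqrt v)) > 0" using y v by simp
    have y0: "y \<noteq> 0" using y by auto
    have q2: "(y * of_real (sqrt v))\<^sup>2 / 4 = of_real v * q"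
      using v by (simp add: q_def power_mult_distrib flip: of_real_power)
    have Ln: "2 * Ln (y * of_real (sqrt v) / 2) = l + of_real (ln v)"
      using Ln_times_of_real_pos[of "sqrt v" "y / 2"] v y0 by (simp add: l_def ln_sqrt)
    have A: "(\<lambda>n. besselA n * (of_real v * q) ^ n) sums (\<Sum>n. besselA n * (of_real v * q) ^ n)"
      using besselA_entire by (intro summable_sums) (simp add: entire_coeffs_def)
    have P: "(\<lambda>n. besselP n * (of_real v * q) ^ n) sums (\<Sum>n. besselP n * (of_real v * q) ^ n)"
      using besselP_entire by (intro summable_sums) (simp add: entire_coeffs_def)
    have "(\<lambda>n. w v * (besselP n * (of_real v * q) ^ n - (l + of_real (ln v)) * (besselA n * (of_real v * q) ^ n)))
       sums (w v * (2 * besselK0 (y * of_real (sqrt v))))"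
      unfolding besselK0_series[OF Y] logser_def q2 Ln by (intro sums_mult sums_diff A P)
    then show ?thesis by (simp add: g_def power_mult_distrib algebra_simps)
  qed
  have gform: "g n v = q ^ n * (besselP n - l * besselA n) * beta_weight (s + of_nat n) (c - s) v -
      q ^ n * besselA n * (beta_weight (s + of_nat n) (c - s) v * of_real (ln v))" if "v \<in> space ?M" for n v
    unfolding g_def w_def beta_weight_shift[OF v01(1)[OF that]] by (simp add: algebra_simps)
  note bi = integrable_beta_weight[OF sn cs] has_integral_beta_weight_aux(4)[OF cs sn]
  have gint: "integrable ?M (g n)" for n
    by (subst Bochner_Integration.integrable_cong[OF refl gform])
       (intro Bochner_Integration.integrable_diff integrable_mult_right bi | assumption)+
  have gval: "(\<integral>v. g n v \<partial>?M) = q ^ n * (besselP n - l * besselA n) * Beta (s + of_nat n) (c - s) -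
      q ^ n * besselA n * (Beta (s + of_nat n) (c - s) * (Digamma (s + of_nat n) - Digamma (s + of_nat n + (c - s))))" for n
    by (subst Bochner_Integration.integral_cong[OF refl gform], assumption)
       (simp only: Bochner_Integration.integral_diff integrable_mult_right bi integral_mult_right_zero
        integral_beta_weight[OF sn cs] integral_beta_weight_ln[OF sn cs])
  define a where "a n = norm (besselP n * q ^ n) + norm l * norm (besselA n * q ^ n)" for n
  define b where "b n = norm (besselA n * q ^ n)" for n
  have sa: "summable a" unfolding a_def by (intro summable_add summable_mult entire_coeffs_norm besselP_entire besselA_entire)
  have sb: "summable b" unfolding b_def by (intro entire_coeffs_norm besselA_entire)
  have gb: "norm (g n v) \<le> a n * norm (w v) + b n * norm (w v * of_real (ln v))" if "v \<in> space ?M" for n v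
  proof -
    note v = v01[OF that]
    have e: "q ^ n * (besselP n - (l + of_real (ln v)) * besselA n) =
       besselP n * q ^ n - l * (besselA n * q ^ n) - of_real (ln v) * (besselA n * q ^ n)" by (simp add: algebra_simps)
    have "norm (q ^ n * (besselP n - (l + of_real (ln v)) * besselA n)) \<le> a n + norm (complex_of_real (ln v)) * b n"
      unfolding e a_def b_def
      by (rule order.trans[OF norm_triangle_ineq4] add_mono)+ (simp_all add: norm_mult)
    moreover have "norm (w v * of_real v ^ n) \<le> norm (w v)"
      using v by (simp add: norm_mult norm_power mult_left_le power_le_one)
    ultimately have "norm (g n v) \<le> norm (w v) * (a n + norm (complex_of_real (ln v)) * b n)"
      unfolding g_def norm_mult[of "w v * _"] by (intro mult_mono) auto
    then show ?thesis by (simp add: norm_mult algebra_simps)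
  qed
  have wi: "integrable ?M w" "integrable ?M (\<lambda>v. w v * of_real (ln v))"
    unfolding w_def by (intro integrable_beta_weight s cs) (rule has_integral_beta_weight_aux(4)[OF cs s])
  have "(\<lambda>n. \<integral>v. g n v \<partial>?M) sums (\<integral>v. (\<Sum>n. g n v) \<partial>?M)"
  proof (rule sums_integral_bounded(1))
    show "g n \<in> borel_measurable ?M" for n using gint[of n] by (rule borel_measurable_integrable)
    show "integrable ?M (\<lambda>v. norm (w v) + norm (w v * of_real (ln v)))"
      by (intro Bochner_Integration.integrable_add integrable_norm wi)
    show "summable (\<lambda>n. a n + b n)" by (intro summable_add sa sb)
    fix n v assume "v \<in> space ?M"
    from gb[OF this, of n] have "norm (g n v) \<le> a n * norm (w v) + b n * norm (w v * of_real (ln v))" .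
    also have "\<dots> \<le> (a n + b n) * norm (w v) + (a n + b n) * norm (w v * of_real (ln v))"
      by (intro add_mono mult_right_mono) (auto simp: a_def b_def)
    finally show "norm (g n v) \<le> (a n + b n) * (norm (w v) + norm (w v * of_real (ln v)))"
      by (simp only: distrib_left)
  qed
  also have "(\<integral>v. (\<Sum>n. g n v) \<partial>?M) = (\<integral>v. w v * (2 * besselK0 (y * of_real (sqrt v))) \<partial>?M)"
    by (intro Bochner_Integration.integral_cong[OF refl] sums_unique[symmetric] gsum)
  finally have "(\<lambda>n. rGamma (c - s) * (\<integral>v. g n v \<partial>?M)) sums (rGamma (c - s) * (\<integral>v. w v * (2 * besselK0 (y * of_real (sqrt v))) \<partial>?M))"
    by (rule sums_mult)
  moreover have "rGamma (c - s) * (\<integral>v. g n v \<partial>?M) = coefP s c n * q ^ n - l * (coefA s c n * q ^ n)" for n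
  proof -
    have cn: "c + of_nat n \<notin> \<int>\<^sub>\<le>\<^sub>0"
      using s c by (auto elim!: nonpos_Ints_cases simp: complex_eq_iff)
    have e: "s + of_nat n + (c - s) = c + of_nat n" by simp
    have B: "rGamma (c - s) * Beta (s + of_nat n) (c - s) = Gamma (s + of_nat n) * rGamma (c + of_nat n)"
    proof -
      have "rGamma (c - s) * Beta (s + of_nat n) (c - s) = (rGamma (c - s) * Gamma (c - s)) * (Gamma (s + of_nat n) * rGamma (c + of_nat n))"
        by (simp add: Beta_altdef e)
      then show ?thesis using rGamma_mult_Gamma_pos[OF cs] by simp
    qed
    have "rGamma (c - s) * (\<integral>v. g n v \<partial>?M) = q ^ n * (rGamma (c - s) * Beta (s + of_nat n) (c - s)) *
       (besselP n - l * besselA n - besselA n * (Digamma (s + of_nat n) - Digamma (c + of_nat n)))"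
      unfolding gval e by (simp add: algebra_simps)
    also have "\<dots> = coefP s c n * q ^ n - l * (coefA s c n * q ^ n)"
      unfolding B coefP_def coefA_def deriv_rGamma_eq[OF cn] besselP_def besselA_def
      by (simp add: algebra_simps diff_divide_distrib add_divide_distrib)
    finally show ?thesis .
  qed
  ultimately have 1: "(\<lambda>n. coefP s c n * q ^ n - l * (coefA s c n * q ^ n)) sums
     (rGamma (c - s) * (\<integral>v. w v * (2 * besselK0 (y * of_real (sqrt v))) \<partial>?M))" by simp
  have "(\<lambda>n. coefP s c n * q ^ n - l * (coefA s c n * q ^ n)) sums besselFC s c y"
    unfolding besselFC_def logser_def q_def[symmetric] l_def[symmetric]
    using entire_coeffs_coef[OF s, of c] by (intro sums_diff sums_mult summable_sums) (auto simp: entire_coeffs_def)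
  from sums_unique2[OF this 1] show ?thesis by (simp add: w_def)
qed

lemma norm_beta_weight_powr_shift:
  assumes "0 < v" "v < 1"
  shows "norm (beta_weight s b v) * v powr (- \<sigma>) = norm (beta_weight (s - of_real \<sigma>) b v)"
  using assms by (simp add: norm_beta_weight powr_add[symmetric] algebra_simps)

section \<open>Decay in sectors\<close>

text \<open>The sector Re y >= \<epsilon> |y| allows |y| in place of Re y in the bound for K_0.
  Decay of order 2 \<sigma> costs v^(-\<sigma>), which v^(s-1) tolerates as \<sigma> < Re s, and Re
  c >= Re s + 1 removes the singularity at v = 1.\<close>

lemma besselFC_bound_base:
  assumes \<sigma>: "0 < \<sigma>" "\<sigma> < Re s" and \<epsilon>: "0 < \<epsilon>"
  obtains C where "C \<ge> 0" "\<And>c y. norm c \<le> R \<Longrightarrow> Re c \<ge> Re s + 1 \<Longrightarrow> Re y > 0 \<Longrightarrow> Re y \<ge> \<epsilon> * norm y \<Longrightarrow>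
     norm (besselFC s c y) \<le> C * norm y powr (- 2 * \<sigma>)"
proof -
  let ?M = unit_lborel
  have s: "Re s > 0" using \<sigma> by simp
  have "bounded (rGamma ` cball (0::complex) (R + norm s))"
    by (intro compact_imp_bounded compact_continuous_image continuous_intros) auto
  then obtain B where B: "\<And>w. norm (w::complex) \<le> R + norm s \<Longrightarrow> norm (rGamma w) \<le> B"
    by (fastforce simp: bounded_iff)
  define D where "D = (2 * (2 * \<sigma>)) powr (2 * \<sigma>) / (2 * \<sigma>)"
  have D: "D \<ge> 0" using \<sigma> by (simp add: D_def)
  define J where "J = (\<integral>v. norm (beta_weight (s - of_real \<sigma>) 1 v) \<partial>?M)"
  have ij: "integrable ?M (\<lambda>v. norm (beta_weight (s - of_real \<sigma>) 1 v))"
    using \<sigma> by (intro integrable_beta_weight_norm) auto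
  have J: "J \<ge> 0" unfolding J_def by (rule integral_nonneg_AE) simp
  define C where "C = \<bar>B\<bar> * (2 * D * \<epsilon> powr (- 2 * \<sigma>) * J)"
  have "norm (besselFC s c y) \<le> C * norm y powr (- 2 * \<sigma>)"
    if c: "norm c \<le> R" "Re c \<ge> Re s + 1" and y: "Re y > 0" "Re y \<ge> \<epsilon> * norm y" for c y
  proof -
    have y0: "norm y > 0" using y by auto
    have nb: "norm (beta_weight s (c - s) v * (2 * besselK0 (y * of_real (sqrt v))))
       \<le> 2 * D * \<epsilon> powr (- 2 * \<sigma>) * norm y powr (- 2 * \<sigma>) * norm (beta_weight (s - of_real \<sigma>) 1 v)"
      if "v \<in> space ?M" for v
    proof -
      have v: "0 < v" "v < 1" using that by (auto simp: space_restrict_space)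
      have "norm (besselK0 (y * of_real (sqrt v))) \<le> D * (Re (y * of_real (sqrt v))) powr (- (2 * \<sigma>))"
        unfolding D_def using y v \<sigma> by (intro besselK0_bound) auto
      also have "\<dots> \<le> D * (\<epsilon> * norm y * sqrt v) powr (- (2 * \<sigma>))"
        using y v \<sigma> \<epsilon> y0 D by (intro mult_left_mono powr_mono2') auto
      also have "(\<epsilon> * norm y * sqrt v) powr (- (2 * \<sigma>)) = \<epsilon> powr (- 2 * \<sigma>) * norm y powr (- 2 * \<sigma>) * v powr (- \<sigma>)"
        using v \<epsilon> y0 by (simp add: powr_mult powr_half_sqrt[symmetric] powr_powr)
      finally have 1: "norm (besselK0 (y * of_real (sqrt v))) \<le> D * (\<epsilon> powr (- 2 * \<sigma>) * norm y powr (- 2 * \<sigma>) * v powr (- \<sigma>))" .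
      have "norm (beta_weight s (c - s) v) \<le> norm (beta_weight s 1 v)"
        using v c by (intro norm_beta_weight_mono) auto
      then have "norm (beta_weight s (c - s) v) * (2 * norm (besselK0 (y * of_real (sqrt v)))) \<le>
        norm (beta_weight s 1 v) * (2 * (D * (\<epsilon> powr (- 2 * \<sigma>) * norm y powr (- 2 * \<sigma>) * v powr (- \<sigma>))))"
        using 1 by (intro mult_mono) auto
      also have "\<dots> = 2 * D * \<epsilon> powr (- 2 * \<sigma>) * norm y powr (- 2 * \<sigma>) * (norm (beta_weight s 1 v) * v powr (- \<sigma>))"
        by (simp add: mult_ac)
      finally show ?thesis unfolding norm_beta_weight_powr_shift[OF v] by (simp add: norm_mult)
    qed
    have "norm (\<integral>v. beta_weight s (c - s) v * (2 * besselK0 (y * of_real (sqrt v))) \<partial>?M) \<le>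
       (\<integral>v. 2 * D * \<epsilon> powr (- 2 * \<sigma>) * norm y powr (- 2 * \<sigma>) * norm (beta_weight (s - of_real \<sigma>) 1 v) \<partial>?M)"
      using D by (intro order.trans[OF integral_norm_bound] integral_mono' integrable_mult_right ij nb) auto
    also have "\<dots> = 2 * D * \<epsilon> powr (- 2 * \<sigma>) * norm y powr (- 2 * \<sigma>) * J" by (simp add: J_def)
    finally have "norm (\<integral>v. beta_weight s (c - s) v * (2 * besselK0 (y * of_real (sqrt v))) \<partial>?M) \<le> \<dots>" .
    moreover have "norm (rGamma (c - s)) \<le> \<bar>B\<bar>"
      using B[of "c - s"] c norm_triangle_ineq4[of c s] by (smt (verit))
    ultimately have "norm (besselFC s c y) \<le> \<bar>B\<bar> * (2 * D * \<epsilon> powr (- 2 * \<sigma>) * norm y powr (- 2 * \<sigma>) * J)"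
      using besselFC_integral[OF s _ y(1), of c] c by (simp add: norm_mult mult_mono)
    then show ?thesis by (simp add: C_def mult_ac)
  qed
  moreover have "C \<ge> 0" using D J by (simp add: C_def)
  ultimately show ?thesis by (rule that[rotated])
qed

text \<open>Each step lowers c by \<open>besselFC_rec\<close>. Cauchy's inequality on a disc of
  radius proportional to |y| makes y times the derivative decay like the function itself. The disc
  may leave the sector and c + 1 the ball of radius R, hence the generalisation over \<epsilon> and
  R in the induction.\<close>

lemma besselFC_bound:
  assumes \<sigma>: "0 < \<sigma>" "\<sigma> < Re s"
  shows "0 < \<epsilon> \<Longrightarrow> \<epsilon> \<le> 1 \<Longrightarrow> \<exists>C\<ge>0. \<forall>c y. norm c \<le> R \<longrightarrow> Re c \<ge> Re s + 1 - real k \<longrightarrow> Re y > 0 \<longrightarrow> Re y \<ge> \<epsilon> * norm y \<longrightarrow>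
     norm (besselFC s c y) \<le> C * norm y powr (- 2 * \<sigma>)"
proof (induction k arbitrary: \<epsilon> R)
  case 0
  obtain C where C: "C \<ge> 0" "\<forall>c y. norm c \<le> R \<longrightarrow> Re c \<ge> Re s + 1 \<longrightarrow> Re y > 0 \<longrightarrow> Re y \<ge> \<epsilon> * norm y \<longrightarrow>
     norm (besselFC s c y) \<le> C * norm y powr (- 2 * \<sigma>)"
    using besselFC_bound_base[OF \<sigma> 0(1), of R] by metis
  then show ?case by (intro exI[of _ C]) simp
next
  case (Suc k)
  have s: "Re s > 0" using \<sigma> by simp
  have "0 < \<epsilon> / 4" "\<epsilon> / 4 \<le> 1" using Suc.prems by auto
  from Suc.IH[OF this, of "R + 1"] obtain C where C: "C \<ge> 0"
    "\<forall>c y. norm c \<le> R + 1 \<longrightarrow> Re c \<ge> Re s + 1 - real k \<longrightarrow> Re y > 0 \<longrightarrow> Re y \<ge> \<epsilon> / 4 * norm y \<longrightarrow>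
     norm (besselFC s c y) \<le> C * norm y powr (- 2 * \<sigma>)" by blast
  define C' where "C' = \<bar>R\<bar> * C + C * 2 powr (2 * \<sigma>) / \<epsilon>"
  have C'0: "C' \<ge> 0" using C Suc.prems by (simp add: C'_def)
  have "norm (besselFC s c y) \<le> C' * norm y powr (- 2 * \<sigma>)"
    if c: "norm c \<le> R" "Re c \<ge> Re s + 1 - real (Suc k)" and y: "Re y > 0" "Re y \<ge> \<epsilon> * norm y" for c y
  proof -
    have y0: "norm y > 0" using y by auto
    have c1: "norm (c + 1) \<le> R + 1" "Re (c + 1) \<ge> Re s + 1 - real k"
      using c norm_triangle_ineq[of c 1] by auto
    \<comment> \<open>With this radius Re u >= \<epsilon> |y| / 2 and |u| <= 2 |y| on the disc, so
      the disc lies in the sector belonging to \<epsilon> / 4.\<close>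
    define r where "r = \<epsilon> * norm y / 2"
    have r: "r > 0" using Suc.prems y0 by (simp add: r_def)
    have near: "Re u > 0" "Re u \<ge> \<epsilon> / 4 * norm u" "norm u \<ge> norm y / 2" if u: "u \<in> cball y r" for u
    proof -
      have d: "norm (y - u) \<le> r" using u by (simp add: dist_norm)
      have "Re (y - u) \<le> r" using complex_Re_le_cmod[of "y - u"] d by linarith
      then have R1: "Re u \<ge> \<epsilon> * norm y / 2" using y by (simp add: r_def)
      moreover have "\<epsilon> * norm y > 0" using Suc.prems y0 by simp
      ultimately show "Re u > 0" by linarith
      have rle: "r \<le> norm y / 2" unfolding r_def using Suc.prems y0 by simp
      have "norm u \<le> norm y + norm (y - u)" using norm_triangle_ineq4[of y "y - u"] by simp
      then have "norm u \<le> 2 * norm y" using d rle y0 by linarith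
      then have "\<epsilon> / 4 * norm u \<le> \<epsilon> / 4 * (2 * norm y)" using Suc.prems by (intro mult_left_mono) auto
      then show "Re u \<ge> \<epsilon> / 4 * norm u" using R1 by simp
      have "norm y \<le> norm u + norm (y - u)" using norm_triangle_ineq[of u "y - u"] by simp
      then show "norm u \<ge> norm y / 2" using d rle by linarith
    qed
    have ub: "norm (besselFC s (c + 1) u) \<le> C * (2 powr (2 * \<sigma>) * norm y powr (- 2 * \<sigma>))" if u: "u \<in> cball y r" for u
    proof -
      have "norm (besselFC s (c + 1) u) \<le> C * norm u powr (- 2 * \<sigma>)"
        using C(2) c1 near[OF u] by blast
      also have "\<dots> \<le> C * (norm y / 2) powr (- 2 * \<sigma>)"
        using C(1) near[OF u] y0 \<sigma> by (intro mult_left_mono powr_mono2') auto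
      also have "(norm y / 2) powr (- 2 * \<sigma>) = 2 powr (2 * \<sigma>) * norm y powr (- 2 * \<sigma>)"
        using y0 by (simp add: powr_divide powr_minus field_simps)
      finally show ?thesis .
    qed
    have "norm ((deriv ^^ 1) (besselFC s (c + 1)) y) \<le> fact 1 * (C * (2 powr (2 * \<sigma>) * norm y powr (- 2 * \<sigma>))) / r ^ 1"
    proof (rule Cauchy_inequality)
      have sub: "cball y r \<subseteq> {y. Re y > 0}" using near by auto
      then show "besselFC s (c + 1) holomorphic_on ball y r"
        by (rule holomorphic_on_subset[OF besselFC_holomorphic[OF s] order.trans[OF ball_subset_cball]])
      show "continuous_on (cball y r) (besselFC s (c + 1))"
        using continuous_on_subset[OF holomorphic_on_imp_continuous_on[OF besselFC_holomorphic[OF s]] sub] .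
      show "0 < r" by (rule r)
      show "norm (besselFC s (c + 1) u) \<le> C * (2 powr (2 * \<sigma>) * norm y powr (- 2 * \<sigma>))" if "norm (y - u) = r" for u
        using ub[of u] that by (simp add: dist_norm)
    qed
    then have d: "norm (deriv (besselFC s (c + 1)) y) \<le> C * (2 powr (2 * \<sigma>) * norm y powr (- 2 * \<sigma>)) / r" by simp
    have "norm (y / 2 * deriv (besselFC s (c + 1)) y) \<le> norm y / 2 * (C * (2 powr (2 * \<sigma>) * norm y powr (- 2 * \<sigma>)) / r)"
      unfolding norm_mult using d by (intro mult_mono) auto
    also have "\<dots> = C * 2 powr (2 * \<sigma>) / \<epsilon> * norm y powr (- 2 * \<sigma>)"
      using y0 Suc.prems by (simp add: r_def)
    finally have 1: "norm (y / 2 * deriv (besselFC s (c + 1)) y) \<le> C * 2 powr (2 * \<sigma>) / \<epsilon> * norm y powr (- 2 * \<sigma>)" .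
    have "\<epsilon> / 4 * norm y \<le> \<epsilon> * norm y" using Suc.prems y0 by simp
    then have "norm (besselFC s (c + 1) y) \<le> C * norm y powr (- 2 * \<sigma>)"
      using C(2) c1 y by (meson order_trans)
    then have "norm c * norm (besselFC s (c + 1) y) \<le> \<bar>R\<bar> * (C * norm y powr (- 2 * \<sigma>))"
      using c by (intro mult_mono) auto
    then have 2: "norm (c * besselFC s (c + 1) y) \<le> \<bar>R\<bar> * C * norm y powr (- 2 * \<sigma>)"
      by (simp add: norm_mult mult.assoc)
    have "norm (besselFC s c y) \<le> norm (c * besselFC s (c + 1) y) + norm (y / 2 * deriv (besselFC s (c + 1)) y)"
      unfolding besselFC_rec[OF s y(1), of c] by (rule norm_triangle_ineq)
    also have "\<dots> \<le> C' * norm y powr (- 2 * \<sigma>)" using add_mono[OF 2 1] unfolding C'_def distrib_right .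
    finally show ?thesis .
  qed
  then show ?case using C'0 by (intro exI[of _ C']) blast
qed

lemma besselFC_sum_holomorphic:
  assumes s: "Re s > 1 / 2" and x: "Re x > 0"
  shows "(\<lambda>c. \<Sum>n. besselFC s c (of_nat (Suc n) * x)) holomorphic_on UNIV"
    and "summable (\<lambda>n. norm (besselFC s c (of_nat (Suc n) * x)))"
proof -
  \<comment> \<open>The midpoint of 1/2 and Re s: 2 \<sigma> > 1 gives convergence over n, \<sigma>
    < Re s the decay bound. All points n x lie on one ray, so a single sector contains them.\<close>
  define \<sigma> where "\<sigma> = (Re s + 1 / 2) / 2"
  have \<sigma>: "0 < \<sigma>" "\<sigma> < Re s" "2 * \<sigma> > 1" using s by (auto simp: \<sigma>_def)
  have s0: "Re s > 0" using s by simp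
  have x0: "norm x > 0" using x by auto
  define \<epsilon> where "\<epsilon> = Re x / norm x"
  have \<epsilon>: "0 < \<epsilon>" "\<epsilon> \<le> 1" using x x0 complex_Re_le_cmod[of x] by (auto simp: \<epsilon>_def)
  have bd: "\<exists>d h. 0 < d \<and> summable h \<and> (\<forall>n. \<forall>c\<in>ball c0 d \<inter> UNIV. norm (besselFC s c (of_nat (Suc n) * x)) \<le> h n)" for c0
  proof -
    define R where "R = norm c0 + 1"
    \<comment> \<open>So large that norm c <= R forces Re c >= Re s + 1 - k.\<close>
    define k where "k = nat \<lceil>Re s + 1 + R\<rceil>"
    obtain C where C: "\<forall>c y. norm c \<le> R \<longrightarrow> Re c \<ge> Re s + 1 - real k \<longrightarrow> Re y > 0 \<longrightarrow> Re y \<ge> \<epsilon> * norm y \<longrightarrow>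
       norm (besselFC s c y) \<le> C * norm y powr (- 2 * \<sigma>)"
      using besselFC_bound[OF \<sigma>(1,2) \<epsilon>, of R k] by blast
    show ?thesis
    proof (intro exI conjI allI ballI)
      show "summable (\<lambda>n. C * norm x powr (- 2 * \<sigma>) * real (Suc n) powr (- (2 * \<sigma>)))"
        by (intro summable_mult summable_inverse_Suc_powr \<sigma>)
      fix n c assume "c \<in> ball c0 1 \<inter> UNIV"
      then have c: "norm c \<le> R" using norm_triangle_ineq2[of c c0] by (simp add: R_def dist_norm norm_minus_commute)
      have k: "Re c \<ge> Re s + 1 - real k" using abs_Re_le_cmod[of c] c unfolding k_def by linarith
      have "Re (of_nat (Suc n) * x) \<ge> \<epsilon> * norm (of_nat (Suc n) * x)" "Re (of_nat (Suc n) * x) > 0"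
        using x x0 by (simp_all add: \<epsilon>_def norm_mult del: of_nat_Suc)
      then have "norm (besselFC s c (of_nat (Suc n) * x)) \<le> C * norm (of_nat (Suc n) * x) powr (- 2 * \<sigma>)"
        using C c k by blast
      also have "norm (of_nat (Suc n) * x) powr (- 2 * \<sigma>) = norm x powr (- 2 * \<sigma>) * real (Suc n) powr (- (2 * \<sigma>))"
        using x0 by (simp add: norm_mult powr_mult mult.commute del: of_nat_Suc)
      finally show "norm (besselFC s c (of_nat (Suc n) * x)) \<le> C * norm x powr (- 2 * \<sigma>) * real (Suc n) powr (- (2 * \<sigma>))"
        by (simp only: mult.assoc)
    qed simp
  qed
  note h = holomorphic_on_series[OF open_UNIV besselFC_holomorphic_c[OF s0] bd]
  show "(\<lambda>c. \<Sum>n. besselFC s c (of_nat (Suc n) * x)) holomorphic_on UNIV" by (rule h(1))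
  show "summable (\<lambda>n. norm (besselFC s c (of_nat (Suc n) * x)))" using h(2)[of c] by simp
qed

subsection \<open>The summation formula\<close>


definition hyp_corr :: "complex \<Rightarrow> complex \<Rightarrow> nat \<Rightarrow> complex \<Rightarrow> complex" where
  "hyp_corr s x n c = 1 / of_nat (Suc n) *
     (half2F1 s c (- (of_real (1 / (4 * pi\<^sup>2 * (real (Suc n))\<^sup>2)) * x\<^sup>2)) - rGamma c)"

lemma xi_slit:
  assumes "Re x > 0" "t \<ge> 0" shows "- (of_real t * x\<^sup>2) \<in> slit_plane"
  using one_plus_square_facts(2)[OF assms] by (simp add: slit_plane_def)

text \<open>For large n the argument is of order n^(-2), and \<open>half2F1_diff_bound\<close> makes
  the term of order n^(-3); the finitely many others are bounded on a compact disc.\<close>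

lemma hyp_corr_sum_holomorphic:
  assumes x: "Re x > 0"
  shows "(\<lambda>c. \<Sum>n. hyp_corr s x n c) holomorphic_on UNIV"
    and "summable (\<lambda>n. norm (hyp_corr s x n c))"
proof -
  define t where "t n = 1 / (4 * pi\<^sup>2 * (real (Suc n))\<^sup>2)" for n
  have t: "t n \<ge> 0" for n by (simp add: t_def)
  have hol: "hyp_corr s x n holomorphic_on UNIV" for n
    unfolding hyp_corr_def t_def[symmetric]
    by (intro holomorphic_intros half2F1_holomorphic_c xi_slit x t)
  have bd: "\<exists>d h. 0 < d \<and> summable h \<and> (\<forall>n. \<forall>c\<in>ball c0 d \<inter> UNIV. norm (hyp_corr s x n c) \<le> h n)" for c0
  proof -
    obtain C \<rho> where C: "C \<ge> 0" "\<rho> > 0"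
      "\<forall>c \<xi>. norm c \<le> norm c0 + 1 \<longrightarrow> norm \<xi> \<le> \<rho> \<longrightarrow> norm (half2F1 s c \<xi> - rGamma c) \<le> C * norm \<xi>"
      using half2F1_diff_bound[of "norm c0 + 1" s] by metis
    have nt: "norm (- (of_real (t n) * x\<^sup>2)) = t n * (norm x)\<^sup>2" for n
      using t[of n] by (simp add: norm_mult norm_power)
    have "(\<lambda>n. t n * (norm x)\<^sup>2) \<longlonglongrightarrow> 0" unfolding t_def by real_asymp
    then have "\<forall>\<^sub>F n in sequentially. t n * (norm x)\<^sup>2 < \<rho>" using C(2) by (rule order_tendstoD)
    then obtain N where N: "\<And>n. n \<ge> N \<Longrightarrow> t n * (norm x)\<^sup>2 < \<rho>" by (auto simp: eventually_sequentially)
    have bn: "\<exists>B. \<forall>c\<in>cball c0 1. norm (hyp_corr s x n c) \<le> B" for n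
    proof -
      have "bounded (hyp_corr s x n ` cball c0 1)"
        by (intro compact_imp_bounded compact_continuous_image continuous_on_subset[OF holomorphic_on_imp_continuous_on[OF hol]]) auto
      then show ?thesis by (auto simp: bounded_iff)
    qed
    then obtain B where B: "\<And>n c. c \<in> cball c0 1 \<Longrightarrow> norm (hyp_corr s x n c) \<le> B n" by metis
    define h where "h n = (if n < N then B n else C * (norm x)\<^sup>2 * real (Suc n) powr (- 3))" for n
    have sh: "summable h"
    proof (rule summable_cong[THEN iffD1])
      show "summable (\<lambda>n. C * (norm x)\<^sup>2 * real (Suc n) powr (- 3))"
        by (intro summable_mult summable_inverse_Suc_powr) simp
      show "\<forall>\<^sub>F n in sequentially. C * (norm x)\<^sup>2 * real (Suc n) powr (- 3) = h n"
        using eventually_ge_at_top[of N] by eventually_elim (simp add: h_def)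
    qed
    have "norm (hyp_corr s x n c) \<le> h n" if c: "c \<in> ball c0 1" for n c
    proof (cases "n < N")
      case True then show ?thesis using B[of c n] c by (simp add: h_def)
    next
      case False
      have nc: "norm c \<le> norm c0 + 1" using c norm_triangle_ineq2[of c c0] by (simp add: dist_norm norm_minus_commute)
      have "4 * pi\<^sup>2 \<ge> 1 * 1\<^sup>2" using pi_gt3 by (intro mult_mono power_mono) auto
      then have t1: "t n \<le> 1 / (1 * (real (Suc n))\<^sup>2)" unfolding t_def
        by (intro divide_left_mono mult_right_mono mult_pos_pos) auto
      have "norm (hyp_corr s x n c) = 1 / real (Suc n) * norm (half2F1 s c (- (of_real (t n) * x\<^sup>2)) - rGamma c)"
        unfolding hyp_corr_def t_def[symmetric] norm_mult norm_divide norm_one norm_of_nat ..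
      also have "\<dots> \<le> 1 / real (Suc n) * (C * norm (- (of_real (t n) * x\<^sup>2)))"
      proof (rule mult_left_mono)
        have "norm (- (of_real (t n) * x\<^sup>2)) \<le> \<rho>" unfolding nt using N[of n] False by simp
        then show "norm (half2F1 s c (- (of_real (t n) * x\<^sup>2)) - rGamma c) \<le> C * norm (- (of_real (t n) * x\<^sup>2))"
          using C(3) nc by blast
      qed simp
      also have "\<dots> \<le> 1 / real (Suc n) * (C * ((1 / (1 * (real (Suc n))\<^sup>2)) * (norm x)\<^sup>2))"
        unfolding nt using C(1) by (intro mult_left_mono mult_right_mono t1) auto
      also have "\<dots> = C * (norm x)\<^sup>2 * real (Suc n) powr (- 3)"
        by (simp add: powr_minus divide_inverse power3_eq_cube power2_eq_square)
      finally show ?thesis using False by (simp add: h_def)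
    qed
    then show ?thesis using sh by (intro exI[of _ 1] exI[of _ h]) auto
  qed
  note h = holomorphic_on_series[OF open_UNIV hol bd]
  show "(\<lambda>c. \<Sum>n. hyp_corr s x n c) holomorphic_on UNIV" by (rule h(1))
  show "summable (\<lambda>n. norm (hyp_corr s x n c))" using h(2)[of c] by simp
qed

text \<open>The classical formula at x sqrt v, integrated against the weight. The term pi / (x sqrt
  v) lowers the exponent s by 1/2, which needs Re s > 1/2; half of ln v gives half of the digamma
  difference; the corrections become Euler integrals with power -1/2 minus plain Beta
  integrals.\<close>

lemma besselFC_sum_base:
  assumes s: "Re s > 1 / 2" and c: "Re c > Re s" and x: "Re x > 0"
  shows "(\<Sum>n. besselFC s c (of_nat (Suc n) * x)) =
     of_real pi / x * (Gamma (s - 1/2) * rGamma (c - 1/2)) +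
     Gamma s * (rGamma c * (euler_mascheroni + Ln (x / (4 * of_real pi))) + (rGamma c * Digamma s + deriv rGamma c) / 2) +
     Gamma s * (\<Sum>n. hyp_corr s x n c)"
proof -
  let ?M = unit_lborel
  have s0: "Re s > 0" using s by simp
  have cs: "Re (c - s) > 0" using c by simp
  define \<sigma> where "\<sigma> = (Re s + 1 / 2) / 2"
  have \<sigma>: "0 < \<sigma>" "\<sigma> < Re s" "2 * \<sigma> > 1" using s by (auto simp: \<sigma>_def)
  define w where "w = beta_weight s (c - s)"
  define \<kappa> where "\<kappa> = rGamma (c - s)"
  define X where "X v = x * of_real (sqrt v)" for v
  have v01: "0 < v" "v < 1" if "v \<in> space ?M" for v using that by (auto simp: space_restrict_space)
  have X: "Re (X v) > 0" if "v \<in> space ?M" for v using x v01[OF that] by (simp add: X_def)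
  have contX: "continuous_on {0<..<1} X" unfolding X_def by (intro continuous_intros)
  have contw: "continuous_on {0<..<1} w" unfolding w_def by (rule continuous_beta_weight)
  have K: "(\<lambda>n. \<integral>v. w v * (2 * besselK0 (of_nat (Suc n) * X v)) \<partial>?M) sums (\<integral>v. (\<Sum>n. w v * (2 * besselK0 (of_nat (Suc n) * X v))) \<partial>?M)"
  proof (rule sums_integral_bounded(1))
    define D where "D = 2 * ((2 * (2 * \<sigma>)) powr (2 * \<sigma>) / (2 * \<sigma>)) * Re x powr (- (2 * \<sigma>))"
    show "integrable ?M (\<lambda>v. norm (beta_weight (s - of_real \<sigma>) (c - s) v))"
      using \<sigma> cs by (intro integrable_beta_weight_norm) auto
    show "summable (\<lambda>n. D * real (Suc n) powr (- (2 * \<sigma>)))"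
      by (intro summable_mult summable_inverse_Suc_powr \<sigma>)
    fix n
    have "continuous_on {0<..<1} (\<lambda>v. besselK0 (of_nat (Suc n) * X v))"
    proof (rule continuous_on_compose2[OF holomorphic_on_imp_continuous_on[OF holomorphic_besselK0_aux(1)]])
      show "continuous_on {0<..<1} (\<lambda>v. of_nat (Suc n) * X v)" by (intro continuous_intros contX)
      show "(\<lambda>v. of_nat (Suc n) * X v) ` {0<..<1} \<subseteq> {y. Re y > 0}"
        using X by (auto simp: space_restrict_space simp del: of_nat_Suc)
    qed
    then show "(\<lambda>v. w v * (2 * besselK0 (of_nat (Suc n) * X v))) \<in> borel_measurable ?M"
      by (intro measurable_unit_lborel continuous_intros contw)
    fix v assume v: "v \<in> space ?M"
    note v' = v01[OF v]
    have "norm (besselK0 (of_nat (Suc n) * X v)) \<le> (2 * (2 * \<sigma>)) powr (2 * \<sigma>) / (2 * \<sigma>) * Re (of_nat (Suc n) * X v) powr (- (2 * \<sigma>))"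
      using X[OF v] \<sigma> by (intro besselK0_bound) (simp_all del: of_nat_Suc)
    also have "Re (of_nat (Suc n) * X v) = real (Suc n) * (Re x * sqrt v)" by (simp add: X_def del: of_nat_Suc)
    also have "(real (Suc n) * (Re x * sqrt v)) powr (- (2 * \<sigma>)) = real (Suc n) powr (- (2 * \<sigma>)) * (Re x powr (- (2 * \<sigma>)) * v powr (- \<sigma>))"
      using x v' by (simp add: powr_mult powr_half_sqrt[symmetric] powr_powr del: of_nat_Suc)
    finally have "norm (w v) * (2 * norm (besselK0 (of_nat (Suc n) * X v))) \<le>
      norm (w v) * (2 * ((2 * (2 * \<sigma>)) powr (2 * \<sigma>) / (2 * \<sigma>) * (real (Suc n) powr (- (2 * \<sigma>)) * (Re x powr (- (2 * \<sigma>)) * v powr (- \<sigma>)))))"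
      by (intro mult_left_mono) auto
    also have "\<dots> = D * real (Suc n) powr (- (2 * \<sigma>)) * (norm (w v) * v powr (- \<sigma>))" by (simp add: D_def mult_ac)
    also have "norm (w v) * v powr (- \<sigma>) = norm (beta_weight (s - of_real \<sigma>) (c - s) v)"
      unfolding w_def by (rule norm_beta_weight_powr_shift[OF v'])
    finally show "norm (w v * (2 * besselK0 (of_nat (Suc n) * X v))) \<le> D * real (Suc n) powr (- (2 * \<sigma>)) * norm (beta_weight (s - of_real \<sigma>) (c - s) v)"
      by (simp add: norm_mult)
  qed
  have cmeas: "(\<lambda>v. w v * besselK0_corr n (X v)) \<in> borel_measurable ?M" for n
  proof -
    have h: "besselK0_corr n holomorphic_on {y. Re y > 0}"
      unfolding besselK0_corr_def using one_plus_square_facts(3)[of _ "1 / (4 * pi\<^sup>2 * (real (Suc n))\<^sup>2)"]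
      by (intro holomorphic_intros) (auto simp del: of_nat_Suc)
    have "continuous_on {0<..<1} (\<lambda>v. besselK0_corr n (X v))"
      by (rule continuous_on_compose2[OF holomorphic_on_imp_continuous_on[OF h] contX])
         (use X in \<open>auto simp: space_restrict_space\<close>)
    then show ?thesis by (intro measurable_unit_lborel continuous_intros contw)
  qed
  have nw: "integrable ?M (\<lambda>v. norm (w v))" unfolding w_def by (rule integrable_beta_weight_norm[OF s0 cs])
  have cs3: "summable (\<lambda>n. (norm x)\<^sup>2 * sqrt (norm x / Re x) * real (Suc n) powr (- 3))"
    by (intro summable_mult summable_inverse_Suc_powr) simp
  have cbd: "norm (w v * besselK0_corr n (X v)) \<le> (norm x)\<^sup>2 * sqrt (norm x / Re x) * real (Suc n) powr (- 3) * norm (w v)"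
    if v: "v \<in> space ?M" for n v
  proof -
    note v' = v01[OF v]
    have sv: "sqrt v > 0" "sqrt v \<le> 1" using v' by auto
    have "norm (besselK0_corr n (X v)) \<le> (norm (X v))\<^sup>2 * sqrt (norm (X v) / Re (X v)) * real (Suc n) powr (- 3)"
      by (rule norm_besselK0_corr[OF X[OF v]])
    also have "norm (X v) / Re (X v) = norm x / Re x" using sv by (simp add: X_def norm_mult)
    also have "(norm (X v))\<^sup>2 * sqrt (norm x / Re x) * real (Suc n) powr (- 3) \<le> (norm x)\<^sup>2 * sqrt (norm x / Re x) * real (Suc n) powr (- 3)"
      using sv x by (intro mult_right_mono power_mono) (auto simp: X_def norm_mult mult_left_le)
    finally have b: "norm (besselK0_corr n (X v)) \<le> (norm x)\<^sup>2 * sqrt (norm x / Re x) * real (Suc n) powr (- 3)" .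
    show ?thesis using mult_right_mono[OF b norm_ge_zero[of "w v"]]
      by (simp only: norm_mult mult.commute[of "norm (w v)"])
  qed
  note cb = sums_integral_bounded[where f="\<lambda>n v. w v * besselK0_corr n (X v)", OF cmeas nw cs3]
  have C1: "(\<lambda>n. \<integral>v. w v * besselK0_corr n (X v) \<partial>?M) sums (\<integral>v. (\<Sum>n. w v * besselK0_corr n (X v)) \<partial>?M)"
    by (rule cb(1)) (rule cbd)
  have C2: "integrable ?M (\<lambda>v. \<Sum>n. w v * besselK0_corr n (X v))"
    by (rule cb(2)) (rule cbd)
  have C3: "summable (\<lambda>n. w v * besselK0_corr n (X v))" if "v \<in> space ?M" for v
    using cbd that by (rule cb(3))
  define L where "L = euler_mascheroni + Ln (x / (4 * of_real pi))"
  have kern: "(\<Sum>n. w v * (2 * besselK0 (of_nat (Suc n) * X v))) =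
     of_real pi / x * beta_weight (s - 1/2) (c - s) v + L * w v + (1/2) * (w v * of_real (ln v)) + (\<Sum>n. w v * besselK0_corr n (X v))"
    if v: "v \<in> space ?M" for v
  proof -
    note v' = v01[OF v]
    have sK: "summable (\<lambda>n. besselK0 (of_nat (Suc n) * X v))"
      using besselK0_sum(1)[OF X[OF v]] by (rule summable_norm_cancel)
    \<comment> \<open>Summability is known for the terms multiplied by \<open>w v\<close>, which is
      nonzero on the open interval.\<close>
    have sC: "summable (\<lambda>n. besselK0_corr n (X v))"
    proof -
      have "w v \<noteq> 0" using v' by (simp add: w_def beta_weight_def)
      then show ?thesis using C3[OF v] by simp
    qed
    have x0: "x \<noteq> 0" using x by auto
    have Ln: "Ln (X v / (4 * of_real pi)) = Ln (x / (4 * of_real pi)) + of_real (ln v) / 2"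
      using Ln_times_of_real_pos[of "sqrt v" "x / (4 * of_real pi)"] v' x0 by (simp add: X_def ln_sqrt)
    have pw: "w v / X v = beta_weight (s - 1/2) (c - s) v / x"
    proof -
      have "complex_of_real (sqrt v) = of_real v powr (1/2)"
        using v' powr_of_real[of v "1/2"] by (simp add: powr_half_sqrt)
      then have "of_real v powr (s - 1) / complex_of_real (sqrt v) = of_real v powr (s - 1 - 1/2)"
        by (simp only: powr_diff)
      also have "s - 1 - 1/2 = s - 1/2 - 1" by simp
      finally have pv: "of_real v powr (s - 1) / complex_of_real (sqrt v) = of_real v powr (s - 1/2 - 1)" .
      have "w v / X v = (of_real v powr (s - 1) / complex_of_real (sqrt v)) * (1 - of_real v) powr (c - s - 1) / x"
        unfolding w_def beta_weight_def X_def by simp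
      then show ?thesis unfolding pv beta_weight_def .
    qed
    have "(\<Sum>n. w v * (2 * besselK0 (of_nat (Suc n) * X v))) = w v * (2 * (\<Sum>n. besselK0 (of_nat (Suc n) * X v)))"
      using sK by (simp only: suminf_mult summable_mult)
    also have "2 * (\<Sum>n. besselK0 (of_nat (Suc n) * X v)) = (\<Sum>n. besselK0_corr n (X v)) + of_real pi / X v + euler_mascheroni + Ln (X v / (4 * of_real pi))"
      using besselK0_sum(2)[OF X[OF v]] by simp
    also have "w v * \<dots> = of_real pi * (w v / X v) + L * w v + (1/2) * (w v * of_real (ln v)) + w v * (\<Sum>n. besselK0_corr n (X v))"
      unfolding Ln L_def by (simp add: algebra_simps)
    also have "w v * (\<Sum>n. besselK0_corr n (X v)) = (\<Sum>n. w v * besselK0_corr n (X v))"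
      using sC by (rule suminf_mult[symmetric])
    finally show ?thesis unfolding pw by simp
  qed
  have wi: "integrable ?M w" "integrable ?M (\<lambda>v. w v * of_real (ln v))" "integrable ?M (beta_weight (s - 1/2) (c - s))"
    unfolding w_def using s by (intro integrable_beta_weight s0 cs, intro has_integral_beta_weight_aux(4)[OF cs s0], intro integrable_beta_weight cs, simp)
  have "(\<integral>v. (\<Sum>n. w v * (2 * besselK0 (of_nat (Suc n) * X v))) \<partial>?M) =
     (\<integral>v. of_real pi / x * beta_weight (s - 1/2) (c - s) v + L * w v + (1/2) * (w v * of_real (ln v)) + (\<Sum>n. w v * besselK0_corr n (X v)) \<partial>?M)"
    by (intro Bochner_Integration.integral_cong[OF refl] kern)
  also have "\<dots> = of_real pi / x * Beta (s - 1/2) (c - s) + L * Beta s (c - s) + (1/2) * (Beta s (c - s) * (Digamma s - Digamma c)) + (\<Sum>n. \<integral>v. w v * besselK0_corr n (X v) \<partial>?M)"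
  proof -
    have "(\<integral>v. w v \<partial>?M) = Beta s (c - s)" unfolding w_def by (rule integral_beta_weight[OF s0 cs])
    moreover have "(\<integral>v. w v * of_real (ln v) \<partial>?M) = Beta s (c - s) * (Digamma s - Digamma c)"
      unfolding w_def using integral_beta_weight_ln[OF s0 cs] by simp
    moreover have "(\<integral>v. beta_weight (s - 1/2) (c - s) v \<partial>?M) = Beta (s - 1/2) (c - s)"
      using s by (intro integral_beta_weight cs) simp
    moreover have "(\<integral>v. (\<Sum>n. w v * besselK0_corr n (X v)) \<partial>?M) = (\<Sum>n. \<integral>v. w v * besselK0_corr n (X v) \<partial>?M)"
      by (rule sums_unique[OF C1])
    ultimately show ?thesis
      by (simp only: Bochner_Integration.integral_add Bochner_Integration.integrable_add integrable_mult_right wi C2 integral_mult_right_zero)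
  qed
  finally have main: "(\<integral>v. (\<Sum>n. w v * (2 * besselK0 (of_nat (Suc n) * X v))) \<partial>?M) = \<dots>" .
  have FC: "besselFC s c (of_nat (Suc n) * x) = \<kappa> * (\<integral>v. w v * (2 * besselK0 (of_nat (Suc n) * X v)) \<partial>?M)" for n
    using besselFC_integral[OF s0 c, of "of_nat (Suc n) * x"] x
    by (simp add: \<kappa>_def w_def X_def mult.assoc del: of_nat_Suc)
  have "(\<lambda>n. besselFC s c (of_nat (Suc n) * x)) sums (\<kappa> * (\<integral>v. (\<Sum>n. w v * (2 * besselK0 (of_nat (Suc n) * X v))) \<partial>?M))"
    unfolding FC by (rule sums_mult[OF K])
  then have "(\<Sum>n. besselFC s c (of_nat (Suc n) * x)) = \<kappa> * (\<integral>v. (\<Sum>n. w v * (2 * besselK0 (of_nat (Suc n) * X v))) \<partial>?M)"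
    by (rule sums_unique[symmetric])
  also have "\<dots> = of_real pi / x * (\<kappa> * Beta (s - 1/2) (c - s)) + (\<kappa> * Beta s (c - s)) * (L + (Digamma s - Digamma c) / 2) +
       \<kappa> * (\<Sum>n. \<integral>v. w v * besselK0_corr n (X v) \<partial>?M)"
  proof -
    have "\<kappa> * (p * A + L * B + (1/2) * (B * d) + S) = p * (\<kappa> * A) + (\<kappa> * B) * (L + d / 2) + \<kappa> * S" for p A B d S
      by (simp add: field_simps)
    then show ?thesis unfolding main .
  qed
  also have "\<kappa> * Beta (s - 1/2) (c - s) = Gamma (s - 1/2) * rGamma (c - 1/2)"
    using rGamma_mult_Gamma_pos[OF cs] by (simp add: \<kappa>_def Beta_altdef mult_ac)
  also have B: "\<kappa> * Beta s (c - s) = Gamma s * rGamma c"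
    using rGamma_mult_Gamma_pos[OF cs] by (simp add: \<kappa>_def Beta_altdef mult_ac)
  also have "\<kappa> * (\<Sum>n. \<integral>v. w v * besselK0_corr n (X v) \<partial>?M) = Gamma s * (\<Sum>n. hyp_corr s x n c)"
  proof -
    have "\<kappa> * (\<integral>v. w v * besselK0_corr n (X v) \<partial>?M) = Gamma s * hyp_corr s x n c" for n
    proof -
      define \<xi> where "\<xi> = - (of_real (1 / (4 * pi\<^sup>2 * (real (Suc n))\<^sup>2)) * x\<^sup>2)"
      have \<xi>: "\<xi> \<in> slit_plane" unfolding \<xi>_def by (rule xi_slit[OF x]) simp
      let ?m = "1 / of_nat (Suc n) :: complex"
      have eq: "w v * besselK0_corr n (X v) = ?m * (w v * (1 - of_real v * \<xi>) powr (- (1/2)) - w v)" if "v \<in> space ?M" for v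
      proof -
        have "(X v)\<^sup>2 = of_real v * x\<^sup>2" using v01[OF that] by (simp add: X_def power_mult_distrib flip: of_real_power)
        then have e: "1 + of_real (1 / (4 * pi\<^sup>2 * (real (Suc n))\<^sup>2)) * (X v)\<^sup>2 = 1 - of_real v * \<xi>" by (simp add: \<xi>_def)
        have h: "(- 1 / 2 :: complex) = - (1 / 2)" by simp
        have "u * (m * (p - 1)) = m * (u * p - u)" for u m p :: complex by (simp add: algebra_simps)
        then show ?thesis unfolding besselK0_corr_def e h .
      qed
      obtain B where Bb: "B > 0" "\<And>t \<xi>' b'. 0 \<le> t \<Longrightarrow> t \<le> 1 \<Longrightarrow> \<xi>' \<in> {\<xi>} \<Longrightarrow> norm b' \<le> norm (1/2::complex) \<Longrightarrow>
            norm ((1 - of_real t * \<xi>') powr (-b')) \<le> B"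
        using slit_powr_bound[of "{\<xi>}" "norm (1/2::complex)"] \<xi> by auto
      have i: "integrable ?M (\<lambda>v. w v * (1 - of_real v * \<xi>) powr (- (1/2)))"
      proof (rule Bochner_Integration.integrable_bound)
        show "integrable ?M (\<lambda>v. B * norm (w v))" by (intro integrable_mult_right nw)
        show "(\<lambda>v. w v * (1 - of_real v * \<xi>) powr (- (1/2))) \<in> borel_measurable ?M"
          unfolding w_def by (intro measurable_unit_lborel continuous_beta_weight_powr \<xi>)
        show "AE v in ?M. norm (w v * (1 - of_real v * \<xi>) powr (- (1/2))) \<le> norm (B * norm (w v))"
          unfolding w_def using Bb by (intro AE_I2 order.trans[OF norm_beta_weight_powr_le[of _ B]]) (auto simp: space_restrict_space)
      qed
      have "(\<integral>v. w v * besselK0_corr n (X v) \<partial>?M) = (\<integral>v. ?m * (w v * (1 - of_real v * \<xi>) powr (- (1/2)) - w v) \<partial>?M)"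
        by (intro Bochner_Integration.integral_cong[OF refl] eq)
      also have "\<dots> = ?m * ((\<integral>v. w v * (1 - of_real v * \<xi>) powr (- (1/2)) \<partial>?M) - (\<integral>v. w v \<partial>?M))"
        by (simp only: integral_mult_right_zero Bochner_Integration.integral_diff i wi)
      also have "(\<integral>v. w v \<partial>?M) = Beta s (c - s)" unfolding w_def by (rule integral_beta_weight[OF s0 cs])
      finally have I: "(\<integral>v. w v * besselK0_corr n (X v) \<partial>?M) =
         ?m * ((\<integral>v. w v * (1 - of_real v * \<xi>) powr (- (1/2)) \<partial>?M) - Beta s (c - s))" .
      have "k * (m * (p - q)) = m * (k * p - k * q)" for k m p q :: complex by (simp add: algebra_simps)
      then have "\<kappa> * (\<integral>v. w v * besselK0_corr n (X v) \<partial>?M) =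
         ?m * (\<kappa> * (\<integral>v. w v * (1 - of_real v * \<xi>) powr (- (1/2)) \<partial>?M) - \<kappa> * Beta s (c - s))"
        unfolding I .
      also have "\<kappa> * (\<integral>v. w v * (1 - of_real v * \<xi>) powr (- (1/2)) \<partial>?M) = Gamma s * reg2F1 0 s (1/2) c \<xi>"
        using rGamma_mult_Gamma_pos[OF s0] by (simp add: \<kappa>_def w_def mult_ac)
      \<comment> \<open>Here s is the weight exponent and 1/2 the power; the symmetry in the
        numerator parameters leads back to \<open>half2F1\<close>.\<close>
      also have "reg2F1 0 s (1/2) c \<xi> = half2F1 s c \<xi>"
        using s0 c \<xi> by (intro half2F1_eq[symmetric]) auto
      finally show ?thesis unfolding B hyp_corr_def \<xi>_def[symmetric] by (simp add: algebra_simps)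
    qed
    then have "\<kappa> * (\<Sum>n. \<integral>v. w v * besselK0_corr n (X v) \<partial>?M) = (\<Sum>n. Gamma s * hyp_corr s x n c)"
      using sums_summable[OF C1] by (simp only: suminf_mult[symmetric])
    also have "\<dots> = Gamma s * (\<Sum>n. hyp_corr s x n c)"
      using summable_norm_cancel[OF hyp_corr_sum_holomorphic(2)[OF x]] by (rule suminf_mult)
    finally show ?thesis .
  qed
  also have "Gamma s * rGamma c * (L + (Digamma s - Digamma c) / 2) =
     Gamma s * (rGamma c * (euler_mascheroni + Ln (x / (4 * of_real pi))) + (rGamma c * Digamma s + deriv rGamma c) / 2)"
  proof -
    have "c \<notin> \<int>\<^sub>\<le>\<^sub>0" using s0 c by (auto elim!: nonpos_Ints_cases)
    then show ?thesis by (simp add: deriv_rGamma_eq L_def algebra_simps diff_divide_distrib)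
  qed
  finally show ?thesis .
qed

lemma besselFC_sum:
  assumes s: "Re s > 1 / 2" and x: "Re x > 0"
  shows "(\<Sum>n. besselFC s c (of_nat (Suc n) * x)) =
     of_real pi / x * (Gamma (s - 1/2) * rGamma (c - 1/2)) +
     Gamma s * (rGamma c * (euler_mascheroni + Ln (x / (4 * of_real pi))) + (rGamma c * Digamma s + deriv rGamma c) / 2) +
     Gamma s * (\<Sum>n. hyp_corr s x n c)"
proof (rule analytic_continuation_open[of "{c. Re c > Re s}" UNIV "\<lambda>c. \<Sum>n. besselFC s c (of_nat (Suc n) * x)"
    "\<lambda>c. of_real pi / x * (Gamma (s - 1/2) * rGamma (c - 1/2)) +
     Gamma s * (rGamma c * (euler_mascheroni + Ln (x / (4 * of_real pi))) + (rGamma c * Digamma s + deriv rGamma c) / 2) +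
     Gamma s * (\<Sum>n. hyp_corr s x n c)"])
  show "open {c. Re c > Re s}" by (rule open_halfspace_Re_gt)
  have "s + 1 \<in> {c. Re c > Re s}" by simp
  then show "{c. Re c > Re s} \<noteq> {}" by blast
  show "(\<lambda>c. \<Sum>n. besselFC s c (of_nat (Suc n) * x)) holomorphic_on UNIV"
    by (rule besselFC_sum_holomorphic[OF s x])
  have x0: "x \<noteq> 0" using x by auto
  have d: "deriv rGamma holomorphic_on (UNIV :: complex set)" by (auto intro!: holomorphic_intros)
  show "(\<lambda>c. of_real pi / x * (Gamma (s - 1/2) * rGamma (c - 1/2)) +
     Gamma s * (rGamma c * (euler_mascheroni + Ln (x / (4 * of_real pi))) + (rGamma c * Digamma s + deriv rGamma c) / 2) +
     Gamma s * (\<Sum>n. hyp_corr s x n c)) holomorphic_on UNIV"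
    using x0 by (intro holomorphic_intros hyp_corr_sum_holomorphic x d) auto
qed (use besselFC_sum_base[OF s _ x] in auto)

subsection \<open>The limit z = 0\<close>


text \<open>Since pochhammer b n times Gamma b is Gamma (b + n), division by Gamma b merges into
  \<open>rGamma (b + of_nat n)\<close>, entire in b. The denominator \<open>pochhammer b2 n\<close>
  is likewise estimated through rGamma.\<close>

lemma reg_hyp1F2_sum:
  assumes b2: "b2 \<notin> \<int>\<^sub>\<le>\<^sub>0"
  shows "(\<lambda>b. \<Sum>n. pochhammer a n * rGamma (b + of_nat n) / pochhammer b2 n * (\<xi> ^ n / fact n)) holomorphic_on UNIV"
    and "summable (\<lambda>n. norm (pochhammer a n * rGamma (b + of_nat n) / pochhammer b2 n * (\<xi> ^ n / fact n)))"
proof -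
  define t where "t n b = pochhammer a n * rGamma (b + of_nat n) / pochhammer b2 n * (\<xi> ^ n / fact n)" for n b
  have hol: "t n holomorphic_on UNIV" for n
    using b2 unfolding t_def by (intro holomorphic_intros) (auto simp: pochhammer_eq_0_iff)
  have bd: "\<exists>d h. 0 < d \<and> summable h \<and> (\<forall>n. \<forall>b\<in>ball b0 d \<inter> UNIV. norm (t n b) \<le> h n)" for b0
  proof -
    obtain B where B: "B \<ge> 0" "\<forall>b n. norm (b::complex) \<le> norm b0 + 1 \<longrightarrow> norm (rGamma (b + of_nat n)) \<le> B * 4 ^ n / fact n"
      using rGamma_shift_bound[of "norm b0 + 1"] by metis
    obtain B' where B': "B' \<ge> 0" "\<forall>n. norm (rGamma (b2 + of_nat n)) \<le> B' * 4 ^ n / fact n"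
      using rGamma_shift_bound[of "norm b2"] by (metis order_refl)
    define C where "C = B * (norm (Gamma b2) * B')"
    define K where "K = (norm a + 1) * 16"
    have 16: "(16::real) ^ n = 4 ^ n * 4 ^ n" for n by (simp flip: power_mult_distrib)
    have "norm (t n b) \<le> C * K ^ n / fact n * norm \<xi> ^ n" if b: "b \<in> ball b0 1 \<inter> UNIV" for n b
    proof -
      have nb: "norm b \<le> norm b0 + 1" using b norm_triangle_ineq2[of b b0] by (simp add: dist_norm norm_minus_commute)
      have "1 / pochhammer b2 n = Gamma b2 * rGamma (b2 + of_nat n)"
      proof -
        have "Gamma b2 \<noteq> 0" using b2 by (simp add: Gamma_eq_zero_iff)
        then have "Gamma b2 * rGamma b2 = 1" by (simp add: rGamma_inverse_Gamma)
        moreover have "pochhammer b2 n \<noteq> 0" using b2 by (auto simp: pochhammer_eq_0_iff)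
        ultimately show ?thesis using pochhammer_rGamma[of b2 n] by (simp add: field_simps)
      qed
      then have e: "t n b = pochhammer a n * rGamma (b + of_nat n) * (Gamma b2 * rGamma (b2 + of_nat n)) * (\<xi> ^ n / fact n)"
        unfolding t_def by (metis divide_inverse inverse_eq_divide)
      have "norm (t n b) = norm (pochhammer a n) * norm (rGamma (b + of_nat n)) * (norm (Gamma b2) * norm (rGamma (b2 + of_nat n))) * (norm \<xi> ^ n / fact n)"
        unfolding e by (simp add: norm_mult norm_divide norm_power)
      also have "\<dots> \<le> ((norm a + 1) ^ n * fact n) * (B * 4 ^ n / fact n) * (norm (Gamma b2) * (B' * 4 ^ n / fact n)) * (norm \<xi> ^ n / fact n)"
        using B B' nb by (intro mult_mono norm_pochhammer_le) (auto intro!: mult_nonneg_nonneg divide_nonneg_nonneg)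
      also have "\<dots> = C * K ^ n / fact n * norm \<xi> ^ n * (1 / fact n)"
        unfolding C_def K_def power_mult_distrib 16 by (simp add: field_simps)
      also have "\<dots> \<le> C * K ^ n / fact n * norm \<xi> ^ n * 1"
        using B B' by (intro mult_left_mono) (auto simp: C_def K_def intro!: mult_nonneg_nonneg divide_nonneg_nonneg)
      finally show ?thesis by simp
    qed
    then show ?thesis
      using summable_exp_bound[of C K "norm \<xi>"]
      by (intro exI[of _ 1] exI[of _ "\<lambda>n. C * K ^ n / fact n * norm \<xi> ^ n"]) auto
  qed
  note h = holomorphic_on_series[OF open_UNIV hol bd]
  show "(\<lambda>b. \<Sum>n. pochhammer a n * rGamma (b + of_nat n) / pochhammer b2 n * (\<xi> ^ n / fact n)) holomorphic_on UNIV"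
    using h(1) by (simp add: t_def)
  show "summable (\<lambda>n. norm (pochhammer a n * rGamma (b + of_nat n) / pochhammer b2 n * (\<xi> ^ n / fact n)))"
    using h(2)[of b] by (simp add: t_def)
qed

lemma div_Gamma_hyp1F2:
  assumes b2: "b2 \<notin> \<int>\<^sub>\<le>\<^sub>0"
  shows "div_Gamma (\<lambda>b. hyp1F2 a b b2 \<xi>) b =
     (\<Sum>n. pochhammer a n * rGamma (b + of_nat n) / pochhammer b2 n * (\<xi> ^ n / fact n))"
proof (rule div_Gamma_eq)
  show "isCont (\<lambda>b. \<Sum>n. pochhammer a n * rGamma (b + of_nat n) / pochhammer b2 n * (\<xi> ^ n / fact n)) b"
    using reg_hyp1F2_sum(1)[OF b2] by (rule isCont_holomorphic_UNIV)
  fix w :: complex assume w: "w \<notin> \<int>\<^sub>\<le>\<^sub>0"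
  let ?t = "\<lambda>n. pochhammer a n * rGamma (w + of_nat n) / pochhammer b2 n * (\<xi> ^ n / fact n)"
  have G: "Gamma w \<noteq> 0" using w by (simp add: Gamma_eq_zero_iff)
  have "pochhammer a n / (pochhammer w n * pochhammer b2 n) * (\<xi> ^ n / fact n) = Gamma w * ?t n" for n
  proof -
    have "pochhammer w n \<noteq> 0" using w by (auto simp: pochhammer_eq_0_iff)
    moreover have "Gamma w * (pochhammer w n * rGamma (w + of_nat n)) = 1"
      unfolding pochhammer_rGamma[of w n, symmetric] using G by (simp add: rGamma_inverse_Gamma)
    ultimately have "1 / pochhammer w n = Gamma w * rGamma (w + of_nat n)" by (simp add: field_simps)
    then have "pochhammer a n * (1 / pochhammer w n) / pochhammer b2 n * (\<xi> ^ n / fact n) = Gamma w * ?t n" by simp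
    then show ?thesis by simp
  qed
  then have "hyp1F2 a w b2 \<xi> = (\<Sum>n. Gamma w * ?t n)" by (simp add: hyp1F2_def)
  also have "\<dots> = Gamma w * (\<Sum>n. ?t n)"
    by (rule suminf_mult[OF summable_norm_cancel[OF reg_hyp1F2_sum(2)[OF b2]]])
  finally show "hyp1F2 a w b2 \<xi> / Gamma w = (\<Sum>n. ?t n)" using G by simp
qed

text \<open>The four shifts are independent so that one majorant covers both series of
  \<open>gen_besselK_nonint\<close>: they are the cases (0, -z, -z, -z) and (z, 0, z, z).\<close>

definition besselT :: "complex \<Rightarrow> complex \<Rightarrow> complex \<Rightarrow> nat \<Rightarrow> complex \<Rightarrow> complex \<Rightarrow> complex \<Rightarrow> complex \<Rightarrow> complex" where
  "besselT s c y n \<alpha> \<beta> \<gamma> \<delta> = Gamma (s + \<alpha> + of_nat n) * rGamma (c + \<beta> + of_nat n) *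
      rGamma (1 + \<gamma> + of_nat n) * exp (\<delta> * Ln (y / 2)) * ((y\<^sup>2 / 4) ^ n / fact n)"

text \<open>Because Re s > 1/2, shifts of norm at most 1/4 keep s + \<alpha> in the right
  half-plane, where Gamma is bounded on the compact disc of shifts.\<close>

lemma besselT_bound:
  assumes s: "Re s > 1 / 2"
  obtains h where "summable h"
    "\<And>n \<alpha> \<beta> \<gamma> \<delta>. norm \<alpha> \<le> 1/4 \<Longrightarrow> norm \<beta> \<le> 1/4 \<Longrightarrow> norm \<gamma> \<le> 1/4 \<Longrightarrow> norm \<delta> \<le> 1/4 \<Longrightarrow>
       norm (besselT s c y n \<alpha> \<beta> \<gamma> \<delta>) \<le> h n"
proof -
  have Rp: "Re (s + \<alpha>) > 0" if "norm \<alpha> \<le> 1/4" for \<alpha>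
    using s abs_Re_le_cmod[of \<alpha>] that by simp
  have "(\<lambda>\<alpha>. Gamma (s + \<alpha>)) holomorphic_on cball 0 (1/4)"
    using Re_pos_notin_nonpos_Ints[OF Rp] by (auto intro!: holomorphic_intros)
  then have "bounded ((\<lambda>\<alpha>. Gamma (s + \<alpha>)) ` cball 0 (1/4))"
    by (intro compact_imp_bounded compact_continuous_image holomorphic_on_imp_continuous_on) auto
  then obtain G where G: "\<And>\<alpha>. norm \<alpha> \<le> 1/4 \<Longrightarrow> norm (Gamma (s + \<alpha>)) \<le> G"
    by (fastforce simp: bounded_iff)
  have G0: "G \<ge> 0" using G[of 0] norm_ge_zero[of "Gamma (s + 0)"] by (simp del: norm_ge_zero add: order_trans)
  obtain B where B: "B \<ge> 0" "\<forall>b n. norm (b::complex) \<le> norm c + 1 \<longrightarrow> norm (rGamma (b + of_nat n)) \<le> B * 4 ^ n / fact n"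
    using rGamma_shift_bound[of "norm c + 1"] by metis
  obtain B' where B': "B' \<ge> 0" "\<forall>b n. norm (b::complex) \<le> 2 \<longrightarrow> norm (rGamma (b + of_nat n)) \<le> B' * 4 ^ n / fact n"
    using rGamma_shift_bound[of 2] by metis
  define E where "E = exp (norm (Ln (y / 2)))"
  define q where "q = y\<^sup>2 / 4"
  define C where "C = G * B * B' * E"
  define K where "K = (norm s + 2) * 16"
  have 16: "(16::real) ^ n = 4 ^ n * 4 ^ n" for n by (simp flip: power_mult_distrib)
  have "norm (besselT s c y n \<alpha> \<beta> \<gamma> \<delta>) \<le> C * K ^ n / fact n * norm q ^ n"
    if n: "norm \<alpha> \<le> 1/4" "norm \<beta> \<le> 1/4" "norm \<gamma> \<le> 1/4" "norm \<delta> \<le> 1/4" for n \<alpha> \<beta> \<gamma> \<delta>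
  proof -
    have 1: "norm (Gamma (s + \<alpha> + of_nat n)) \<le> ((norm s + 2) ^ n * fact n) * G"
    proof -
      have "norm (s + \<alpha>) + 1 \<le> norm s + 2" using n norm_triangle_ineq[of s \<alpha>] by simp
      then have "(norm (s + \<alpha>) + 1) ^ n * fact n \<le> (norm s + 2) ^ n * fact n"
        by (intro mult_right_mono power_mono) auto
      then have "norm (pochhammer (s + \<alpha>) n) \<le> (norm s + 2) ^ n * fact n"
        using norm_pochhammer_le[of "s + \<alpha>" n] by linarith
      then show ?thesis unfolding pochhammer_Gamma_pos[OF Rp[OF n(1)]] norm_mult
        using G[OF n(1)] by (intro mult_mono) auto
    qed
    have 2: "norm (rGamma (c + \<beta> + of_nat n)) \<le> B * 4 ^ n / fact n"
      using B(2) n norm_triangle_ineq[of c \<beta>] by auto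
    have 3: "norm (rGamma (1 + \<gamma> + of_nat n)) \<le> B' * 4 ^ n / fact n"
      using B'(2) n norm_triangle_ineq[of 1 \<gamma>] by auto
    have 4: "norm (exp (\<delta> * Ln (y / 2))) \<le> E"
    proof -
      have "norm (exp (\<delta> * Ln (y / 2))) \<le> exp (norm (\<delta> * Ln (y / 2)))" by (rule norm_exp)
      also have "norm (\<delta> * Ln (y / 2)) \<le> 1 * norm (Ln (y / 2))"
        unfolding norm_mult using n by (intro mult_right_mono) auto
      finally show ?thesis by (simp add: E_def)
    qed
    have "norm (besselT s c y n \<alpha> \<beta> \<gamma> \<delta>) = norm (Gamma (s + \<alpha> + of_nat n)) * norm (rGamma (c + \<beta> + of_nat n)) *
      norm (rGamma (1 + \<gamma> + of_nat n)) * norm (exp (\<delta> * Ln (y / 2))) * (norm q ^ n / fact n)"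
      unfolding besselT_def q_def[symmetric] by (simp only: norm_mult norm_divide norm_power norm_fact)
    also have "\<dots> \<le> (((norm s + 2) ^ n * fact n) * G) * (B * 4 ^ n / fact n) * (B' * 4 ^ n / fact n) * E * (norm q ^ n / fact n)"
      using B B' G0 by (intro mult_mono 1 2 3 4) (auto simp: E_def intro!: mult_nonneg_nonneg divide_nonneg_nonneg)
    also have "\<dots> = C * K ^ n / fact n * norm q ^ n * (1 / fact n)"
      unfolding C_def K_def power_mult_distrib 16 by (simp add: field_simps)
    also have "\<dots> \<le> C * K ^ n / fact n * norm q ^ n * 1"
      using B B' G0 by (intro mult_left_mono) (auto simp: C_def K_def E_def intro!: mult_nonneg_nonneg divide_nonneg_nonneg)
    finally show ?thesis by simp
  qed
  then show ?thesis by (rule that[OF summable_exp_bound[of C K "norm q"]])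
qed

text \<open>
  The two series in the definition of \<open>gen_besselK_nonint\<close> agree at \<open>z = 0\<close>, so the limit \<open>z \<rightarrow> 0\<close> is
  the difference of their derivatives.
\<close>

definition besselH1 :: "complex \<Rightarrow> complex \<Rightarrow> complex \<Rightarrow> complex \<Rightarrow> complex" where
  "besselH1 s c y z = (\<Sum>n. besselT s c y n 0 (- z) (- z) (- z))"

definition besselH2 :: "complex \<Rightarrow> complex \<Rightarrow> complex \<Rightarrow> complex \<Rightarrow> complex" where
  "besselH2 s c y z = (\<Sum>n. besselT s c y n z 0 z z)"

lemma besselH_deriv:
  assumes s: "Re s > 1 / 2"
  shows "((\<lambda>z. besselH1 s c y z - besselH2 s c y z) has_field_derivative besselFC s c y) (at 0)"
    and "besselH1 s c y 0 = besselH2 s c y 0"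
proof -
  have s0: "Re s > 0" using s by simp
  obtain h where h: "summable h"
    "\<forall>n \<alpha> \<beta> \<gamma> \<delta>. norm \<alpha> \<le> 1/4 \<longrightarrow> norm \<beta> \<le> 1/4 \<longrightarrow> norm \<gamma> \<le> 1/4 \<longrightarrow> norm \<delta> \<le> 1/4 \<longrightarrow>
       norm (besselT s c y n \<alpha> \<beta> \<gamma> \<delta>) \<le> h n"
    using besselT_bound[OF s, of c y] by metis
  let ?S = "ball (0::complex) (1/4)"
  define f1 where "f1 n z = besselT s c y n 0 (- z) (- z) (- z)" for n z
  define f2 where "f2 n z = besselT s c y n z 0 z z" for n z
  have Rp: "s + z + of_nat n \<notin> \<int>\<^sub>\<le>\<^sub>0" if "norm z \<le> 1/4" for z n
  proof -
    have "Re (s + z + of_nat n) > 0" using s abs_Re_le_cmod[of z] that by simp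
    then show ?thesis by (rule Re_pos_notin_nonpos_Ints)
  qed
  have hol: "f1 n holomorphic_on ?S" "f2 n holomorphic_on ?S" for n
    unfolding f1_def f2_def besselT_def using Rp by (auto intro!: holomorphic_intros)
  have bd: "\<exists>d h. 0 < d \<and> summable h \<and> (\<forall>n. \<forall>z\<in>ball z0 d \<inter> ?S. norm (f1 n z) \<le> h n)"
    "\<exists>d h. 0 < d \<and> summable h \<and> (\<forall>n. \<forall>z\<in>ball z0 d \<inter> ?S. norm (f2 n z) \<le> h n)" for z0
    using h unfolding f1_def f2_def by (intro exI[of _ 1] exI[of _ h]; auto)+
  note H1 = holomorphic_on_series[OF open_ball hol(1) bd(1)]
  note H2 = holomorphic_on_series[OF open_ball hol(2) bd(2)]
  have z0: "0 \<in> ?S" by simp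
  have e: "besselH1 s c y = (\<lambda>z. \<Sum>n. f1 n z)" "besselH2 s c y = (\<lambda>z. \<Sum>n. f2 n z)"
    by (auto simp: besselH1_def besselH2_def f1_def f2_def)
  have dH: "((\<lambda>z. besselH1 s c y z - besselH2 s c y z) has_field_derivative
      deriv (\<lambda>z. \<Sum>n. f1 n z) 0 - deriv (\<lambda>z. \<Sum>n. f2 n z) 0) (at 0)"
    unfolding e by (intro DERIV_diff holomorphic_derivI[OF H1(1) open_ball z0] holomorphic_derivI[OF H2(1) open_ball z0])
  have sd: "(\<lambda>n. deriv (f1 n) 0 - deriv (f2 n) 0) sums (deriv (\<lambda>z. \<Sum>n. f1 n z) 0 - deriv (\<lambda>z. \<Sum>n. f2 n z) 0)"
    by (intro sums_diff H1(3) H2(3) z0)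
  \<comment> \<open>At z = 0, after factoring out rGamma (1 + n), the factors rGamma (1 - z + n) and
    rGamma (1 + z + n) contribute psi(1 + n) each, rGamma (c - z + n) the term - deriv rGamma, Gamma
    (s + z + n) the term - psi(s + n), and the two powers of y / 2 together - 2 Ln (y / 2).\<close>
  have td: "deriv (f1 n) 0 - deriv (f2 n) 0 = coefP s c n * (y\<^sup>2 / 4) ^ n - 2 * Ln (y / 2) * (coefA s c n * (y\<^sup>2 / 4) ^ n)" for n
  proof -
    define l where "l = Ln (y / 2)"
    define Q where "Q = (y\<^sup>2 / 4) ^ n / fact n"
    have rd: "(rGamma has_field_derivative deriv rGamma w) (at w)" for w :: complex
      by (rule holomorphic_derivI[of _ UNIV]) (auto intro!: holomorphic_intros)
    have np1: "1 + of_nat n \<notin> (\<int>\<^sub>\<le>\<^sub>0 :: complex set)"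
      by (auto elim!: nonpos_Ints_cases simp: complex_eq_iff)
    have nps: "s + of_nat n \<notin> \<int>\<^sub>\<le>\<^sub>0" using Rp[of 0 n] by simp
    have r1: "rGamma (1 + of_nat n) = 1 / (fact n :: complex)"
      using Gamma_fact[of n, where ?'a=complex] by (simp add: rGamma_inverse_Gamma inverse_eq_divide)
    have m: "((\<lambda>z. a - z + b) has_field_derivative - 1) (at 0)" "((\<lambda>z. a + z + b) has_field_derivative 1) (at 0)"
      for a b :: complex by (auto intro!: derivative_eq_intros)
    have cm: "((\<lambda>z. rGamma (a - z + of_nat n)) has_field_derivative deriv rGamma (a + of_nat n) * - 1) (at 0)" for a :: complex
      by (rule DERIV_chain2[of rGamma _ "\<lambda>z. a - z + of_nat n" 0, OF _ m(1)]) (use rd in simp)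
    have cp: "((\<lambda>z. rGamma (a + z + of_nat n)) has_field_derivative deriv rGamma (a + of_nat n) * 1) (at 0)" for a :: complex
      by (rule DERIV_chain2[of rGamma _ "\<lambda>z. a + z + of_nat n" 0, OF _ m(2)]) (use rd in simp)
    have ce: "((\<lambda>z. exp (- z * l)) has_field_derivative - l) (at 0)" "((\<lambda>z. exp (z * l)) has_field_derivative l) (at 0)"
      by (auto intro!: derivative_eq_intros)
    have cg: "((\<lambda>z. Gamma (s + z + of_nat n)) has_field_derivative Gamma (s + of_nat n) * Digamma (s + of_nat n) * 1) (at 0)"
      by (rule DERIV_chain2[of Gamma _ "\<lambda>z. s + z + of_nat n" 0, OF _ m(2)])
         (use has_field_derivative_Gamma[OF nps, of UNIV] in simp)
    have "(f1 n has_field_derivative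
       (Gamma (s + of_nat n) * ((rGamma (c - 0 + of_nat n) * (deriv rGamma (1 + of_nat n) * - 1) + deriv rGamma (c + of_nat n) * - 1 * rGamma (1 - 0 + of_nat n)) * exp (- 0 * l)
         + rGamma (c - 0 + of_nat n) * rGamma (1 - 0 + of_nat n) * - l)) * Q) (at 0)"
    proof -
      have "f1 n = (\<lambda>z. (Gamma (s + of_nat n) * (rGamma (c - z + of_nat n) * rGamma (1 - z + of_nat n) * exp (- z * l))) * Q)"
        by (rule ext) (simp add: f1_def besselT_def l_def Q_def mult_ac)
      moreover have "((\<lambda>z. (Gamma (s + of_nat n) * (rGamma (c - z + of_nat n) * rGamma (1 - z + of_nat n) * exp (- z * l))) * Q) has_field_derivative
       (Gamma (s + of_nat n) * ((rGamma (c - 0 + of_nat n) * (deriv rGamma (1 + of_nat n) * - 1) + deriv rGamma (c + of_nat n) * - 1 * rGamma (1 - 0 + of_nat n)) * exp (- 0 * l)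
         + rGamma (c - 0 + of_nat n) * rGamma (1 - 0 + of_nat n) * - l)) * Q) (at 0)"
        by (rule DERIV_cmult_right DERIV_cmult)+
           (use DERIV_mult'[OF DERIV_mult'[OF cm[of c] cm[of 1]] ce(1)] in \<open>simp add: algebra_simps\<close>)
      ultimately show ?thesis by simp
    qed
    then have d1: "deriv (f1 n) 0 = (Gamma (s + of_nat n) * ((rGamma (c + of_nat n) * (- deriv rGamma (1 + of_nat n)) - deriv rGamma (c + of_nat n) * rGamma (1 + of_nat n))
         - rGamma (c + of_nat n) * rGamma (1 + of_nat n) * l)) * Q"
      by (simp add: DERIV_imp_deriv algebra_simps)
    have "(f2 n has_field_derivative
       (rGamma (c + of_nat n) * ((Gamma (s + 0 + of_nat n) * (deriv rGamma (1 + of_nat n) * 1) + Gamma (s + of_nat n) * Digamma (s + of_nat n) * 1 * rGamma (1 + 0 + of_nat n)) * exp (0 * l)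
         + Gamma (s + 0 + of_nat n) * rGamma (1 + 0 + of_nat n) * l)) * Q) (at 0)"
    proof -
      have "f2 n = (\<lambda>z. (rGamma (c + of_nat n) * (Gamma (s + z + of_nat n) * rGamma (1 + z + of_nat n) * exp (z * l))) * Q)"
        by (rule ext) (simp add: f2_def besselT_def l_def Q_def mult_ac)
      moreover have "((\<lambda>z. (rGamma (c + of_nat n) * (Gamma (s + z + of_nat n) * rGamma (1 + z + of_nat n) * exp (z * l))) * Q) has_field_derivative
       (rGamma (c + of_nat n) * ((Gamma (s + 0 + of_nat n) * (deriv rGamma (1 + of_nat n) * 1) + Gamma (s + of_nat n) * Digamma (s + of_nat n) * 1 * rGamma (1 + 0 + of_nat n)) * exp (0 * l)
         + Gamma (s + 0 + of_nat n) * rGamma (1 + 0 + of_nat n) * l)) * Q) (at 0)"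
        by (rule DERIV_cmult_right DERIV_cmult)+
           (use DERIV_mult'[OF DERIV_mult'[OF cg cp[of 1]] ce(2)] in \<open>simp add: algebra_simps\<close>)
      ultimately show ?thesis by simp
    qed
    then have d2: "deriv (f2 n) 0 = (rGamma (c + of_nat n) * ((Gamma (s + of_nat n) * deriv rGamma (1 + of_nat n) + Gamma (s + of_nat n) * Digamma (s + of_nat n) * rGamma (1 + of_nat n))
         + Gamma (s + of_nat n) * rGamma (1 + of_nat n) * l)) * Q"
      by (simp add: DERIV_imp_deriv algebra_simps)
    show ?thesis
      unfolding d1 d2 deriv_rGamma_eq[OF np1] r1 l_def[symmetric] coefP_def coefA_def Q_def
      by (simp add: field_simps power2_eq_square)
  qed
  have sF: "(\<lambda>n. coefP s c n * (y\<^sup>2 / 4) ^ n - 2 * Ln (y / 2) * (coefA s c n * (y\<^sup>2 / 4) ^ n)) sums besselFC s c y"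
    unfolding besselFC_def logser_def
    using entire_coeffs_coef[OF s0, of c] by (intro sums_diff sums_mult summable_sums) (auto simp: entire_coeffs_def)
  show "((\<lambda>z. besselH1 s c y z - besselH2 s c y z) has_field_derivative besselFC s c y) (at 0)"
    using dH sums_unique2[OF sd[unfolded td] sF] by simp
  show "besselH1 s c y 0 = besselH2 s c y 0" by (simp add: besselH1_def besselH2_def)
qed

lemma gen_besselK_nonint_eq:
  assumes s: "Re (\<mu> + lam + 1/2) > 1 / 2" and y: "Re y > 0" and z: "norm z < 1 / 4"
  shows "gen_besselK_nonint \<mu> z y lam = of_real pi * y powr lam * 2 powr (\<mu> + z - 1) / sin (z * of_real pi) *
     (besselH1 (\<mu> + lam + 1/2) (lam + 1/2) y z - besselH2 (\<mu> + lam + 1/2) (lam + 1/2) y z)"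
proof -
  define s where "s = \<mu> + lam + 1/2"
  define c where "c = lam + 1/2"
  have sp: "Re s > 1/2" using s by (simp add: s_def)
  have y2: "y / 2 \<noteq> 0" using y by auto
  have np: "1 + w \<notin> \<int>\<^sub>\<le>\<^sub>0" if "norm w < 1/4" for w :: complex
  proof -
    have "Re (1 + w) > 0" using abs_Re_le_cmod[of w] that by simp
    then show ?thesis by (rule Re_pos_notin_nonpos_Ints)
  qed
  have G: "Gamma (s + w) * pochhammer (s + w) n = Gamma (s + w + of_nat n)" if "norm w < 1/4" for w n
  proof -
    have "Re (s + w) > 0" using abs_Re_le_cmod[of w] that sp by simp
    then show ?thesis by (simp add: pochhammer_Gamma_pos)
  qed
  have R: "1 / (Gamma (1 + w) * pochhammer (1 + w) n) = rGamma (1 + w + of_nat n)" if "norm w < 1/4" for w :: complex and n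
  proof -
    have "Gamma (1 + w) \<noteq> 0" using np[OF that] by (simp add: Gamma_eq_zero_iff)
    moreover have "pochhammer (1 + w) n \<noteq> 0" using np[OF that] by (auto simp: pochhammer_eq_0_iff)
    ultimately show ?thesis using pochhammer_rGamma[of "1 + w" n] by (simp add: rGamma_inverse_Gamma field_simps)
  qed
  \<comment> \<open>Kept general in the shifts so that it rewrites both summands of the definition,
    with \<open>1 - z\<close> read as \<open>1 + (- z)\<close>.\<close>
  have trm: "(y / 2) powr \<delta> * (Gamma (s + \<alpha>) / Gamma (1 + \<gamma>)) * div_Gamma (\<lambda>b. hyp1F2 (s + \<alpha>) b (1 + \<gamma>) (y\<^sup>2 / 4)) (c + \<beta>) =
     (\<Sum>n. besselT s c y n \<alpha> \<beta> \<gamma> \<delta>)" if a: "norm \<alpha> < 1/4" and g: "norm \<gamma> < 1/4" for \<alpha> \<beta> \<gamma> \<delta>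
  proof -
    let ?t = "\<lambda>n. pochhammer (s + \<alpha>) n * rGamma (c + \<beta> + of_nat n) / pochhammer (1 + \<gamma>) n * ((y\<^sup>2 / 4) ^ n / fact n)"
    have "summable ?t" by (rule summable_norm_cancel[OF reg_hyp1F2_sum(2)[OF np[OF g]]])
    then have "(y / 2) powr \<delta> * (Gamma (s + \<alpha>) / Gamma (1 + \<gamma>)) * (\<Sum>n. ?t n) =
       (\<Sum>n. (y / 2) powr \<delta> * (Gamma (s + \<alpha>) / Gamma (1 + \<gamma>)) * ?t n)"
      by (rule suminf_mult[symmetric])
    also have "(\<lambda>n. (y / 2) powr \<delta> * (Gamma (s + \<alpha>) / Gamma (1 + \<gamma>)) * ?t n) = (\<lambda>n. besselT s c y n \<alpha> \<beta> \<gamma> \<delta>)"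
    proof
      fix n
      have "(y / 2) powr \<delta> * (Gamma (s + \<alpha>) / Gamma (1 + \<gamma>)) * ?t n =
        (Gamma (s + \<alpha>) * pochhammer (s + \<alpha>) n) * rGamma (c + \<beta> + of_nat n) * (1 / (Gamma (1 + \<gamma>) * pochhammer (1 + \<gamma>) n)) * (y / 2) powr \<delta> * ((y\<^sup>2 / 4) ^ n / fact n)"
      proof -
        have "p * (u / v) * (a * r / b * q) = (u * a) * r * (1 / (v * b)) * p * q" for p u v a r b q :: complex
          by (simp add: mult_ac)
        then show ?thesis .
      qed
      also have "\<dots> = besselT s c y n \<alpha> \<beta> \<gamma> \<delta>"
        unfolding G[OF a] R[OF g] besselT_def using y2 by (simp add: powr_def)
      finally show "(y / 2) powr \<delta> * (Gamma (s + \<alpha>) / Gamma (1 + \<gamma>)) * ?t n = besselT s c y n \<alpha> \<beta> \<gamma> \<delta>" .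
    qed
    finally show ?thesis unfolding div_Gamma_hyp1F2[OF np[OF g]] .
  qed
  have "gen_besselK_nonint \<mu> z y lam = of_real pi * y powr lam * 2 powr (\<mu> + z - 1) / sin (z * of_real pi) *
     ((y / 2) powr (- z) * (Gamma (s + 0) / Gamma (1 + (- z))) * div_Gamma (\<lambda>b. hyp1F2 (s + 0) b (1 + (- z)) (y\<^sup>2 / 4)) (c + (- z))
     - (y / 2) powr z * (Gamma (s + z) / Gamma (1 + z)) * div_Gamma (\<lambda>b. hyp1F2 (s + z) b (1 + z) (y\<^sup>2 / 4)) (c + 0))"
  proof -
    have e: "s + 0 = \<mu> + lam + 1/2" "1 + (- z) = 1 - z" "c + (- z) = lam + 1/2 - z" "s + z = \<mu> + z + lam + 1/2" "c + 0 = lam + 1/2"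
      by (simp_all add: s_def c_def)
    show ?thesis unfolding gen_besselK_nonint_def e ..
  qed
  then show ?thesis
    using z by (subst (asm) trm, simp, simp, subst (asm) trm, simp, simp)
      (simp add: besselH1_def besselH2_def s_def c_def)
qed

text \<open>The difference H of the two series vanishes at z = 0, so H z / sin (pi z) tends to H'(0)
  / pi, and H'(0) is \<open>besselFC\<close>; the prefactor pi cancels.\<close>

lemma gen_besselK_0:
  assumes s: "Re (\<mu> + lam) > 0" and y: "Re y > 0"
  shows "gen_besselK \<mu> 0 y lam = y powr lam * 2 powr (\<mu> - 1) * besselFC (\<mu> + lam + 1/2) (lam + 1/2) y"
proof -
  define H where "H z = besselH1 (\<mu> + lam + 1/2) (lam + 1/2) y z - besselH2 (\<mu> + lam + 1/2) (lam + 1/2) y z" for z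
  let ?F = "besselFC (\<mu> + lam + 1/2) (lam + 1/2) y"
  have s': "Re (\<mu> + lam + 1/2) > 1/2" using s by simp
  have H0: "H 0 = 0" using besselH_deriv(2)[OF s'] by (simp add: H_def)
  have "((\<lambda>z. (H z - H 0) / (z - 0)) \<longlongrightarrow> ?F) (at 0)"
    using besselH_deriv(1)[OF s'] unfolding has_field_derivative_iff H_def .
  then have l1: "((\<lambda>z. H z / z) \<longlongrightarrow> ?F) (at 0)" by (simp add: H0)
  have "((\<lambda>z. sin (z * of_real pi)) has_field_derivative complex_of_real pi) (at 0)"
    by (auto intro!: derivative_eq_intros)
  then have l2: "((\<lambda>z. sin (z * of_real pi) / z) \<longlongrightarrow> complex_of_real pi) (at 0)"
    unfolding has_field_derivative_iff by simp
  have l3: "((\<lambda>z. 2 powr (\<mu> + z - 1)) \<longlongrightarrow> 2 powr (\<mu> + 0 - 1 :: complex)) (at 0)"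
    by (intro tendsto_intros) auto
  have "((\<lambda>z. of_real pi * y powr lam * 2 powr (\<mu> + z - 1) / (sin (z * of_real pi) / z) * (H z / z)) \<longlongrightarrow>
     of_real pi * y powr lam * 2 powr (\<mu> + 0 - 1) / of_real pi * ?F) (at 0)"
    by (intro tendsto_intros l1 l2 l3) auto
  moreover have "\<forall>\<^sub>F z in at 0. of_real pi * y powr lam * 2 powr (\<mu> + z - 1) / (sin (z * of_real pi) / z) * (H z / z) =
     gen_besselK_nonint \<mu> z y lam"
  proof -
    have "\<forall>\<^sub>F z in at (0::complex). z \<in> ball 0 (1/4) - {0}"
      unfolding eventually_at by (intro exI[of _ "1/4"]) (auto simp: dist_commute)
    then show ?thesis
    proof eventually_elim
      case (elim z)
      then show ?case using gen_besselK_nonint_eq[OF s' y, of z] by (simp add: H_def)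
    qed
  qed
  ultimately have "((\<lambda>z. gen_besselK_nonint \<mu> z y lam) \<longlongrightarrow> of_real pi * y powr lam * 2 powr (\<mu> + 0 - 1) / of_real pi * ?F) (at 0)"
    by (rule Lim_transform_eventually)
  then show ?thesis by (simp add: gen_besselK_def tendsto_Lim)
qed

theorem theorem1p8:
  fixes x \<mu> lam :: complex
  assumes "Re x > 0" and "Re (\<mu> + lam) > 0"
  shows "let f = (\<lambda>n::nat. (of_nat n * x / 2) powr (- lam) * gen_besselK \<mu> 0 (of_nat n * x) lam);
             g = (\<lambda>n::nat. 1 / of_nat n *
                   div_Gamma (\<lambda>c. hyp2F1 (1/2) (1/2 + lam + \<mu>) c
                                    (- (x\<^sup>2 / (4 * (of_real pi)\<^sup>2 * (of_nat n)\<^sup>2))) - 1)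
                             (1/2 + lam))
         in summable (\<lambda>n. f (Suc n)) \<and> summable (\<lambda>n. g (Suc n)) \<and>
            2 * (\<Sum>n. f (Suc n))
              - of_real pi * 2 powr (\<mu> + lam) * Gamma (lam + \<mu>) / x * rGamma lam
            = 2 powr (\<mu> + lam) * Gamma (1/2 + lam + \<mu>) * (\<Sum>n. g (Suc n))
              + 2 powr (\<mu> + lam - 1) * Gamma (1/2 + lam + \<mu>) *
                div_Gamma (\<lambda>c. 2 * (euler_mascheroni + Ln (x / (4 * of_real pi)))
                                  - Digamma c + Digamma (lam + \<mu> + 1/2))
                          (lam + 1/2)"
proof -
  define s where "s = 1/2 + lam + \<mu>"
  define c where "c = 1/2 + lam"
  define f where "f = (\<lambda>n::nat. (of_nat n * x / 2) powr (- lam) * gen_besselK \<mu> 0 (of_nat n * x) lam)"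
  define g where "g = (\<lambda>n::nat. 1 / of_nat n *
                   div_Gamma (\<lambda>c. hyp2F1 (1/2) s c (- (x\<^sup>2 / (4 * (of_real pi)\<^sup>2 * (of_nat n)\<^sup>2))) - 1) c)"
  define L where "L = euler_mascheroni + Ln (x / (4 * of_real pi))"
  have s: "Re s > 1/2" using assms(2) by (simp add: s_def)
  have sc: "\<mu> + lam + 1/2 = s" "lam + 1/2 = c" "lam + \<mu> + 1/2 = s" by (auto simp: s_def c_def)
  have f: "f (Suc n) = 2 powr (\<mu> + lam - 1) * besselFC s c (of_nat (Suc n) * x)" for n
  proof -
    define y where "y = of_nat (Suc n) * x"
    have y: "Re y > 0" using assms(1) by (simp add: y_def del: of_nat_Suc)
    then have y0: "y \<noteq> 0" by auto
    \<comment> \<open>Division by a positive real does not cross the branch cut, so the two powers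
      combine to exactly 2^\<lambda>.\<close>
    have Ln2: "Ln (y / 2) = Ln y - Ln 2"
      using Ln_divide_of_real[of 2 y] Ln_of_real[of 2] y0 by simp
    have "(y / 2) powr (- lam) * y powr lam = 2 powr lam"
      using y0 by (simp add: powr_def Ln2 algebra_simps flip: exp_add)
    moreover have "f (Suc n) = ((y / 2) powr (- lam) * y powr lam) * (2 powr (\<mu> - 1) * besselFC s c y)"
      unfolding f_def y_def[symmetric] gen_besselK_0[OF assms(2) y] sc by (simp add: mult_ac)
    moreover have "2 powr lam * 2 powr (\<mu> - 1) = (2::complex) powr (\<mu> + lam - 1)"
      by (simp add: powr_add[symmetric] algebra_simps)
    ultimately show ?thesis by (simp add: y_def flip: mult.assoc)
  qed
  have g: "g (Suc n) = hyp_corr s x n c" for n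
  proof -
    have e: "- (x\<^sup>2 / (4 * (of_real pi)\<^sup>2 * (of_nat (Suc n))\<^sup>2)) = - (of_real (1 / (4 * pi\<^sup>2 * (real (Suc n))\<^sup>2)) * x\<^sup>2)"
      by simp
    have "- (of_real (1 / (4 * pi\<^sup>2 * (real (Suc n))\<^sup>2)) * x\<^sup>2) \<in> slit_plane"
      by (rule xi_slit[OF assms(1)]) simp
    from div_Gamma_hyp2F1_half[OF this] show ?thesis
      unfolding g_def e hyp_corr_def by simp
  qed
  \<comment> \<open>Off the poles psi(c) / Gamma(c) is \<open>- deriv rGamma c\<close>, so the right
    side is the required entire continuation.\<close>
  have D: "div_Gamma (\<lambda>c. 2 * L - Digamma c + Digamma s) c = (2 * L + Digamma s) * rGamma c + deriv rGamma c"
  proof (rule div_Gamma_eq)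
    have "(\<lambda>c. (2 * L + Digamma s) * rGamma c + deriv rGamma c) holomorphic_on UNIV"
      by (auto intro!: holomorphic_intros)
    then show "isCont (\<lambda>c. (2 * L + Digamma s) * rGamma c + deriv rGamma c) c"
      by (rule isCont_holomorphic_UNIV)
    fix w :: complex assume "w \<notin> \<int>\<^sub>\<le>\<^sub>0"
    then show "(2 * L - Digamma w + Digamma s) / Gamma w = (2 * L + Digamma s) * rGamma w + deriv rGamma w"
      by (simp add: deriv_rGamma_eq rGamma_inverse_Gamma divide_inverse algebra_simps)
  qed
  have sumF: "summable (\<lambda>n. besselFC s c (of_nat (Suc n) * x))"
    by (rule summable_norm_cancel[OF besselFC_sum_holomorphic(2)[OF s assms(1)]])
  have sf: "summable (\<lambda>n. f (Suc n))" unfolding f by (intro summable_mult sumF)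
  have sg: "summable (\<lambda>n. g (Suc n))"
    unfolding g by (rule summable_norm_cancel[OF hyp_corr_sum_holomorphic(2)[OF assms(1)]])
  have p2: "2 * (2::complex) powr (\<mu> + lam - 1) = 2 powr (\<mu> + lam)"
    by (simp add: powr_diff)
  have "2 * (\<Sum>n. f (Suc n)) = 2 powr (\<mu> + lam) * (\<Sum>n. besselFC s c (of_nat (Suc n) * x))"
    unfolding f suminf_mult[OF sumF] by (simp add: p2[symmetric])
  also have "\<dots> = 2 powr (\<mu> + lam) * (of_real pi / x * (Gamma (lam + \<mu>) * rGamma lam) +
     Gamma s * (rGamma c * L + (rGamma c * Digamma s + deriv rGamma c) / 2) + Gamma s * (\<Sum>n. g (Suc n)))"
  proof -
    have e: "s - 1/2 = lam + \<mu>" "c - 1/2 = lam" by (auto simp: s_def c_def)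
    show ?thesis using besselFC_sum[OF s assms(1), of c] unfolding g L_def e by simp
  qed
  finally have "2 * (\<Sum>n. f (Suc n)) - of_real pi * 2 powr (\<mu> + lam) * Gamma (lam + \<mu>) / x * rGamma lam
      = 2 powr (\<mu> + lam) * Gamma s * (\<Sum>n. g (Suc n)) + 2 powr (\<mu> + lam - 1) * Gamma s * ((2 * L + Digamma s) * rGamma c + deriv rGamma c)"
    unfolding p2[symmetric] by (simp add: algebra_simps)
  note main = this
  show ?thesis
    unfolding Let_def s_def[symmetric] unfolding sc c_def[symmetric] L_def[symmetric] D
    using sf sg main unfolding f_def g_def by (intro conjI)
qed

end
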